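(* Let $N/2<K<N$ be integers, $(k,\eta)\in\mathbb T_K\times\mathcal E_{N,K}$, and let $(X(t),\eta(t))_{t\ge0}$ be the Facilitated Exclusion Process with a tagged particle, started from $X(0)=x_k(\eta)$, $\eta(0)=\eta$. Let $k(t)=\sum_{y=1}^{X(t)}\eta_y(t)$ be the rank at time $t$ of the tagged particle, and let $\sigma(t)$ be the second coordinate of $\Phi(k(t),\eta(t))$ (whose first coordinate is $X(t)$). Then: 1. The process $(\sigma(t))_{t\ge0}$ is a Simple Symmetric Exclusion Process on $\mathbb T_K$ with $2K-N$ particles, started from $\sigma(0)$. 2. For all $t\ge0$, $X(t)-X(0)$ is equal, modulo $N$, to the total current through the edge $(K,1)$ from time $0$ to time $t$ in $(\sigma(s))_{0\le s\le t}$.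
   Context: For an integer $M$, $\mathbb T_M=\mathbb Z/M\mathbb Z$ with elements written $1,\dots,M$, and $\Gamma_{M,Q}=\{\eta\in\{0,1\}^{\mathbb T_M}:\sum_x\eta_x=Q\}$. $\mathcal E_{N,K}=\{\eta\in\Gamma_{N,K}:\eta_x+\eta_{x+1}\ge1\ \forall x\in\mathbb T_N\}$. $\eta^{x,y}$ denotes $\eta$ with the values at $x$ and $y$ exchanged. For $\eta\in\Gamma_{N,K}$, $k\in\{1,\dots,K\}$, $x_k(\eta)=\inf\{x\in\{1,\dots,N\}:\sum_{y=1}^x\eta_y=k\}$. The Facilitated Exclusion Process with a tagged particle is the Markov chain $(X(t),\eta(t))$, with $\eta(t)\in\mathcal E_{N,K}$ and $X(t)\in\mathbb T_N$ an occupied site of $\eta(t)$, with generator $$\mathcal L f(x,\eta)=\sum_{y\ne x}\eta_y\sum_{z=\pm1}\eta_{y-z}(1-\eta_{y+z})\big(f(x,\eta^{y,y+z})-f(x,\eta)\big)+\eta_x\sum_{z=\pm1}\eta_{x-z}(1-\eta_{x+z})\big(f(x+z,\eta^{x,x+z})-f(x,\eta)\big).$$ The map $\Phi:\mathbb T_K\times\mathcal E_{N,K}\to\mathbb T_N\times\Gamma_{K,2K-N}$ is $\Phi(k,\eta)=(x_k(\eta),\sigma^{(k,\eta)})$ with $\sigma^{(k,\eta)}_l=2-x_{k+l}(\eta)+x_{k+l-1}(\eta)$ for $l\in\mathbb T_K$, rank indices being taken in $\mathbb T_K$ and the difference $x_{k+l}(\eta)-x_{k+l-1}(\eta)$ modulo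 $N$ with representative in $\{1,\dots,N\}$. The Simple Symmetric Exclusion Process (SSEP) on $\mathbb T_K$ with $Q$ particles is the Markov chain on $\Gamma_{K,Q}$ with generator $\mathcal L f(\sigma)=\sum_{k\in\mathbb T_K}(\sigma_k(1-\sigma_{k+1})+(1-\sigma_k)\sigma_{k+1})(f(\sigma^{k,k+1})-f(\sigma))$. The current through the edge $(K,1)$ over a time interval is the number of particles that crossed it from $K$ to $1$ minus the number that crossed it from $1$ to $K$. *)

theory Defs
  imports "HOL-Probability.Probability" "HOL-Number_Theory.Cong"
begin

section \<open>Continuous-time Markov chains with a given bounded generator\<close>

text \<open>A generator is an operator on real functions of the state. Its semigroup is the exponential
  series, which converges pointwise for bounded \<open>f\<close> as soon as the jump rates are bounded.\<close>

definition markov_semigroup :: "(('s \<Rightarrow> real) \<Rightarrow> 's \<Rightarrow> real) \<Rightarrow> real \<Rightarrow> ('s \<Rightarrow> real) \<Rightarrow> 's \<Rightarrow> real" where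
  "markov_semigroup L t f s = (\<Sum>n. t ^ n / fact n * (L ^^ n) f s)"

definition transition_prob :: "(('s \<Rightarrow> real) \<Rightarrow> 's \<Rightarrow> real) \<Rightarrow> real \<Rightarrow> 's \<Rightarrow> 's \<Rightarrow> real" where
  "transition_prob L t s s' = markov_semigroup L t (indicator {s'}) s"

text \<open>Right-continuity and left limits, for paths in a discrete space.\<close>

definition cadlag_path :: "(real \<Rightarrow> 's) \<Rightarrow> bool" where
  "cadlag_path p \<longleftrightarrow>
     (\<forall>t\<ge>0. \<forall>\<^sub>F u in at_right t. p u = p t) \<and>
     (\<forall>t>0. \<exists>a. \<forall>\<^sub>F u in at_left t. p u = a)"

text \<open>\<open>Y\<close> is a Markov chain on the countable set \<open>S\<close> with generator \<open>L\<close>, started from \<open>s0\<close>.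
  The last clause is the Markov property with transition function \<open>transition_prob L\<close>,
  multiplied out so that no conditioning on null events occurs.\<close>

definition markov_chain ::
  "'w measure \<Rightarrow> 's set \<Rightarrow> (('s \<Rightarrow> real) \<Rightarrow> 's \<Rightarrow> real) \<Rightarrow> 's \<Rightarrow> (real \<Rightarrow> 'w \<Rightarrow> 's) \<Rightarrow> bool" where
  "markov_chain M S L s0 Y \<longleftrightarrow>
     prob_space M \<and>
     (\<forall>t\<ge>0. Y t \<in> measurable M (count_space S)) \<and>
     (AE \<omega> in M. cadlag_path (\<lambda>t. Y t \<omega>)) \<and>
     (AE \<omega> in M. Y 0 \<omega> = s0) \<and>
     (\<forall>(n::nat) (t :: nat \<Rightarrow> real) (s :: nat \<Rightarrow> 's).
        0 \<le> t 0 \<longrightarrow> (\<forall>i\<le>n. t i < t (Suc i)) \<longrightarrow> (\<forall>i\<le>Suc n. s i \<in> S) \<longrightarrow>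
        measure M {\<omega> \<in> space M. \<forall>i\<le>Suc n. Y (t i) \<omega> = s i} =
        measure M {\<omega> \<in> space M. \<forall>i\<le>n. Y (t i) \<omega> = s i} *
          transition_prob L (t (Suc n) - t n) (s n) (s (Suc n)))"

section \<open>Configurations on the discrete torus\<close>

definition torus :: "int \<Rightarrow> int set" where
  "torus M = {1..M}"

text \<open>The representative in \<open>{1..M}\<close> of an integer modulo \<open>M\<close>.\<close>

definition rep :: "int \<Rightarrow> int \<Rightarrow> int" where
  "rep M x = (x - 1) mod M + 1"

type_synonym config = "int \<Rightarrow> int"

definition Gam :: "int \<Rightarrow> int \<Rightarrow> config set" where
  "Gam M Q = {\<eta> \<in> torus M \<rightarrow>\<^sub>E {0, 1}. (\<Sum>x\<in>torus M. \<eta> x) = Q}"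

definition Erg :: "int \<Rightarrow> int \<Rightarrow> config set" where
  "Erg N K = {\<eta> \<in> Gam N K. \<forall>x\<in>torus N. \<eta> x + \<eta> (rep N (x + 1)) \<ge> 1}"

definition exchange :: "int \<Rightarrow> int \<Rightarrow> config \<Rightarrow> config" where
  "exchange x y \<eta> = \<eta>(x := \<eta> y, y := \<eta> x)"

section \<open>The facilitated exclusion process with a tagged particle\<close>

definition tagged_states :: "int \<Rightarrow> int \<Rightarrow> (int \<times> config) set" where
  "tagged_states N K = {(x, \<eta>). \<eta> \<in> Erg N K \<and> x \<in> torus N \<and> \<eta> x = 1}"

definition fep_rate :: "int \<Rightarrow> config \<Rightarrow> int \<Rightarrow> int \<Rightarrow> real" where
  "fep_rate N \<eta> y z = real_of_int (\<eta> y * \<eta> (rep N (y - z)) * (1 - \<eta> (rep N (y + z))))"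

definition fep_gen :: "int \<Rightarrow> (int \<times> config \<Rightarrow> real) \<Rightarrow> int \<times> config \<Rightarrow> real" where
  "fep_gen N f = (\<lambda>(x, \<eta>).
     (\<Sum>y\<in>torus N - {x}. \<Sum>z\<in>{1, -1}.
        fep_rate N \<eta> y z * (f (x, exchange y (rep N (y + z)) \<eta>) - f (x, \<eta>))) +
     (\<Sum>z\<in>{1, -1}.
        fep_rate N \<eta> x z * (f (rep N (x + z), exchange x (rep N (x + z)) \<eta>) - f (x, \<eta>))))"

definition particle_pos :: "int \<Rightarrow> config \<Rightarrow> int \<Rightarrow> int" where
  "particle_pos N \<eta> k = Inf {x \<in> {1..N}. (\<Sum>y\<in>{1..x}. \<eta> y) = k}"

definition particle_rank :: "config \<Rightarrow> int \<Rightarrow> int" where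
  "particle_rank \<eta> x = (\<Sum>y\<in>{1..x}. \<eta> y)"

definition Phi :: "int \<Rightarrow> int \<Rightarrow> int \<times> config \<Rightarrow> int \<times> config" where
  "Phi N K = (\<lambda>(k, \<eta>).
     (particle_pos N \<eta> k,
      \<lambda>l\<in>torus K. 2 - rep N (particle_pos N \<eta> (rep K (k + l)) - particle_pos N \<eta> (rep K (k + l - 1)))))"

section \<open>The symmetric simple exclusion process and its current\<close>

definition ssep_gen :: "int \<Rightarrow> (config \<Rightarrow> real) \<Rightarrow> config \<Rightarrow> real" where
  "ssep_gen K f \<sigma> =
     (\<Sum>k\<in>torus K.
        real_of_int (\<sigma> k * (1 - \<sigma> (rep K (k + 1))) + (1 - \<sigma> k) * \<sigma> (rep K (k + 1))) *
        (f (exchange k (rep K (k + 1)) \<sigma>) - f \<sigma>))"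

definition left_value :: "(real \<Rightarrow> 's) \<Rightarrow> real \<Rightarrow> 's" where
  "left_value p t = (THE a. \<forall>\<^sub>F u in at_left t. p u = a)"

text \<open>Times in \<open>(0,t]\<close> at which a particle jumps from \<open>a\<close> to \<open>b\<close>.\<close>

definition crossings :: "(real \<Rightarrow> config) \<Rightarrow> real \<Rightarrow> int \<Rightarrow> int \<Rightarrow> real set" where
  "crossings p t a b =
     {u \<in> {0<..t}. left_value p u a = 1 \<and> left_value p u b = 0 \<and>
                   p u = exchange a b (left_value p u)}"

text \<open>Net number of crossings of the edge \<open>(K,1)\<close>, counted positively from \<open>K\<close> to \<open>1\<close>. It is read
  off from the path, which is meaningful for \<open>K \<ge> 3\<close> only: on the torus with two sites the edges
  \<open>(1,2)\<close> and \<open>(2,1)\<close> have the same endpoints, and the path does not tell which of them was used.\<close>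

definition path_current :: "int \<Rightarrow> (real \<Rightarrow> config) \<Rightarrow> real \<Rightarrow> int" where
  "path_current K p t = int (card (crossings p t K 1)) - int (card (crossings p t 1 K))"

text \<open>The generator of the exclusion process together with the integer counter of its net crossings
  of the edge \<open>(K,1)\<close>: each edge acts on the configuration as in \<^const>\<open>ssep_gen\<close>, and
  only an exchange through the edge \<open>(K,1)\<close> changes the counter. This defines the current also
  for \<open>K = 2\<close>.\<close>

definition ssep_current_gen :: "int \<Rightarrow> (config \<times> int \<Rightarrow> real) \<Rightarrow> config \<times> int \<Rightarrow> real" where
  "ssep_current_gen K f = (\<lambda>(\<sigma>, j).
     (\<Sum>k\<in>torus K - {K}.
        real_of_int (\<sigma> k * (1 - \<sigma> (rep K (k + 1))) + (1 - \<sigma> k) * \<sigma> (rep K (k + 1))) *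
        (f (exchange k (rep K (k + 1)) \<sigma>, j) - f (\<sigma>, j))) +
     real_of_int (\<sigma> K * (1 - \<sigma> 1)) * (f (exchange K 1 \<sigma>, j + 1) - f (\<sigma>, j)) +
     real_of_int ((1 - \<sigma> K) * \<sigma> 1) * (f (exchange K 1 \<sigma>, j - 1) - f (\<sigma>, j)))"

end

(* Relative to the tagged particle, the gaps between consecutive particles are 1 or 2, and a jump
   of the l-th particle lengthens the gap on one side and shortens the one on the other: on the gap
   configuration this is an exchange of the sites l and l+1, performed at rate 1. Hence the gap
   configuration intertwines the two generators and is a lumping of the tagged process. The jumps
   of the tagged particle itself are the exchanges through the edge (K,1).

   For K >= 3 the current is a sum over the jumps of the path, and almost surely every jump is one
   that the generator allows: over a grid of mesh T/m the probability of seeing another one is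
   O(1/m). For K = 2 the counter J is the sum of the signed displacements over all jumps. On a fine
   grid it is a sum of increments, which turns its law into an m-step iteration of a kernel
   1 + (t/m) L + O(1/m^2) for the lifted generator L, and the Chernoff product formula identifies
   the limit with the semigroup of L. *)

theory Submission
  imports Defs
begin

section \<open>Semigroups of bounded operators\<close>

text \<open>Individual jumps are therefore recovered from grids: a cadlag path in a discrete space
  has finitely many jumps in a bounded interval, and a fine enough grid isolates them. How fine
  depends on the path, so such facts hold eventually in the mesh and reach probabilities by
  dominated convergence.

  With two sites, the path of \<open>\<sigma>\<close> does not show which edge was used, so the
  counter is built from the tagged path. It depends on the whole past, and cylinder events of the
  tagged process alone do not carry an induction over times; a class of events closed under almost
  sure limits does.

  The combinatorics lives on the integers: the occupied sites of the periodic extension form an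
  increasing sequence \<open>p\<close> indexed from the tagged particle, and a jump adds
  \<open>1\<close> or \<open>-1\<close> to \<open>p\<close> on one residue class modulo
  \<open>K\<close>. The tag has index \<open>0\<close>, whose representative on the torus is
  \<open>K\<close>; this singles out the edge between \<open>K\<close> and \<open>1\<close>.\<close>

definition bounded_on :: "'s set \<Rightarrow> ('s \<Rightarrow> real) \<Rightarrow> bool" where
  "bounded_on S f \<longleftrightarrow> (\<exists>B. \<forall>s\<in>S. \<bar>f s\<bar> \<le> B)"

lemma bounded_onI: "(\<And>s. s \<in> S \<Longrightarrow> \<bar>f s\<bar> \<le> B) \<Longrightarrow> bounded_on S f"
  unfolding bounded_on_def by blast

lemma bounded_on_finite: "finite S \<Longrightarrow> bounded_on S f"
  by (rule bounded_onI[where B = "\<Sum>s\<in>S. \<bar>f s\<bar>"]) (auto intro: member_le_sum)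

lemma bounded_on_indicator [intro]: "bounded_on S (indicator A)"
  by (rule bounded_onI[where B = 1]) (auto simp: indicator_def)

lemma bounded_on_add [intro]:
  "bounded_on S f \<Longrightarrow> bounded_on S g \<Longrightarrow> bounded_on S (\<lambda>x. f x + g x)"
  unfolding bounded_on_def by (meson abs_triangle_ineq add_mono order_trans)

lemma bounded_on_scale [intro]:
  assumes "bounded_on S f" shows "bounded_on S (\<lambda>x. c * f x)"
proof -
  obtain B where "\<And>s. s \<in> S \<Longrightarrow> \<bar>f s\<bar> \<le> B" using assms unfolding bounded_on_def by blast
  then have "\<bar>c * f s\<bar> \<le> \<bar>c\<bar> * B" if "s \<in> S" for s
    using that by (simp add: abs_mult mult_left_mono)
  then show ?thesis by (rule bounded_onI)
qed

lemma bounded_on_sum [intro]: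
  "(\<And>a. a \<in> A \<Longrightarrow> bounded_on S (f a)) \<Longrightarrow> bounded_on S (\<lambda>x. \<Sum>a\<in>A. f a x)"
proof (induction A rule: infinite_finite_induct)
  case (insert a A)
  then show ?case by (simp add: bounded_on_add)
qed (auto intro: bounded_onI[where B = 0])

lemma bounded_on_cong: "(\<And>s. s \<in> S \<Longrightarrow> f s = g s) \<Longrightarrow> bounded_on S f = bounded_on S g"
  unfolding bounded_on_def by simp

text \<open>Operators act on functions of the whole type, whereas only \<open>S\<close> is
  meaningful. The laws are therefore restricted to \<open>S\<close>, and \<open>C\<close> bounds the
  operator norm for the supremum over \<open>S\<close>.\<close>

locale bounded_operator =
  fixes S :: "'s set" and L :: "('s \<Rightarrow> real) \<Rightarrow> 's \<Rightarrow> real" and C :: real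
  assumes C_nonneg: "0 \<le> C"
    and add: "bounded_on S f \<Longrightarrow> bounded_on S g \<Longrightarrow> s \<in> S \<Longrightarrow> L (\<lambda>x. f x + g x) s = L f s + L g s"
    and scale: "bounded_on S f \<Longrightarrow> s \<in> S \<Longrightarrow> L (\<lambda>x. c * f x) s = c * L f s"
    and bound: "(\<And>x. x \<in> S \<Longrightarrow> \<bar>f x\<bar> \<le> B) \<Longrightarrow> s \<in> S \<Longrightarrow> \<bar>L f s\<bar> \<le> C * B"
begin

lemma bounded_image: "bounded_on S f \<Longrightarrow> bounded_on S (L f)"
  unfolding bounded_on_def using bound by meson

text \<open>Linearity reduces this to \<open>f - g\<close>, which is bounded by \<open>0\<close> on
  \<open>S\<close>; \<open>bound\<close> with \<open>B = 0\<close> makes its image vanish. So values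
  outside \<open>S\<close> never matter.\<close>

lemma cong:
  assumes "bounded_on S f" "\<And>x. x \<in> S \<Longrightarrow> f x = g x" "s \<in> S"
  shows "L f s = L g s"
proof -
  have g: "bounded_on S g" using assms(1) bounded_on_cong[of S f g] assms(2) by auto
  have "\<bar>L (\<lambda>x. f x + (-1) * g x) s\<bar> \<le> C * 0"
    by (rule bound) (use assms in auto)
  moreover have "L (\<lambda>x. f x + (-1) * g x) s = L f s + L (\<lambda>x. (-1) * g x) s"
    by (rule add[OF assms(1) bounded_on_scale[OF g] assms(3)])
  moreover have "L (\<lambda>x. (-1) * g x) s = (-1) * L g s" by (rule scale[OF g assms(3)])
  ultimately show ?thesis by linarith
qed

lemma zero: "s \<in> S \<Longrightarrow> L (\<lambda>x. 0) s = 0"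
  using bound[of "\<lambda>x. 0" 0 s] by simp

lemma sum:
  assumes "\<And>a. a \<in> A \<Longrightarrow> bounded_on S (f a)" "s \<in> S"
  shows "L (\<lambda>x. \<Sum>a\<in>A. c a * f a x) s = (\<Sum>a\<in>A. c a * L (f a) s)"
  using assms
proof (induction A rule: infinite_finite_induct)
  case (insert a A)
  have "bounded_on S (\<lambda>x. c a * f a x)" "bounded_on S (\<lambda>x. \<Sum>a\<in>A. c a * f a x)"
    by (intro bounded_on_sum bounded_on_scale insert.prems(1); simp)+
  moreover have "bounded_on S (f a)" using insert by auto
  moreover have "L (\<lambda>x. \<Sum>a\<in>A. c a * f a x) s = (\<Sum>a\<in>A. c a * L (f a) s)"
    using insert by blast
  ultimately show ?case using insert.hyps insert.prems(2) by (simp add: add scale)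
qed (simp_all add: zero)

end

lemma bounded_operator_id: "bounded_operator S (\<lambda>f. f) 1"
  by unfold_locales auto

lemma bounded_operator_comp:
  assumes "bounded_operator S L C" "bounded_operator S K D"
  shows "bounded_operator S (\<lambda>f. L (K f)) (C * D)"
proof -
  interpret L: bounded_operator S L C by fact
  interpret K: bounded_operator S K D by fact
  show ?thesis
  proof
    show "0 \<le> C * D" by (simp add: L.C_nonneg K.C_nonneg)
  next
    fix f g s assume *: "bounded_on S f" "bounded_on S g" "s \<in> S"
    have "L (K (\<lambda>x. f x + g x)) s = L (\<lambda>x. K f x + K g x) s"
      by (rule L.cong) (use * K.add in \<open>auto intro!: K.bounded_image\<close>)
    then show "L (K (\<lambda>x. f x + g x)) s = L (K f) s + L (K g) s"
      using * by (simp add: L.add K.bounded_image)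
  next
    fix f s c assume *: "bounded_on S f" "s \<in> S"
    have "L (K (\<lambda>x. c * f x)) s = L (\<lambda>x. c * K f x) s"
      by (rule L.cong) (use * K.scale in \<open>auto intro!: K.bounded_image\<close>)
    then show "L (K (\<lambda>x. c * f x)) s = c * L (K f) s"
      using * by (simp add: L.scale K.bounded_image)
  next
    fix f :: "'a \<Rightarrow> real" and B s assume *: "\<And>x. x \<in> S \<Longrightarrow> \<bar>f x\<bar> \<le> B" "s \<in> S"
    then have "\<bar>L (K f) s\<bar> \<le> C * (D * B)" by (intro L.bound K.bound) auto
    then show "\<bar>L (K f) s\<bar> \<le> C * D * B" by (simp add: mult.assoc)
  qed
qed

lemma (in bounded_operator) funpow: "bounded_operator S (L ^^ n) (C ^ n)"
proof (induction n)
  case 0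
  then show ?case using bounded_operator_id by (simp add: id_def)
next
  case (Suc n)
  then show ?case
    using bounded_operator_comp[OF bounded_operator_axioms Suc] by (simp add: comp_def)
qed

context bounded_operator
begin

lemma funpow_bound:
  "(\<And>x. x \<in> S \<Longrightarrow> \<bar>f x\<bar> \<le> B) \<Longrightarrow> s \<in> S \<Longrightarrow> \<bar>(L ^^ n) f s\<bar> \<le> C ^ n * B"
  using funpow by (rule bounded_operator.bound)

lemma funpow_bounded: "bounded_on S f \<Longrightarrow> bounded_on S ((L ^^ n) f)"
  using funpow by (rule bounded_operator.bounded_image)

lemma semigroup_term_bound:
  assumes "\<And>x. x \<in> S \<Longrightarrow> \<bar>f x\<bar> \<le> B" "s \<in> S" "0 \<le> t"
  shows "\<bar>t ^ n / fact n * (L ^^ n) f s\<bar> \<le> (C * t) ^ n / fact n * B"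
proof -
  have "\<bar>t ^ n / fact n * (L ^^ n) f s\<bar> = t ^ n / fact n * \<bar>(L ^^ n) f s\<bar>"
    using assms by (simp add: abs_mult)
  also have "\<dots> \<le> t ^ n / fact n * (C ^ n * B)"
    using assms by (intro mult_left_mono funpow_bound) auto
  finally show ?thesis by (simp add: power_mult_distrib mult_ac)
qed

lemma exp_sums: "(\<lambda>n. (C * t) ^ n / fact n * B) sums (exp (C * t) * B)"
  using sums_mult2[OF exp_converges[of "C * t"], of B] by (simp add: scaleR_conv_of_real field_simps)

lemma semigroup_summable:
  assumes "bounded_on S f" "s \<in> S" "0 \<le> t"
  shows "summable (\<lambda>n. t ^ n / fact n * (L ^^ n) f s)"
proof -
  obtain B where B: "\<And>x. x \<in> S \<Longrightarrow> \<bar>f x\<bar> \<le> B" using assms unfolding bounded_on_def by blast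
  show ?thesis
    by (rule summable_comparison_test[OF _ sums_summable[OF exp_sums[of t B]]])
      (use semigroup_term_bound[OF B assms(2,3)] in auto)
qed

lemma semigroup_bounded_operator:
  assumes t: "0 \<le> t"
  shows "bounded_operator S (markov_semigroup L t) (exp (C * t))"
proof
  show "0 \<le> exp (C * t)" by simp
next
  fix f g s assume *: "bounded_on S f" "bounded_on S g" "s \<in> S"
  have "t ^ n / fact n * (L ^^ n) (\<lambda>x. f x + g x) s =
      t ^ n / fact n * (L ^^ n) f s + t ^ n / fact n * (L ^^ n) g s" for n
    using bounded_operator.add[OF funpow * ] by (simp add: algebra_simps add_divide_distrib)
  then show "markov_semigroup L t (\<lambda>x. f x + g x) s = markov_semigroup L t f s + markov_semigroup L t g s"
    unfolding markov_semigroup_def using * t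
    by (simp only: suminf_add[OF semigroup_summable semigroup_summable])
next
  fix f s c assume *: "bounded_on S f" "s \<in> S"
  have "t ^ n / fact n * (L ^^ n) (\<lambda>x. c * f x) s = c * (t ^ n / fact n * (L ^^ n) f s)" for n
    using bounded_operator.scale[OF funpow * ] by simp
  then show "markov_semigroup L t (\<lambda>x. c * f x) s = c * markov_semigroup L t f s"
    unfolding markov_semigroup_def using suminf_mult[OF semigroup_summable[OF * t]] by presburger
next
  fix f :: "'s \<Rightarrow> real" and B s assume *: "\<And>x. x \<in> S \<Longrightarrow> \<bar>f x\<bar> \<le> B" "s \<in> S"
  have "norm (markov_semigroup L t f s) \<le> (\<Sum>n. (C * t) ^ n / fact n * B)"
    unfolding markov_semigroup_def
    by (rule norm_suminf_le) (use exp_sums[of t B] semigroup_term_bound[OF *] t in \<open>auto simp: sums_iff\<close>)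
  then show "\<bar>markov_semigroup L t f s\<bar> \<le> exp (C * t) * B"
    using exp_sums[of t B] by (simp add: sums_iff)
qed

text \<open>The remainder is quadratic in \<open>h\<close>, so over \<open>m\<close> steps of length
  \<open>t / m\<close> the errors add up to order \<open>1 / m\<close>.\<close>

lemma semigroup_taylor:
  assumes f: "\<And>x. x \<in> S \<Longrightarrow> \<bar>f x\<bar> \<le> B" and s: "s \<in> S" and h: "0 \<le> h"
  shows "\<bar>markov_semigroup L h f s - (f s + h * L f s)\<bar> \<le> (C * h)\<^sup>2 * exp (C * h) * B"
proof -
  let ?a = "\<lambda>n. h ^ n / fact n * (L ^^ n) f s"
  have B: "0 \<le> B" using f[OF s] by simp
  have summ: "summable ?a" by (rule semigroup_summable) (use f s h in \<open>auto intro: bounded_onI\<close>)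
  have "markov_semigroup L h f s = (\<Sum>n. ?a (n + 2)) + (\<Sum>i<2. ?a i)"
    unfolding markov_semigroup_def by (rule suminf_split_initial_segment[OF summ])
  then have eq: "markov_semigroup L h f s - (f s + h * L f s) = (\<Sum>n. ?a (n + 2))"
    by (simp add: numeral_2_eq_2)
  have ds: "(\<lambda>n. (C * h)\<^sup>2 * ((C * h) ^ n / fact n * B)) sums ((C * h)\<^sup>2 * (exp (C * h) * B))"
    by (rule sums_mult[OF exp_sums])
  have "norm (\<Sum>n. ?a (n + 2)) \<le> (\<Sum>n. (C * h)\<^sup>2 * ((C * h) ^ n / fact n * B))"
  proof (rule norm_suminf_le)
    show "summable (\<lambda>n. (C * h)\<^sup>2 * ((C * h) ^ n / fact n * B))" using ds by (simp add: sums_iff)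
    fix n
    have "norm (?a (n + 2)) \<le> (C * h) ^ (n + 2) / fact (n + 2) * B"
      using semigroup_term_bound[OF f s h, where n = "n + 2"] by simp
    \<comment> \<open>Weakening \<open>fact (n + 2)\<close> to \<open>fact n\<close> lets the square
      of \<open>C * h\<close> be pulled out of an exponential series.\<close>
    also have "\<dots> \<le> (C * h) ^ (n + 2) / fact n * B"
      using B C_nonneg h by (intro mult_right_mono divide_left_mono fact_mono) auto
    finally show "norm (?a (n + 2)) \<le> (C * h)\<^sup>2 * ((C * h) ^ n / fact n * B)"
      by (simp add: power_add mult_ac power2_eq_square)
  qed
  then show ?thesis using ds eq by (simp add: sums_iff mult.assoc)
qed

section \<open>Euler steps and the product formula\<close>

text \<open>From \<open>1 + C * h \<le> exp (C * h)\<close>. The exponential is chosen because its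
  \<open>m\<close>-th power at \<open>h = t / m\<close> is \<open>exp (C * t)\<close>, uniformly in
  \<open>m\<close>.\<close>

lemma euler_bounded_operator:
  assumes "0 \<le> h"
  shows "bounded_operator S (\<lambda>f x. f x + h * L f x) (exp (C * h))"
proof
  show "0 \<le> exp (C * h)" by simp
next
  fix f :: "'s \<Rightarrow> real" and B s assume *: "\<And>x. x \<in> S \<Longrightarrow> \<bar>f x\<bar> \<le> B" "s \<in> S"
  have "\<bar>f s + h * L f s\<bar> \<le> \<bar>f s\<bar> + h * \<bar>L f s\<bar>"
    using assms abs_triangle_ineq[of "f s" "h * L f s"] by (simp add: abs_mult)
  also have "\<dots> \<le> B + h * (C * B)"
    using bound[OF *] * assms by (intro add_mono mult_left_mono) auto
  also have "\<dots> = (1 + C * h) * B" by (simp add: algebra_simps)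
  also have "\<dots> \<le> exp (C * h) * B"
    using *(1)[OF *(2)] by (intro mult_right_mono exp_ge_add_one_self) linarith
  finally show "\<bar>f s + h * L f s\<bar> \<le> exp (C * h) * B" .
qed (auto simp: add scale algebra_simps)

text \<open>The binomial theorem for the identity and \<open>h * L\<close>. Linearity of
  \<open>L\<close> is available only on \<open>S\<close> and for bounded functions, hence the
  induction with \<open>cong\<close> at each step.\<close>

lemma euler_expand:
  assumes f: "bounded_on S f" and h: "0 \<le> h"
  shows "s \<in> S \<Longrightarrow>
    ((\<lambda>f x. f x + h * L f x) ^^ m) f s = (\<Sum>n\<le>m. real (m choose n) * h ^ n * (L ^^ n) f s)"
proof (induction m arbitrary: s)
  case 0
  then show ?case by simp
next
  case (Suc m)
  let ?E = "\<lambda>f x. f x + h * L f x" and ?c = "\<lambda>m n. real (m choose n) * h ^ n"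
  have b: "bounded_on S ((?E ^^ m) f)"
    by (rule bounded_operator.funpow_bounded[OF euler_bounded_operator]) fact+
  have "L ((?E ^^ m) f) s = L (\<lambda>x. \<Sum>n\<le>m. ?c m n * (L ^^ n) f x) s"
    by (rule cong) (use b Suc in auto)
  also have "\<dots> = (\<Sum>n\<le>m. ?c m n * (L ^^ Suc n) f s)"
    using Suc.prems f by (subst sum) (auto simp: funpow_bounded)
  finally have "(?E ^^ Suc m) f s =
      (\<Sum>n\<le>m. ?c m n * (L ^^ n) f s) + h * (\<Sum>n\<le>m. ?c m n * (L ^^ Suc n) f s)"
    using Suc by simp
  also have "(\<Sum>n\<le>m. ?c m n * (L ^^ n) f s) = (\<Sum>n\<le>Suc m. ?c m n * (L ^^ n) f s)"
    by (simp add: binomial_eq_0)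
  \<comment> \<open>Splitting off \<open>n = 0\<close> aligns both sums at
    \<open>L ^^ Suc n\<close>; their coefficients then combine by Pascal's rule.\<close>
  also have "\<dots> = f s + (\<Sum>n\<le>m. ?c m (Suc n) * (L ^^ Suc n) f s)"
    by (subst sum.atMost_Suc_shift) simp
  also have "\<dots> + h * (\<Sum>n\<le>m. ?c m n * (L ^^ Suc n) f s) =
      f s + (\<Sum>n\<le>m. ?c (Suc m) (Suc n) * (L ^^ Suc n) f s)"
    by (simp add: sum_distrib_left sum.distrib[symmetric] algebra_simps)
  also have "\<dots> = (\<Sum>n\<le>Suc m. ?c (Suc m) n * (L ^^ n) f s)"
    by (subst sum.atMost_Suc_shift) simp
  finally show ?case .
qed

end

text \<open>Supplies the majorant, uniform in \<open>m\<close>, under which the limit may be taken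
  inside the series.\<close>

lemma binomial_over_power_le:
  assumes "m > 0"
  shows "real (m choose n) / real m ^ n \<le> 1 / fact n"
proof -
  have "real ((m choose n) * fact n) \<le> real (m ^ n)"
    using binomial_fact_pow[of m n] by (intro of_nat_mono) 
  then show ?thesis using assms by (simp add: field_simps)
qed

text \<open>For fixed \<open>n\<close> the quotient is a product of \<open>n\<close> factors
  \<open>(m - i) / m\<close>, each tending to \<open>1\<close>, divided by
  \<open>fact n\<close>.\<close>

lemma tendsto_binomial_over_power:
  "(\<lambda>m. real (m choose n) / real m ^ n) \<longlonglongrightarrow> 1 / fact n"
proof -
  have "(\<lambda>m. (\<Prod>i<n. (real m - real i) / real m) / fact n) \<longlonglongrightarrow> (\<Prod>i<n. 1) / fact n"
  proof (intro tendsto_divide tendsto_prod tendsto_const)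
    fix i
    have "(\<lambda>m. 1 - real i / real m) \<longlonglongrightarrow> 1 - 0"
      by (intro tendsto_diff tendsto_const real_tendsto_divide_at_top[OF tendsto_const] filterlim_real_sequentially)
    moreover have "\<forall>\<^sub>F m in sequentially. 1 - real i / real m = (real m - real i) / real m"
      using eventually_gt_at_top[of 0] by eventually_elim (simp add: field_simps)
    ultimately show "(\<lambda>m. (real m - real i) / real m) \<longlonglongrightarrow> 1"
      by (simp add: tendsto_cong)
  qed auto
  moreover have "(\<Prod>i<n. (real m - real i) / real m) / fact n = real (m choose n) / real m ^ n" for m
    by (simp add: binomial_gbinomial gbinomial_prod_rev prod_dividef atLeast0LessThan)
  ultimately show ?thesis by simp
qed

context bounded_operator
begin

text \<open>The operator form of the limit of \<open>(1 + t / m) ^ m\<close>: the binomial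
  coefficients converge for each \<open>n\<close> and are dominated uniformly in \<open>m\<close>,
  so Tannery's theorem applies.\<close>

lemma euler_limit:
  assumes f: "bounded_on S f" and s: "s \<in> S" and t: "0 \<le> t"
  shows "(\<lambda>m. ((\<lambda>f x. f x + t / real m * L f x) ^^ m) f s) \<longlonglongrightarrow> markov_semigroup L t f s"
proof -
  obtain B where B: "\<And>x. x \<in> S \<Longrightarrow> \<bar>f x\<bar> \<le> B" using f unfolding bounded_on_def by blast
  let ?a = "\<lambda>n m. real (m choose n) / real m ^ n * (t ^ n * (L ^^ n) f s)"
  have *: "(\<lambda>m. \<Sum>n. ?a n m) \<longlonglongrightarrow> (\<Sum>n. t ^ n / fact n * (L ^^ n) f s)"
  proof (rule tannerys_theorem[THEN conjunct2, THEN conjunct2])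
    fix n
    have "(\<lambda>m. ?a n m) \<longlonglongrightarrow> 1 / fact n * (t ^ n * (L ^^ n) f s)"
      by (intro tendsto_mult tendsto_binomial_over_power tendsto_const)
    then show "(\<lambda>m. ?a n m) \<longlonglongrightarrow> t ^ n / fact n * (L ^^ n) f s" by simp
  next
    show "\<forall>\<^sub>F (n, m) in sequentially \<times>\<^sub>F sequentially. norm (?a n m) \<le> (C * t) ^ n / fact n * B"
    proof -
      have "\<forall>\<^sub>F m in sequentially. \<forall>n. norm (?a n m) \<le> (C * t) ^ n / fact n * B"
        using eventually_gt_at_top[of 0]
      proof eventually_elim
        case (elim m)
        show ?case
        proof
          fix n
          have "norm (?a n m) = real (m choose n) / real m ^ n * \<bar>t ^ n * (L ^^ n) f s\<bar>"
            by (simp add: abs_mult)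
          also have "\<dots> \<le> 1 / fact n * \<bar>t ^ n * (L ^^ n) f s\<bar>"
            using elim by (intro mult_right_mono binomial_over_power_le) auto
          also have "\<dots> = \<bar>t ^ n / fact n * (L ^^ n) f s\<bar>" by (simp add: abs_mult)
          also have "\<dots> \<le> (C * t) ^ n / fact n * B" by (rule semigroup_term_bound[OF B s t])
          finally show "norm (?a n m) \<le> (C * t) ^ n / fact n * B" .
        qed
      qed
      then show ?thesis
        by (subst eventually_prod_sequentially) (auto simp: eventually_sequentially)
    qed
  next
    show "summable (\<lambda>n. (C * t) ^ n / fact n * B)" using exp_sums[of t B] by (simp add: sums_iff)
  qed auto
  have "((\<lambda>f x. f x + t / real m * L f x) ^^ m) f s = (\<Sum>n. ?a n m)" for m
  proof -
    have "((\<lambda>f x. f x + t / real m * L f x) ^^ m) f s = (\<Sum>n\<le>m. ?a n m)"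
      using t by (subst euler_expand[OF f _ s]) (auto simp: power_divide intro!: sum.cong)
    also have "\<dots> = (\<Sum>n. ?a n m)"
      by (rule suminf_finite[symmetric]) (auto simp: binomial_eq_0)
    finally show ?thesis .
  qed
  then show ?thesis using * by (simp add: markov_semigroup_def)
qed

text \<open>A one-step error of order \<open>\<epsilon>\<close> telescopes to at most \<open>m * \<epsilon>\<close> after \<open>m\<close> steps.\<close>

lemma funpow_diff_bound:
  assumes P: "bounded_operator S P D" and LD: "bounded_operator S L D" and D: "1 \<le> D" and e: "0 \<le> \<epsilon>"
    and diff: "\<And>f B s. (\<And>x. x \<in> S \<Longrightarrow> \<bar>f x\<bar> \<le> B) \<Longrightarrow> s \<in> S \<Longrightarrow> \<bar>P f s - L f s\<bar> \<le> \<epsilon> * B"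
    and f: "\<And>x. x \<in> S \<Longrightarrow> \<bar>f x\<bar> \<le> B"
  shows "s \<in> S \<Longrightarrow> \<bar>(P ^^ m) f s - (L ^^ m) f s\<bar> \<le> real m * \<epsilon> * D ^ m * B"
proof (induction m arbitrary: s)
  case 0
  then show ?case by simp
next
  case (Suc m)
  interpret P: bounded_operator S P D by fact
  have B: "0 \<le> B" using f[OF Suc.prems] by simp
  have fb: "bounded_on S f" using f by (rule bounded_onI)
  have L: "\<bar>(L ^^ m) f x\<bar> \<le> D ^ m * B" if "x \<in> S" for x
    using bounded_operator.funpow_bound[OF LD f that] .
  have 1: "\<bar>P ((L ^^ m) f) s - L ((L ^^ m) f) s\<bar> \<le> \<epsilon> * (D ^ m * B)"
    by (rule diff[OF L Suc.prems])
  have "\<bar>P (\<lambda>x. (P ^^ m) f x + (-1) * (L ^^ m) f x) s\<bar> \<le> D * (real m * \<epsilon> * D ^ m * B)"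
    using Suc by (intro P.bound) auto
  moreover have "P (\<lambda>x. (P ^^ m) f x + (-1) * (L ^^ m) f x) s = P ((P ^^ m) f) s + P (\<lambda>x. (-1) * (L ^^ m) f x) s"
    by (rule P.add[OF P.funpow_bounded[OF fb] bounded_on_scale[OF funpow_bounded[OF fb]] Suc.prems])
  moreover have "P (\<lambda>x. (-1) * (L ^^ m) f x) s = (-1) * P ((L ^^ m) f) s"
    by (rule P.scale[OF funpow_bounded[OF fb] Suc.prems])
  ultimately have 2: "\<bar>P ((P ^^ m) f) s - P ((L ^^ m) f) s\<bar> \<le> real m * \<epsilon> * D ^ Suc m * B"
    by (simp add: mult_ac)
  have "D ^ m \<le> D ^ Suc m" using D by (simp add: mult_le_cancel_right1)
  then have "\<epsilon> * (D ^ m * B) \<le> \<epsilon> * (D ^ Suc m * B)"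
    using e B by (intro mult_left_mono mult_right_mono) auto
  then have "\<bar>P ((P ^^ m) f) s - L ((L ^^ m) f) s\<bar> \<le> \<epsilon> * (D ^ Suc m * B) + real m * \<epsilon> * D ^ Suc m * B"
    using 1 2 by linarith
  then show ?case by (simp add: algebra_simps)
qed

text \<open>\<open>P\<close> only has to agree with \<open>1 + h * L\<close> up to second order.
  Each of the \<open>m\<close> comparisons with an Euler step costs order \<open>1 / m^2\<close>
  while all growth factors together stay below a constant, so the Euler limit is inherited.\<close>

theorem chernoff_product:
  assumes P: "\<And>h. 0 \<le> h \<Longrightarrow> bounded_operator S (P h) (exp (C * h))"
    and approx: "\<And>h f B s. 0 \<le> h \<Longrightarrow> (\<And>x. x \<in> S \<Longrightarrow> \<bar>f x\<bar> \<le> B) \<Longrightarrow> s \<in> S \<Longrightarrow>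
        \<bar>P h f s - (f s + h * L f s)\<bar> \<le> (C * h)\<^sup>2 * exp (C * h) * B"
    and f: "bounded_on S f" and s: "s \<in> S" and t: "0 \<le> t"
  shows "(\<lambda>m. (P (t / real m) ^^ m) f s) \<longlonglongrightarrow> markov_semigroup L t f s"
proof -
  obtain B where B: "\<And>x. x \<in> S \<Longrightarrow> \<bar>f x\<bar> \<le> B" using f unfolding bounded_on_def by blast
  let ?E = "\<lambda>m f x. f x + t / real m * L f x"
  let ?b = "\<lambda>m. ((C * t)\<^sup>2 * exp (C * t) * exp (C * t) * B) / real m"
  have bd: "\<forall>\<^sub>F m in sequentially. norm ((P (t / real m) ^^ m) f s - (?E m ^^ m) f s) \<le> ?b m"
    using eventually_gt_at_top[of 0]
  proof eventually_elim
    case (elim m)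
    let ?h = "t / real m"
    have h: "0 \<le> ?h" "1 \<le> exp (C * ?h)" using t C_nonneg by auto
    have B0: "0 \<le> B" using B[OF s] by simp
    have "t * 1 \<le> t * real m" using elim t by (intro mult_left_mono) auto
    then have hle: "C * ?h \<le> C * t"
      using elim C_nonneg by (intro mult_left_mono) (simp_all add: divide_le_eq)
    interpret E: bounded_operator S "?E m" "exp (C * ?h)" by (rule euler_bounded_operator[OF h(1)])
    have "\<bar>(P ?h ^^ m) f s - (?E m ^^ m) f s\<bar> \<le>
        real m * ((C * ?h)\<^sup>2 * exp (C * ?h)) * exp (C * ?h) ^ m * B"
    proof (rule E.funpow_diff_bound[OF P[OF h(1)] E.bounded_operator_axioms h(2) _ _ B s])
      show "0 \<le> (C * ?h)\<^sup>2 * exp (C * ?h)" by simp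
    qed (use approx[OF h(1)] in auto)
    also have "exp (C * ?h) ^ m = exp (C * t)"
      using elim by (simp add: exp_of_nat_mult[symmetric])
    also have "real m * ((C * ?h)\<^sup>2 * exp (C * ?h)) * exp (C * t) * B =
        (C * t)\<^sup>2 * exp (C * t) * B / real m * exp (C * ?h)"
      using elim by (simp add: power2_eq_square field_simps)
    also have "\<dots> \<le> (C * t)\<^sup>2 * exp (C * t) * B / real m * exp (C * t)"
      using hle t B0 by (intro mult_left_mono) auto
    finally show ?case by (simp add: field_simps)
  qed
  have "(\<lambda>m. (P (t / real m) ^^ m) f s - (?E m ^^ m) f s) \<longlonglongrightarrow> 0"
    by (rule Lim_null_comparison[OF bd])
      (intro real_tendsto_divide_at_top[OF tendsto_const] filterlim_real_sequentially)
  from tendsto_add[OF this euler_limit[OF f s t]] show ?thesis by simp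
qed

end

section \<open>Functionals of jumps: the lifted generator\<close>

text \<open>The generator of a chain together with an integer that grows by \<open>d s s'\<close> at each jump.\<close>

definition lift_op :: "('s \<Rightarrow> 's \<Rightarrow> int) \<Rightarrow> (('s \<Rightarrow> real) \<Rightarrow> 's \<Rightarrow> real) \<Rightarrow> ('s \<times> int \<Rightarrow> real) \<Rightarrow> 's \<times> int \<Rightarrow> real" where
  "lift_op d L f = (\<lambda>(s, j). L (\<lambda>s'. f (s', j + d s s')) s)"

text \<open>At a fixed \<open>(s, j)\<close> the lifted operator is \<open>L\<close> applied to a
  slice of \<open>f\<close>, with \<open>s\<close> frozen inside \<open>d\<close>. The slice obeys
  the same bound as \<open>f\<close>, hence the same constant.\<close>

lemma bounded_operator_lift:
  assumes "bounded_operator S L C"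
  shows "bounded_operator (S \<times> UNIV) (lift_op d L) C"
proof -
  interpret bounded_operator S L C by fact
  have b: "bounded_on S (\<lambda>s'. f (s', j + d s s'))" if "bounded_on (S \<times> UNIV) f" for f j s
    using that unfolding bounded_on_def by auto
  show ?thesis
  proof
    show "0 \<le> C" by (rule C_nonneg)
  qed (auto simp: lift_op_def add scale b intro!: bound)
qed

text \<open>Lifting the semigroup at time \<open>h\<close> charges only \<open>d\<close> between the
  two ends of the step, so it errs when several jumps fall within \<open>h\<close>. To first order
  in \<open>h\<close> it agrees with the lifted generator, and the product formula removes the
  difference.\<close>

lemma lift_chernoff:
  assumes L: "bounded_operator S L C" and d: "\<And>s. s \<in> S \<Longrightarrow> d s s = 0"
    and f: "bounded_on (S \<times> UNIV) f" and s: "s \<in> S" and t: "0 \<le> t"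
  shows "(\<lambda>m. (lift_op d (markov_semigroup L (t / real m)) ^^ m) f (s, j))
    \<longlonglongrightarrow> markov_semigroup (lift_op d L) t f (s, j)"
proof -
  interpret L: bounded_operator S L C by fact
  interpret Lift: bounded_operator "S \<times> UNIV" "lift_op d L" C by (rule bounded_operator_lift[OF L])
  show ?thesis
  proof (rule Lift.chernoff_product[where P = "\<lambda>h. lift_op d (markov_semigroup L h)", OF _ _ f _ t])
    fix h :: real assume h: "0 \<le> h"
    show "bounded_operator (S \<times> UNIV) (lift_op d (markov_semigroup L h)) (exp (C * h))"
      by (rule bounded_operator_lift[OF L.semigroup_bounded_operator[OF h]])
    fix f :: "'a \<times> int \<Rightarrow> real" and B x
    assume *: "\<And>x. x \<in> S \<times> UNIV \<Longrightarrow> \<bar>f x\<bar> \<le> B" and x: "x \<in> S \<times> (UNIV :: int set)"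
    obtain s j where [simp]: "x = (s, j)" by force
    have "s \<in> S" using x by simp
    \<comment> \<open>Because \<open>d s s = 0\<close>, the term of order zero is
      \<open>f (s, j)\<close> with the counter unshifted.\<close>
    then show "\<bar>lift_op d (markov_semigroup L h) f x - (f x + h * lift_op d L f x)\<bar> \<le> (C * h)\<^sup>2 * exp (C * h) * B"
      using L.semigroup_taylor[of "\<lambda>s'. f (s', j + d s s')" B s h] * h d
      by (simp add: lift_op_def)
  qed (use s in auto)
qed

section \<open>Jumps of paths in a discrete space\<close>

lemma left_value_eqI: "\<forall>\<^sub>F u in at_left t. p u = a \<Longrightarrow> left_value p t = a"
  for t :: real
proof -
  assume *: "\<forall>\<^sub>F u in at_left t. p u = a"
  have "b = a" if "\<forall>\<^sub>F u in at_left t. p u = b" for b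
  proof -
    have "\<forall>\<^sub>F u in at_left t. b = a" using * that by eventually_elim simp
    then show ?thesis by simp
  qed
  then show ?thesis unfolding left_value_def using * by blast
qed

lemma eventually_left_value:
  assumes "cadlag_path p" "0 < t"
  shows "\<forall>\<^sub>F u in at_left t. p u = left_value p t"
proof -
  obtain a where a: "\<forall>\<^sub>F u in at_left t. p u = a" using assms unfolding cadlag_path_def by blast
  then show ?thesis using left_value_eqI[OF a] by simp
qed

lemma left_value_attained:
  assumes "cadlag_path p" "0 < t"
  obtains v where "0 < v" "v < t" "p v = left_value p t"
proof -
  have "\<forall>\<^sub>F u in at_left t. 0 < u \<and> u < t \<and> p u = left_value p t"
    using eventually_left_value[OF assms] eventually_at_left_real[OF assms(2)]
    by eventually_elim auto
  then have "\<exists>u. 0 < u \<and> u < t \<and> p u = left_value p t"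
    by (rule eventually_happens'[rotated]) simp
  then show thesis using that by blast
qed

lemma left_value_comp:
  "cadlag_path p \<Longrightarrow> 0 < t \<Longrightarrow> left_value (\<lambda>u. f (p u)) t = f (left_value p t)"
  by (rule left_value_eqI) (auto elim: eventually_mono[OF eventually_left_value])

lemma cadlag_path_comp: "cadlag_path p \<Longrightarrow> cadlag_path (\<lambda>u. f (p u))"
  unfolding cadlag_path_def
proof (elim conjE, intro conjI allI impI)
  fix t :: real assume "\<forall>t\<ge>0. \<forall>\<^sub>F u in at_right t. p u = p t" "0 \<le> t"
  then have "\<forall>\<^sub>F u in at_right t. p u = p t" by blast
  then show "\<forall>\<^sub>F u in at_right t. f (p u) = f (p t)" by eventually_elim simp
next
  fix t :: real assume "\<forall>t>0. \<exists>a. \<forall>\<^sub>F u in at_left t. p u = a" "0 < t"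
  then obtain a where "\<forall>\<^sub>F u in at_left t. p u = a" by blast
  then have "\<forall>\<^sub>F u in at_left t. f (p u) = f a" by eventually_elim simp
  then show "\<exists>a. \<forall>\<^sub>F u in at_left t. f (p u) = a" by blast
qed

text \<open>Values at negative times are unconstrained, so a left value at \<open>0\<close> carries
  no meaning; hence \<open>0 < u\<close>.\<close>

definition jump_times :: "(real \<Rightarrow> 's) \<Rightarrow> real set" where
  "jump_times p = {u. 0 < u \<and> left_value p u \<noteq> p u}"

definition jump_sum :: "('s \<Rightarrow> 's \<Rightarrow> int) \<Rightarrow> (real \<Rightarrow> 's) \<Rightarrow> real \<Rightarrow> real \<Rightarrow> int" where
  "jump_sum d p a b = (\<Sum>u\<in>jump_times p \<inter> {a<..b}. d (left_value p u) (p u))"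

text \<open>On each side of \<open>x\<close> the path is constant up to distance \<open>e\<close>,
  which rules out jumps at every other time of the neighbourhood. The clause
  \<open>e \<le> x\<close> keeps the left part within nonnegative times.\<close>

lemma cadlag_local:
  assumes p: "cadlag_path p" and x: "0 \<le> x"
  obtains e where "0 < e" "0 < x \<Longrightarrow> e \<le> x"
    "\<And>u. x \<le> u \<Longrightarrow> u < x + e \<Longrightarrow> p u = p x"
    "\<And>u. 0 \<le> u \<Longrightarrow> x - e < u \<Longrightarrow> u < x \<Longrightarrow> p u = left_value p x"
    "\<And>u v. 0 \<le> u \<Longrightarrow> x - e < u \<Longrightarrow> v < x + e \<Longrightarrow> jump_times p \<inter> {u<..v} \<subseteq> {x}"
proof -
  have "\<forall>\<^sub>F u in at_right x. p u = p x" using p x unfolding cadlag_path_def by blast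
  then obtain r where r: "r > x" "\<And>u. x < u \<Longrightarrow> u < r \<Longrightarrow> p u = p x"
    unfolding eventually_at_right_field by auto
  \<comment> \<open>At \<open>x = 0\<close> no nonnegative time lies to the left, and any negative
    \<open>l\<close> does.\<close>
  have "\<exists>l<x. (0 < x \<longrightarrow> 0 \<le> l) \<and> (\<forall>u. 0 \<le> u \<longrightarrow> l < u \<longrightarrow> u < x \<longrightarrow> p u = left_value p x)"
  proof (cases "0 < x")
    case True
    obtain l where "l < x" "\<And>u. l < u \<Longrightarrow> u < x \<Longrightarrow> p u = left_value p x"
      using eventually_left_value[OF p True] unfolding eventually_at_left_field by auto
    then show ?thesis using True by (intro exI[of _ "max l 0"]) auto
  next
    case False
    then show ?thesis using x by (intro exI[of _ "-1"]) auto
  qed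
  then obtain l where l: "l < x" "0 < x \<Longrightarrow> 0 \<le> l"
    "\<And>u. 0 \<le> u \<Longrightarrow> l < u \<Longrightarrow> u < x \<Longrightarrow> p u = left_value p x" by blast
  define e where "e = min (r - x) (x - l)"
  have e: "0 < e" "x + e \<le> r" "l \<le> x - e" using r l unfolding e_def by auto
  have lv: "left_value p w = p w" if w: "0 < w" "x - e < w" "w < x + e" "w \<noteq> x" for w
  proof (cases "w < x")
    case True
    have "\<forall>\<^sub>F u in at_left w. max 0 l < u \<and> u < w"
      using w True e eventually_at_left_real[of "max 0 l" w] by (auto elim: eventually_mono)
    then have "\<forall>\<^sub>F u in at_left w. p u = left_value p x"
      by eventually_elim (use l True in auto)
    then show ?thesis using left_value_eqI l(3)[of w] w True e by force
  next
    case False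
    have "\<forall>\<^sub>F u in at_left w. x < u \<and> u < w"
      using w False by (intro eventually_at_left_real[THEN eventually_mono]) auto
    then have "\<forall>\<^sub>F u in at_left w. p u = p x"
      by eventually_elim (use r w e in auto)
    then show ?thesis using left_value_eqI r(2)[of w] w False e by force
  qed
  have "jump_times p \<inter> {u<..v} \<subseteq> {x}" if uv: "0 \<le> u" "x - e < u" "v < x + e" for u v
  proof
    fix w assume "w \<in> jump_times p \<inter> {u<..v}"
    then have "0 < w" "x - e < w" "w < x + e" "left_value p w \<noteq> p w"
      using uv unfolding jump_times_def by auto
    then show "w \<in> {x}" using lv[of w] by auto
  qed
  moreover have "p u = p x" if "x \<le> u" "u < x + e" for u
    using r(2)[of u] that e by (cases "u = x") auto
  moreover have "p u = left_value p x" if "0 \<le> u" "x - e < u" "u < x" for u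
    using l(3)[of u] that e by auto
  moreover have "e \<le> x" if "0 < x" using l(2) that e by auto
  ultimately show thesis using that[of e] e(1) by blast
qed

text \<open>In the neighbourhood, \<open>{u<..v}\<close> contains at most the jump at
  \<open>x\<close>. If it contains none, the path has equal values at both ends and
  \<open>d s s = 0\<close> settles the case.\<close>

lemma jump_sum_local:
  assumes p: "cadlag_path p" and x: "0 \<le> x" and d: "\<And>s. d s s = 0"
  obtains e where "0 < e"
    "\<And>u v. 0 \<le> u \<Longrightarrow> x - e < u \<Longrightarrow> u \<le> v \<Longrightarrow> v < x + e \<Longrightarrow>
      finite (jump_times p \<inter> {u<..v}) \<and> jump_sum d p u v = d (p u) (p v)"
proof -
  from cadlag_local[OF p x] obtain e where e: "0 < e"
    "\<And>u. x \<le> u \<Longrightarrow> u < x + e \<Longrightarrow> p u = p x"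
    "\<And>u. 0 \<le> u \<Longrightarrow> x - e < u \<Longrightarrow> u < x \<Longrightarrow> p u = left_value p x"
    "\<And>u v. 0 \<le> u \<Longrightarrow> x - e < u \<Longrightarrow> v < x + e \<Longrightarrow> jump_times p \<inter> {u<..v} \<subseteq> {x}"
    by metis
  have "finite (jump_times p \<inter> {u<..v}) \<and> jump_sum d p u v = d (p u) (p v)"
    if uv: "0 \<le> u" "x - e < u" "u \<le> v" "v < x + e" for u v
  proof -
    have sub: "jump_times p \<inter> {u<..v} \<subseteq> {x}" using e(4) uv by blast
    show ?thesis
    proof (cases "x \<in> {u<..v}")
      case True
      then have pu: "p u = left_value p x" and pv: "p v = p x"
        using uv e(2)[of v] e(3)[of u] by simp_all
      show ?thesis
      proof (cases "x \<in> jump_times p")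
        case True
        then have "jump_times p \<inter> {u<..v} = {x}" using sub \<open>x \<in> {u<..v}\<close> by auto
        then show ?thesis by (simp add: jump_sum_def pu pv)
      next
        case False
        then have "jump_times p \<inter> {u<..v} = {}" "p u = p v"
          using sub pu pv \<open>x \<in> {u<..v}\<close> uv unfolding jump_times_def by auto
        then show ?thesis by (simp add: jump_sum_def d)
      qed
    next
      case False
      then have "jump_times p \<inter> {u<..v} = {}" using sub by auto
      moreover have "p u = p v"
        using False uv e(2)[of u] e(2)[of v] e(3)[of u] e(3)[of v] by (cases "x \<le> u") auto
      ultimately show ?thesis by (simp add: jump_sum_def d)
    qed
  qed
  then show thesis using that[of e] e(1) by blast
qed

text \<open>Compactness of \<open>{a..b}\<close>: \<open>\<delta>\<close> is a Lebesgue number of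
  the cover by the neighbourhoods of \<open>jump_sum_local\<close>, so both ends of a short interval
  lie in one of them.\<close>

lemma jump_sum_uniform:
  assumes p: "cadlag_path p" and a: "0 \<le> a" and d: "\<And>s. d s s = 0"
  obtains \<delta> where "0 < \<delta>"
    "\<And>u v. a \<le> u \<Longrightarrow> u \<le> v \<Longrightarrow> v \<le> b \<Longrightarrow> v - u < \<delta> \<Longrightarrow>
      finite (jump_times p \<inter> {u<..v}) \<and> jump_sum d p u v = d (p u) (p v)"
proof -
  have "\<exists>e. 0 < e \<and> (\<forall>u v. 0 \<le> u \<longrightarrow> x - e < u \<longrightarrow> u \<le> v \<longrightarrow> v < x + e \<longrightarrow>
      finite (jump_times p \<inter> {u<..v}) \<and> jump_sum d p u v = d (p u) (p v))" if "0 \<le> x" for x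
    by (rule jump_sum_local[where d = d, OF p that d]) blast+
  then obtain e where e: "\<And>x. 0 \<le> x \<Longrightarrow> 0 < e x"
    "\<And>x u v. 0 \<le> x \<Longrightarrow> 0 \<le> u \<Longrightarrow> x - e x < u \<Longrightarrow> u \<le> v \<Longrightarrow> v < x + e x \<Longrightarrow>
      finite (jump_times p \<inter> {u<..v}) \<and> jump_sum d p u v = d (p u) (p v)" by metis
  obtain \<delta> where \<delta>: "0 < \<delta>"
    "\<And>x. x \<in> {a..b} \<Longrightarrow> \<exists>G\<in>(\<lambda>x. {x - e x<..<x + e x}) ` {0..}. ball x \<delta> \<subseteq> G"
  proof (rule Heine_Borel_lemma[of "{a..b}" "(\<lambda>x. {x - e x<..<x + e x}) ` {0..}"])
    show "{a..b} \<subseteq> \<Union> ((\<lambda>x. {x - e x<..<x + e x}) ` {0..})" proof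
      fix x assume x: "x \<in> {a..b}"
      then have "x \<in> {x - e x<..<x + e x}" using e(1)[of x] a by auto
      then show "x \<in> \<Union> ((\<lambda>x. {x - e x<..<x + e x}) ` {0..})"
        by (rule UN_I[rotated]) (use x a in auto)
    qed
  qed auto
  have "finite (jump_times p \<inter> {u<..v}) \<and> jump_sum d p u v = d (p u) (p v)"
    if uv: "a \<le> u" "u \<le> v" "v \<le> b" "v - u < \<delta>" for u v
  proof -
    obtain x where x: "0 \<le> x" "ball u \<delta> \<subseteq> {x - e x<..<x + e x}" using \<delta>(2)[of u] uv by auto
    have "u \<in> ball u \<delta>" "v \<in> ball u \<delta>" using uv \<delta>(1) by (auto simp: dist_real_def)
    then have "u \<in> {x - e x<..<x + e x}" "v \<in> {x - e x<..<x + e x}" using x(2) by blast+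
    then show ?thesis using x(1) e(2)[of x u v] uv a by simp
  qed
  then show thesis using that \<delta>(1) by blast
qed

lemma jump_sum_add:
  assumes "a \<le> b" "b \<le> c" "finite (jump_times p \<inter> {a<..b})" "finite (jump_times p \<inter> {b<..c})"
  shows "finite (jump_times p \<inter> {a<..c})" "jump_sum d p a c = jump_sum d p a b + jump_sum d p b c"
proof -
  have "jump_times p \<inter> {a<..c} = (jump_times p \<inter> {a<..b}) \<union> (jump_times p \<inter> {b<..c})"
    using assms by auto
  then show "finite (jump_times p \<inter> {a<..c})" "jump_sum d p a c = jump_sum d p a b + jump_sum d p b c"
    using assms unfolding jump_sum_def by (auto intro!: sum.union_disjoint)
qed

text \<open>Once the mesh is below the \<open>\<delta>\<close> of the path, each cell contributes
  exactly its own jump sum. The equality is exact from some \<open>m\<close> on, so events can be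
  compared instead of approximated.\<close>

lemma grid_jump_sum:
  assumes p: "cadlag_path p" and a: "0 \<le> a" "a \<le> b" and d: "\<And>s. d s s = 0"
  shows "\<forall>\<^sub>F m in sequentially. finite (jump_times p \<inter> {a<..b}) \<and>
    (\<Sum>i<m. d (p (a + real i * ((b - a) / real m))) (p (a + real (Suc i) * ((b - a) / real m)))) = jump_sum d p a b"
proof -
  obtain \<delta> where \<delta>: "0 < \<delta>"
    "\<And>u v. a \<le> u \<Longrightarrow> u \<le> v \<Longrightarrow> v \<le> b \<Longrightarrow> v - u < \<delta> \<Longrightarrow>
      finite (jump_times p \<inter> {u<..v}) \<and> jump_sum d p u v = d (p u) (p v)"
    by (rule jump_sum_uniform[where d = d and b = b, OF p a(1) d]) blast+
  have "(\<lambda>m. (b - a) / real m) \<longlonglongrightarrow> 0"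
    by (intro real_tendsto_divide_at_top[OF tendsto_const] filterlim_real_sequentially)
  then have "\<forall>\<^sub>F m in sequentially. (b - a) / real m < \<delta>"
    using \<delta>(1) by (rule order_tendstoD)
  then show ?thesis using eventually_gt_at_top[of 0]
  proof eventually_elim
    case (elim m)
    define h where "h = (b - a) / real m"
    have h: "0 \<le> h" "h < \<delta>" "real m * h = b - a" using elim a unfolding h_def by auto
    have "finite (jump_times p \<inter> {a<..a + real n * h}) \<and>
        (\<Sum>i<n. d (p (a + real i * h)) (p (a + real (Suc i) * h))) = jump_sum d p a (a + real n * h)"
      if "n \<le> m" for n
      using that
    proof (induction n)
      case 0
      then show ?case by (simp add: jump_sum_def)
    next
      case (Suc n)
      have le: "real (Suc n) * h \<le> b - a"
        using Suc.prems h by (metis mult_right_mono of_nat_mono)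
      have *: "finite (jump_times p \<inter> {a + real n * h<..a + real (Suc n) * h}) \<and>
          jump_sum d p (a + real n * h) (a + real (Suc n) * h) = d (p (a + real n * h)) (p (a + real (Suc n) * h))"
        by (rule \<delta>(2)) (use h le in \<open>auto simp: algebra_simps\<close>)
      have le2: "a \<le> a + real n * h" "a + real n * h \<le> a + real (Suc n) * h"
        using h(1) by (auto intro: mult_right_mono)
      show ?case
        using jump_sum_add[OF le2, where p = p] * Suc by auto
    qed
    from this[of m] show ?case using h(3) unfolding h_def by simp
  qed
qed

lemma finite_jump_times:
  assumes "cadlag_path p" "0 \<le> a"
  shows "finite (jump_times p \<inter> {a<..b})"
proof (cases "a \<le> b")
  case True
  from eventually_happens'[OF _ grid_jump_sum[OF assms True, of "\<lambda>_ _. 0"]] show ?thesis by auto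
qed auto

lemma jump_sum_split:
  "cadlag_path p \<Longrightarrow> 0 \<le> a \<Longrightarrow> a \<le> b \<Longrightarrow> b \<le> c \<Longrightarrow> jump_sum d p a c = jump_sum d p a b + jump_sum d p b c"
  by (rule jump_sum_add) (auto intro: finite_jump_times)

text \<open>For a difference of values of \<open>f\<close>, the grid sums telescope. This turns the
  displacement of the tagged particle into a sum over jumps.\<close>

lemma jump_sum_telescope:
  assumes "cadlag_path p" "0 \<le> a" "a \<le> b"
  shows "jump_sum (\<lambda>s s'. f s' - f s) p a b = f (p b) - f (p a)"
proof -
  let ?d = "\<lambda>s s'. f s' - f s"
  obtain m where m: "m > 0"
    "(\<Sum>i<m. ?d (p (a + real i * ((b - a) / real m))) (p (a + real (Suc i) * ((b - a) / real m)))) = jump_sum ?d p a b"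
    using eventually_happens'[OF _ eventually_conj[OF grid_jump_sum[OF assms, of ?d] eventually_gt_at_top[of 0]]]
    by auto
  then show ?thesis
    using m(2)[unfolded sum_lessThan_telescope[of "\<lambda>i. f (p (a + real i * ((b - a) / real m)))"]] by simp
qed

lemma cadlag_jump_sum:
  assumes p: "cadlag_path p"
  shows "cadlag_path (\<lambda>t. (p t, jump_sum d p 0 t))"
  unfolding cadlag_path_def
proof (intro conjI allI impI)
  fix x :: real assume x: "0 \<le> x"
  from cadlag_local[OF p x] obtain e where e: "0 < e" "\<And>u. x \<le> u \<Longrightarrow> u < x + e \<Longrightarrow> p u = p x"
    "\<And>u v. 0 \<le> u \<Longrightarrow> x - e < u \<Longrightarrow> v < x + e \<Longrightarrow> jump_times p \<inter> {u<..v} \<subseteq> {x}"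
    by metis
  have "\<forall>\<^sub>F u in at_right x. x < u \<and> u < x + e"
    using e(1) by (intro eventually_at_right_real[THEN eventually_mono]) auto
  then show "\<forall>\<^sub>F u in at_right x. (p u, jump_sum d p 0 u) = (p x, jump_sum d p 0 x)"
  proof eventually_elim
    case (elim u)
    have "jump_times p \<inter> {x<..u} \<subseteq> {x}" using e(3)[of x u] elim e(1) x by auto
    then have "jump_times p \<inter> {x<..u} = {}" by auto
    then have "jump_sum d p x u = 0" by (simp add: jump_sum_def)
    then show ?case using jump_sum_split[OF p, of 0 x u d] x elim e(2)[of u] by auto
  qed
next
  fix x :: real assume x: "0 < x"
  from cadlag_local[OF p less_imp_le[OF x]] x obtain e where e: "0 < e" "e \<le> x"
    "\<And>u. 0 \<le> u \<Longrightarrow> x - e < u \<Longrightarrow> u < x \<Longrightarrow> p u = left_value p x"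
    "\<And>u v. 0 \<le> u \<Longrightarrow> x - e < u \<Longrightarrow> v < x + e \<Longrightarrow> jump_times p \<inter> {u<..v} \<subseteq> {x}"
    by metis
  \<comment> \<open>Any point of the left neighbourhood would serve as reference;
    \<open>e / 2\<close> keeps it strictly inside, and \<open>e \<le> x\<close> keeps it
    nonnegative.\<close>
  define c where "c = x - e / 2"
  have c: "0 \<le> c" "x - e < c" "c < x" using e unfolding c_def by auto
  have "\<forall>\<^sub>F u in at_left x. c < u \<and> u < x"
    using c by (intro eventually_at_left_real[THEN eventually_mono]) auto
  then have "\<forall>\<^sub>F u in at_left x. (p u, jump_sum d p 0 u) = (left_value p x, jump_sum d p 0 c)"
  proof eventually_elim
    case (elim u)
    have "jump_times p \<inter> {c<..u} \<subseteq> {x}" using e(4)[of c u] elim e(1) c by auto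
    then have "jump_times p \<inter> {c<..u} = {}" using elim by auto
    then have "jump_sum d p c u = 0" by (simp add: jump_sum_def)
    then show ?case using jump_sum_split[OF p, of 0 c u d] c elim e(3)[of u] by auto
  qed
  then show "\<exists>a. \<forall>\<^sub>F u in at_left x. (p u, jump_sum d p 0 u) = a" by blast
qed

section \<open>Markov chains with bounded generators\<close>

text \<open>\<open>B\<close> lies in the past of time \<open>a\<close> and in \<open>Y a = s\<close>, and the future after \<open>a\<close> is independent of it.
  Unlike cylinders, such events are stable under almost sure limits.\<close>

definition markov_event ::
  "'w measure \<Rightarrow> 's set \<Rightarrow> (('s \<Rightarrow> real) \<Rightarrow> 's \<Rightarrow> real) \<Rightarrow> (real \<Rightarrow> 'w \<Rightarrow> 's) \<Rightarrow> real \<Rightarrow> 's \<Rightarrow> 'w set \<Rightarrow> bool" where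
  "markov_event M S L Y a s B \<longleftrightarrow>
     B \<in> sets M \<and> B \<subseteq> {\<omega> \<in> space M. Y a \<omega> = s} \<and>
     (\<forall>n t r. t 0 = a \<longrightarrow> r 0 = s \<longrightarrow> (\<forall>i<n. t i < t (Suc i)) \<longrightarrow> (\<forall>i\<le>n. r i \<in> S) \<longrightarrow>
        measure M (B \<inter> {\<omega> \<in> space M. \<forall>i\<le>n. Y (t i) \<omega> = r i}) =
        measure M B * (\<Prod>i<n. transition_prob L (t (Suc i) - t i) (r i) (r (Suc i))))"

section \<open>Events that keep the Markov property\<close>

locale jump_chain =
  fixes M :: "'w measure" and S L s0 Y
  assumes chain: "markov_chain M S L (s0 :: 's) Y"
begin

sublocale prob_space M
  using chain unfolding markov_chain_def by blast

lemma measurable_Y: "0 \<le> t \<Longrightarrow> Y t \<in> measurable M (count_space S)"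
  using chain unfolding markov_chain_def by blast

lemma Y_in: "0 \<le> t \<Longrightarrow> \<omega> \<in> space M \<Longrightarrow> Y t \<omega> \<in> S"
  using measurable_space[OF measurable_Y] by simp

lemma Y_event: 
  assumes "0 \<le> t" shows "{\<omega> \<in> space M. P (Y t \<omega>)} \<in> sets M"
proof -
  have "Y t -` {s \<in> S. P s} \<inter> space M \<in> sets M"
    by (rule measurable_sets[OF measurable_Y[OF assms]]) simp
  also have "Y t -` {s \<in> S. P s} \<inter> space M = {\<omega> \<in> space M. P (Y t \<omega>)}"
    using Y_in[OF assms] by auto
  finally show ?thesis .
qed

lemma cylinder_event:
  "(\<And>i. i \<le> n \<Longrightarrow> 0 \<le> t i) \<Longrightarrow> {\<omega> \<in> space M. \<forall>i\<le>(n::nat). Y (t i) \<omega> = r i} \<in> sets M"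
proof (induction n)
  case 0
  then show ?case using Y_event[of "t 0" "\<lambda>s. s = r 0"] by simp
next
  case (Suc n)
  have "{\<omega> \<in> space M. \<forall>i\<le>Suc n. Y (t i) \<omega> = r i} =
      {\<omega> \<in> space M. \<forall>i\<le>n. Y (t i) \<omega> = r i} \<inter> {\<omega> \<in> space M. Y (t (Suc n)) \<omega> = r (Suc n)}"
    by (auto simp: le_Suc_eq)
  moreover have "{\<omega> \<in> space M. \<forall>i\<le>n. Y (t i) \<omega> = r i} \<in> sets M"
    by (rule Suc.IH) (simp add: Suc.prems)
  moreover have "{\<omega> \<in> space M. Y (t (Suc n)) \<omega> = r (Suc n)} \<in> sets M"
    by (rule Y_event) (simp add: Suc.prems)
  ultimately show ?case by (simp only: sets.Int)
qed

lemma grid_nonneg: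
  fixes t :: "nat \<Rightarrow> real"
  shows "0 \<le> t 0 \<Longrightarrow> (\<forall>i<n. t i < t (Suc i)) \<Longrightarrow> i \<le> n \<Longrightarrow> 0 \<le> t i"
proof (induction i)
  case (Suc i)
  then have "0 \<le> t i" "t i < t (Suc i)" by auto
  then show ?case by linarith
qed

lemma markov_property:
  assumes "0 \<le> t 0" "\<And>i. i \<le> n \<Longrightarrow> t i < t (Suc i)" "\<And>i. i \<le> Suc n \<Longrightarrow> r i \<in> S"
  shows "measure M {\<omega> \<in> space M. \<forall>i\<le>Suc n. Y (t i) \<omega> = r i} =
    measure M {\<omega> \<in> space M. \<forall>i\<le>n. Y (t i) \<omega> = r i} *
      transition_prob L (t (Suc n) - t n) (r n) (r (Suc n))"
  by (rule chain[unfolded markov_chain_def, THEN conjunct2, THEN conjunct2, THEN conjunct2, THEN conjunct2,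
      rule_format, OF assms])

abbreviation "mev \<equiv> markov_event M S L Y"

lemma mev_sets: "mev a s B \<Longrightarrow> B \<in> sets M"
  unfolding markov_event_def by blast

lemma mev_sub: "mev a s B \<Longrightarrow> B \<subseteq> {\<omega> \<in> space M. Y a \<omega> = s}"
  unfolding markov_event_def by blast

lemma mev_measure:
  "mev a s B \<Longrightarrow> t 0 = a \<Longrightarrow> r 0 = s \<Longrightarrow> (\<And>i. i < n \<Longrightarrow> t i < t (Suc i)) \<Longrightarrow> (\<And>i. i \<le> n \<Longrightarrow> r i \<in> S) \<Longrightarrow>
    measure M (B \<inter> {\<omega> \<in> space M. \<forall>i\<le>n. Y (t i) \<omega> = r i}) =
    measure M B * (\<Prod>i<n. transition_prob L (t (Suc i) - t i) (r i) (r (Suc i)))"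
  by (rule markov_event_def[THEN iffD1, THEN conjunct2, THEN conjunct2, rule_format])

text \<open>Iterating the one-step Markov property turns the law of a cylinder into a product of
  transition probabilities.\<close>

lemma mev_start:
  assumes a: "0 \<le> a"
  shows "mev a s {\<omega> \<in> space M. Y a \<omega> = s}"
  unfolding markov_event_def
proof (intro conjI allI impI)
  show "{\<omega> \<in> space M. Y a \<omega> = s} \<in> sets M" by (rule Y_event[OF a])
  fix n t r
  assume t: "t (0::nat) = a" and r: "r (0::nat) = s"
  have *: "{\<omega> \<in> space M. Y a \<omega> = s} \<inter> {\<omega> \<in> space M. \<forall>i\<le>n. Y (t i) \<omega> = r i} =
      {\<omega> \<in> space M. \<forall>i\<le>n. Y (t i) \<omega> = r i}" for n
    using t r by auto
  assume "\<forall>i<n. t i < t (Suc i)" "\<forall>i\<le>n. r i \<in> S"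
  then have "measure M {\<omega> \<in> space M. \<forall>i\<le>n. Y (t i) \<omega> = r i} =
      measure M {\<omega> \<in> space M. Y a \<omega> = s} * (\<Prod>i<n. transition_prob L (t (Suc i) - t i) (r i) (r (Suc i)))"
  proof (induction n)
    case 0
    then show ?case using t r by simp
  next
    case (Suc n)
    then show ?case by (subst markov_property) (use t a in auto)
  qed
  then show "measure M ({\<omega> \<in> space M. Y a \<omega> = s} \<inter> {\<omega> \<in> space M. \<forall>i\<le>n. Y (t i) \<omega> = r i}) =
      measure M {\<omega> \<in> space M. Y a \<omega> = s} * (\<Prod>i<n. transition_prob L (t (Suc i) - t i) (r i) (r (Suc i)))"
    using * by simp
qed auto

lemma mev_empty: "mev a s {}"
  unfolding markov_event_def by simp

lemma mev_step:
  assumes B: "mev a s B" and a: "0 \<le> a" "a < b" and s: "s \<in> S" "s' \<in> S"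
  shows "mev b s' (B \<inter> {\<omega> \<in> space M. Y b \<omega> = s'})"
    and "measure M (B \<inter> {\<omega> \<in> space M. Y b \<omega> = s'}) = measure M B * transition_prob L (b - a) s s'"
proof -
  let ?B = "B \<inter> {\<omega> \<in> space M. Y b \<omega> = s'}"
  have shift: "measure M (?B \<inter> {\<omega> \<in> space M. \<forall>i\<le>n. Y (t i) \<omega> = r i}) =
      measure M B * (transition_prob L (b - a) s s' * (\<Prod>i<n. transition_prob L (t (Suc i) - t i) (r i) (r (Suc i))))"
    if "t 0 = b" "r 0 = s'" "\<And>i. i < n \<Longrightarrow> t i < t (Suc i)" "\<And>i. i \<le> n \<Longrightarrow> r i \<in> S" for n t r
  proof -
    \<comment> \<open>Prepending the state \<open>s\<close> at time \<open>a\<close> turns a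
      cylinder from \<open>b\<close> into one from \<open>a\<close>, to which the factorization for
      \<open>B\<close> applies; the additional first factor is the transition from \<open>s\<close>
      to \<open>s'\<close>.\<close>
    let ?t = "case_nat a t" and ?r = "case_nat s r"
    have "?B \<inter> {\<omega> \<in> space M. \<forall>i\<le>n. Y (t i) \<omega> = r i} = B \<inter> {\<omega> \<in> space M. \<forall>i\<le>Suc n. Y (?t i) \<omega> = ?r i}"
      using mev_sub[OF B] that(1,2) by (auto split: nat.split)
    also have "measure M \<dots> =
        measure M B * (\<Prod>i<Suc n. transition_prob L (?t (Suc i) - ?t i) (?r i) (?r (Suc i)))"
      by (rule mev_measure[OF B]) (use that a s in \<open>auto split: nat.split\<close>)
    finally show ?thesis unfolding prod.lessThan_Suc_shift using that(1,2) by simp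
  qed
  have sets: "?B \<in> sets M" using mev_sets[OF B] Y_event[of b "\<lambda>x. x = s'"] a by auto
  have "?B \<inter> {\<omega> \<in> space M. \<forall>i\<le>0. Y b \<omega> = s'} = ?B" by auto
  then show m: "measure M ?B = measure M B * transition_prob L (b - a) s s'"
    using shift[of "\<lambda>_. b" "\<lambda>_. s'" 0] s by simp
  show "mev b s' ?B"
    unfolding markov_event_def using sets m shift by (auto simp: mult.assoc)
qed

text \<open>The factorization is linear in the measure of \<open>B\<close>, and its second factor
  does not depend on \<open>B\<close>, so it survives finite disjoint unions.\<close>

lemma mev_Union:
  assumes I: "finite I" and B: "\<And>i. i \<in> I \<Longrightarrow> mev a s (B i)" and disj: "disjoint_family_on B I" and a: "0 \<le> a"
  shows "mev a s (\<Union>i\<in>I. B i)"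
  unfolding markov_event_def
proof (intro conjI allI impI)
  show "(\<Union>i\<in>I. B i) \<in> sets M" using I B mev_sets by blast
  show "(\<Union>i\<in>I. B i) \<subseteq> {\<omega> \<in> space M. Y a \<omega> = s}" using B mev_sub by blast
  fix n t r
  assume *: "t (0::nat) = a" "r (0::nat) = s" "\<forall>i<n. t i < t (Suc i)" "\<forall>i\<le>n. r i \<in> S"
  let ?C = "{\<omega> \<in> space M. \<forall>i\<le>n. Y (t i) \<omega> = r i}"
  let ?p = "\<Prod>i<n. transition_prob L (t (Suc i) - t i) (r i) (r (Suc i))"
  have C: "?C \<in> sets M" by (rule cylinder_event, rule grid_nonneg[of t n]) (use * a in auto)
  have BC: "B i \<in> sets M" "measure M (B i \<inter> ?C) = measure M (B i) * ?p" if "i \<in> I" for i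
    by (rule mev_sets[OF B[OF that]], rule mev_measure[OF B[OF that]]) (use * in auto)
  have "measure M ((\<Union>i\<in>I. B i) \<inter> ?C) = measure M (\<Union>i\<in>I. B i \<inter> ?C)"
    by (rule arg_cong[of _ _ "measure M"]) blast
  also have "\<dots> = (\<Sum>i\<in>I. measure M (B i \<inter> ?C))"
  proof (rule finite_measure_finite_Union[OF I])
    show "(\<lambda>i. B i \<inter> ?C) ` I \<subseteq> sets M" using BC(1) C by blast
    show "disjoint_family_on (\<lambda>i. B i \<inter> ?C) I" using disj unfolding disjoint_family_on_def by blast
  qed
  also have "\<dots> = (\<Sum>i\<in>I. measure M (B i) * ?p)"
    by (rule sum.cong[OF refl BC(2)])
  also have "\<dots> = (\<Sum>i\<in>I. measure M (B i)) * ?p"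
    by (rule sum_distrib_right[symmetric])
  also have "(\<Sum>i\<in>I. measure M (B i)) = measure M (\<Union>i\<in>I. B i)"
    by (rule finite_measure_finite_Union[OF I _ disj, symmetric]) (use BC(1) in blast)
  finally show "measure M ((\<Union>i\<in>I. B i) \<inter> ?C) = measure M (\<Union>i\<in>I. B i) * ?p" .
qed

lemma measure_limit:
  assumes "\<And>m. B m \<in> sets M" "B' \<in> sets M"
    and "AE \<omega> in M. \<forall>\<^sub>F m in sequentially. \<omega> \<in> B m \<longleftrightarrow> \<omega> \<in> B'"
  shows "(\<lambda>m. measure M (B m)) \<longlonglongrightarrow> measure M B'"
proof -
  have "(\<lambda>m. \<integral>\<omega>. indicator (B m) \<omega> \<partial>M) \<longlonglongrightarrow> (\<integral>\<omega>. indicator B' \<omega> \<partial>M :: real)"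
  proof (rule integral_dominated_convergence[where w = "\<lambda>_. 1"])
    show "AE \<omega> in M. (\<lambda>m. indicator (B m) \<omega> :: real) \<longlonglongrightarrow> indicator B' \<omega>"
      using assms(3)
    proof eventually_elim
      case (elim \<omega>)
      show ?case
        by (rule tendsto_eventually) (use elim in \<open>auto elim!: eventually_mono simp: indicator_def\<close>)
    qed
  qed (use assms in \<open>auto simp: indicator_def\<close>)
  then show ?thesis using assms by simp
qed

text \<open>Both sides of the factorization see \<open>B\<close> only through measures, which pass
  to the limit by dominated convergence of indicators. This closure admits events about path
  functionals such as a sum over jumps.\<close>

lemma mev_limit:
  assumes B: "\<And>m. mev a s (B m)" and B': "B' \<in> sets M" "B' \<subseteq> {\<omega> \<in> space M. Y a \<omega> = s}" and a: "0 \<le> a"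
    and lim: "AE \<omega> in M. \<forall>\<^sub>F m in sequentially. \<omega> \<in> B m \<longleftrightarrow> \<omega> \<in> B'"
  shows "mev a s B'"
  unfolding markov_event_def
proof (intro conjI allI impI B')
  fix n t r
  assume *: "t (0::nat) = a" "r (0::nat) = s" "\<forall>i<n. t i < t (Suc i)" "\<forall>i\<le>n. r i \<in> S"
  let ?C = "{\<omega> \<in> space M. \<forall>i\<le>n. Y (t i) \<omega> = r i}"
  let ?p = "\<Prod>i<n. transition_prob L (t (Suc i) - t i) (r i) (r (Suc i))"
  have C: "?C \<in> sets M" by (rule cylinder_event, rule grid_nonneg[of t n]) (use * a in auto)
  have lim1: "(\<lambda>m. measure M (B m \<inter> ?C)) \<longlonglongrightarrow> measure M (B' \<inter> ?C)"
  proof (rule measure_limit)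
    show "AE \<omega> in M. \<forall>\<^sub>F m in sequentially. \<omega> \<in> B m \<inter> ?C \<longleftrightarrow> \<omega> \<in> B' \<inter> ?C"
      using lim by eventually_elim (auto elim: eventually_mono)
  qed (rule sets.Int[OF mev_sets[OF B] C] sets.Int[OF B'(1) C])+
  have lim2: "(\<lambda>m. measure M (B m) * ?p) \<longlonglongrightarrow> measure M B' * ?p"
    by (rule tendsto_mult[OF measure_limit[OF mev_sets[OF B] B'(1) lim] tendsto_const])
  have "measure M (B m \<inter> ?C) = measure M (B m) * ?p" for m
    by (rule mev_measure[OF B]) (use * in auto)
  then show "measure M (B' \<inter> ?C) = measure M B' * ?p"
    using LIMSEQ_unique[OF lim1] lim2 by presburger
qed

end

section \<open>Lumping by a map that intertwines two generators\<close>

text \<open>An event about the images is split by the actual state at its last time. Each piece is a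
  Markov event of \<open>Y\<close>, and transition probabilities summed over a target fibre depend
  on the current state only through its image, so the pieces recombine.\<close>

theorem lumped_markov_chain:
  assumes Y: "markov_chain M S L s0 Y" and L: "bounded_operator S L C"
    and maps: "\<And>s. s \<in> S \<Longrightarrow> \<pi> s \<in> S'" and fin: "\<And>x. x \<in> S' \<Longrightarrow> finite {s \<in> S. \<pi> s = x}"
    and intertwine: "\<And>f s. s \<in> S \<Longrightarrow> L (\<lambda>s. f (\<pi> s)) s = L' f (\<pi> s)"
  shows "markov_chain M S' L' (\<pi> s0) (\<lambda>t \<omega>. \<pi> (Y t \<omega>))"
proof -
  interpret jump_chain M S L s0 Y by unfold_locales fact
  interpret L: bounded_operator S L C by fact
  let ?F = "\<lambda>x. {s \<in> S. \<pi> s = x}"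
  have pow: "(L ^^ n) (\<lambda>s. f (\<pi> s)) s = (L' ^^ n) f (\<pi> s)"
    if f: "bounded_on S (\<lambda>s. f (\<pi> s))" and "s \<in> S" for n f s
    using \<open>s \<in> S\<close>
  proof (induction n arbitrary: s)
    case (Suc n)
    have "L ((L ^^ n) (\<lambda>s. f (\<pi> s))) s = L (\<lambda>s. (L' ^^ n) f (\<pi> s)) s"
      by (rule L.cong) (use Suc L.funpow_bounded[OF f] in auto)
    then show ?case using intertwine[OF Suc.prems] by simp
  qed simp
  \<comment> \<open>The powers of \<open>L\<close> and \<open>L'\<close> correspond term by term,
    and the finite fibre has an indicator that is a finite sum of point indicators, so linearity of
    the semigroup applies.\<close>
  have tp: "(\<Sum>s'\<in>?F x. transition_prob L t s s') = transition_prob L' t (\<pi> s) x"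
    if s: "s \<in> S" and x: "x \<in> S'" and t: "0 \<le> t" for s x t
  proof -
    interpret T: bounded_operator S "markov_semigroup L t" "exp (C * t)"
      by (rule L.semigroup_bounded_operator[OF t])
    have "transition_prob L' t (\<pi> s) x = markov_semigroup L t (\<lambda>s. indicator {x} (\<pi> s)) s"
      unfolding transition_prob_def markov_semigroup_def
      using pow[of "indicator {x}", OF _ s] bounded_onI[of S "\<lambda>s. indicator {x} (\<pi> s)" 1]
      by (auto simp: indicator_def)
    also have "\<dots> = markov_semigroup L t (\<lambda>u. \<Sum>s'\<in>?F x. 1 * indicator {s'} u) s"
    proof (rule T.cong[OF _ _ s])
      show "indicator {x} (\<pi> u) = (\<Sum>s'\<in>?F x. 1 * indicator {s'} u :: real)" if "u \<in> S" for u
        using that fin[OF x] by (auto simp: indicator_def sum.If_cases)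
    qed (auto intro: bounded_onI[where B = 1] simp: indicator_def)
    also have "\<dots> = (\<Sum>s'\<in>?F x. 1 * markov_semigroup L t (indicator {s'}) s)"
      by (rule T.sum[OF bounded_on_indicator s])
    finally show ?thesis by (simp add: transition_prob_def)
  qed
  define B where "B t x n = {\<omega> \<in> space M. \<forall>i\<le>n. \<pi> (Y (t i) \<omega>) = x i}" for t x and n :: nat
  have B0: "B t x 0 \<inter> {\<omega> \<in> space M. Y (t 0) \<omega> = s} = {\<omega> \<in> space M. Y (t 0) \<omega> = s}" if "s \<in> ?F (x 0)" for t x s
    using that unfolding B_def by auto
  have BSuc: "B t x (Suc n) \<inter> {\<omega> \<in> space M. Y (t (Suc n)) \<omega> = s'} =
      (\<Union>s\<in>?F (x n). B t x n \<inter> {\<omega> \<in> space M. Y (t n) \<omega> = s} \<inter> {\<omega> \<in> space M. Y (t (Suc n)) \<omega> = s'})"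
    if "s' \<in> ?F (x (Suc n))" "0 \<le> t n" for t x n s'
    using that Y_in[of "t n"] unfolding B_def by (auto simp: le_Suc_eq)
  have disj: "disjoint_family_on (\<lambda>s. A \<inter> {\<omega> \<in> space M. Y u \<omega> = s} \<inter> A') I" for A A' u I
    by (auto simp: disjoint_family_on_def)
  have mB: "mev (t n) s (B t x n \<inter> {\<omega> \<in> space M. Y (t n) \<omega> = s})"
    if "0 \<le> t 0" "\<forall>i<n. t i < t (Suc i)" "\<forall>i\<le>n. x i \<in> S'" "s \<in> ?F (x n)" for t x n s
    using that
  proof (induction n arbitrary: s)
    case 0
    have "B t x 0 \<inter> {\<omega> \<in> space M. Y (t 0) \<omega> = s} = {\<omega> \<in> space M. Y (t 0) \<omega> = s}"
      by (rule B0) (use 0 in simp)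
    then show ?case using mev_start[OF 0(1), of s] by simp
  next
    case (Suc n)
    have tn: "0 \<le> t n" "0 \<le> t (Suc n)" by (rule grid_nonneg[of t "Suc n"]; use Suc.prems in auto)+
    have eq: "B t x (Suc n) \<inter> {\<omega> \<in> space M. Y (t (Suc n)) \<omega> = s} =
        (\<Union>r\<in>?F (x n). B t x n \<inter> {\<omega> \<in> space M. Y (t n) \<omega> = r} \<inter> {\<omega> \<in> space M. Y (t (Suc n)) \<omega> = s})"
      by (rule BSuc) (use Suc.prems tn in auto)
    show ?case
      unfolding eq
    proof (rule mev_Union[OF _ _ disj tn(2)])
      show "finite (?F (x n))" using Suc.prems by (intro fin) auto
      fix r assume r: "r \<in> ?F (x n)"
      show "mev (t (Suc n)) s (B t x n \<inter> {\<omega> \<in> space M. Y (t n) \<omega> = r} \<inter> {\<omega> \<in> space M. Y (t (Suc n)) \<omega> = s})"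
        by (rule mev_step(1)[OF Suc.IH]) (use Suc.prems r tn in auto)
    qed
  qed
  have sumB: "measure M (B t x n) = (\<Sum>s\<in>?F (x n). measure M (B t x n \<inter> {\<omega> \<in> space M. Y (t n) \<omega> = s}))"
    if "0 \<le> t 0" "\<forall>i<n. t i < t (Suc i)" "\<forall>i\<le>n. x i \<in> S'" for t x n
  proof -
    have tn: "0 \<le> t n" by (rule grid_nonneg[of t n]) (use that in auto)
    have "B t x n = (\<Union>s\<in>?F (x n). B t x n \<inter> {\<omega> \<in> space M. Y (t n) \<omega> = s})"
      using Y_in[OF tn] unfolding B_def by auto
    moreover have "mev (t n) s (B t x n \<inter> {\<omega> \<in> space M. Y (t n) \<omega> = s})" if "s \<in> ?F (x n)" for s
      by (rule mB) fact+
    then have "measure M (\<Union>s\<in>?F (x n). B t x n \<inter> {\<omega> \<in> space M. Y (t n) \<omega> = s}) =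
        (\<Sum>s\<in>?F (x n). measure M (B t x n \<inter> {\<omega> \<in> space M. Y (t n) \<omega> = s}))"
      using that fin mev_sets
      by (intro finite_measure_finite_Union) (auto simp: disjoint_family_on_def)
    ultimately show ?thesis by simp
  qed
  have markov: "measure M (B t x (Suc n)) = measure M (B t x n) * transition_prob L' (t (Suc n) - t n) (x n) (x (Suc n))"
    if t0: "0 \<le> t 0" and t: "\<forall>i\<le>n. t i < t (Suc i)" and x: "\<forall>i\<le>Suc n. x i \<in> S'" for t x n
  proof -
    have pre: "\<forall>i<n. t i < t (Suc i)" "\<forall>i\<le>n. x i \<in> S'" "\<forall>i<Suc n. t i < t (Suc i)" "t n < t (Suc n)" using t x by auto
    have tn: "0 \<le> t n" by (rule grid_nonneg[of t n]) (use t0 pre in auto)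
    let ?A = "\<lambda>s. B t x n \<inter> {\<omega> \<in> space M. Y (t n) \<omega> = s}"
    have mA: "mev (t n) s (?A s)" if "s \<in> ?F (x n)" for s
      by (rule mB) fact+
    have "measure M (B t x (Suc n) \<inter> {\<omega> \<in> space M. Y (t (Suc n)) \<omega> = s'}) =
        (\<Sum>s\<in>?F (x n). measure M (?A s) * transition_prob L (t (Suc n) - t n) s s')"
      if s': "s' \<in> ?F (x (Suc n))" for s'
    proof -
      have st: "mev (t (Suc n)) s' (?A s \<inter> {\<omega> \<in> space M. Y (t (Suc n)) \<omega> = s'})"
        "measure M (?A s \<inter> {\<omega> \<in> space M. Y (t (Suc n)) \<omega> = s'}) = measure M (?A s) * transition_prob L (t (Suc n) - t n) s s'"
        if "s \<in> ?F (x n)" for s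
        using mev_step[OF mA[OF that] tn pre(4)] that s' by auto
      have eq: "B t x (Suc n) \<inter> {\<omega> \<in> space M. Y (t (Suc n)) \<omega> = s'} =
          (\<Union>s\<in>?F (x n). ?A s \<inter> {\<omega> \<in> space M. Y (t (Suc n)) \<omega> = s'})"
        by (rule BSuc) (use s' tn in auto)
      show ?thesis
        unfolding eq using fin x st mev_sets
        by (subst finite_measure_finite_Union) (auto intro!: disj)
    qed
    moreover have "measure M (B t x (Suc n)) =
        (\<Sum>s'\<in>?F (x (Suc n)). measure M (B t x (Suc n) \<inter> {\<omega> \<in> space M. Y (t (Suc n)) \<omega> = s'}))"
      by (rule sumB) fact+
    ultimately have "measure M (B t x (Suc n)) =
        (\<Sum>s'\<in>?F (x (Suc n)). \<Sum>s\<in>?F (x n). measure M (?A s) * transition_prob L (t (Suc n) - t n) s s')"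
      by simp
    also have "\<dots> = (\<Sum>s\<in>?F (x n). measure M (?A s) * (\<Sum>s'\<in>?F (x (Suc n)). transition_prob L (t (Suc n) - t n) s s'))"
      by (subst sum.swap) (simp add: sum_distrib_left)
    also have "\<dots> = (\<Sum>s\<in>?F (x n). measure M (?A s) * transition_prob L' (t (Suc n) - t n) (x n) (x (Suc n)))"
      using x pre(4) by (intro sum.cong refl) (auto simp: tp)
    also have "\<dots> = measure M (B t x n) * transition_prob L' (t (Suc n) - t n) (x n) (x (Suc n))"
    proof -
      have "measure M (B t x n) = (\<Sum>s\<in>?F (x n). measure M (?A s))" by (rule sumB) fact+
      then show ?thesis by (simp add: sum_distrib_right)
    qed
    finally show ?thesis .
  qed
  have "\<pi> \<in> measurable (count_space S) (count_space S')" using maps by auto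
  then have "\<forall>t\<ge>0. (\<lambda>\<omega>. \<pi> (Y t \<omega>)) \<in> measurable M (count_space S')"
    using measurable_compose[OF measurable_Y] by blast
  moreover have "AE \<omega> in M. cadlag_path (\<lambda>t. \<pi> (Y t \<omega>))" "AE \<omega> in M. \<pi> (Y 0 \<omega>) = \<pi> s0"
    using chain unfolding markov_chain_def by (auto intro: cadlag_path_comp elim: eventually_mono)
  ultimately show ?thesis
    unfolding markov_chain_def using prob_space_axioms markov[unfolded B_def] by blast
qed

section \<open>Joint law of a chain and a sum over its jumps\<close>

lemma sets_Collect_eventually_sequentially:
  assumes "\<And>m. {\<omega> \<in> space M. P m \<omega>} \<in> sets M"
  shows "{\<omega> \<in> space M. \<forall>\<^sub>F m in sequentially. P m \<omega>} \<in> sets M"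
proof -
  have [measurable]: "\<And>m. Measurable.pred M (P m)" using assms by (simp add: pred_def)
  show ?thesis unfolding eventually_sequentially by measurable
qed

context jump_chain
begin

text \<open>The set of regular paths need not be measurable. Removing a null set that covers the
  exceptions leaves a measurable set of full measure on which path functionals can be
  defined.\<close>

lemma good_set:
  obtains G where "G \<in> sets M" "AE \<omega> in M. \<omega> \<in> G" "\<And>\<omega>. \<omega> \<in> G \<Longrightarrow> cadlag_path (\<lambda>t. Y t \<omega>)"
proof -
  have "AE \<omega> in M. cadlag_path (\<lambda>t. Y t \<omega>)" using chain unfolding markov_chain_def by blast
  then obtain N where N: "N \<in> null_sets M" "{\<omega> \<in> space M. \<not> cadlag_path (\<lambda>t. Y t \<omega>)} \<subseteq> N"
    unfolding eventually_ae_filter by blast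
  show thesis
  proof (rule that[of "space M - N"])
    show "AE \<omega> in M. \<omega> \<in> space M - N" using AE_not_in[OF N(1)] by (auto intro: AE_mp)
  qed (use N in auto)
qed

abbreviation grid_sum :: "('s \<Rightarrow> 's \<Rightarrow> int) \<Rightarrow> real \<Rightarrow> real \<Rightarrow> nat \<Rightarrow> 'w \<Rightarrow> int" where
  "grid_sum d a h m \<omega> \<equiv> (\<Sum>i<m. d (Y (a + real i * h) \<omega>) (Y (a + real (Suc i) * h) \<omega>))"

lemma grid_sum_event:
  assumes "finite S" "0 \<le> a" "0 \<le> h"
  shows "{\<omega> \<in> space M. grid_sum d a h m \<omega> = c} \<in> sets M"
proof -
  have "(\<lambda>\<omega>. real_of_int (grid_sum d a h m \<omega>)) \<in> borel_measurable M"
    unfolding of_int_sum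
  proof (intro borel_measurable_sum)
    fix i
    have t: "0 \<le> a + real i * h" "0 \<le> a + real (Suc i) * h" using assms by auto
    show "(\<lambda>\<omega>. real_of_int (d (Y (a + real i * h) \<omega>) (Y (a + real (Suc i) * h) \<omega>))) \<in> borel_measurable M"
    proof (rule measurable_compose_countable'[OF _ measurable_Y[OF t(1)]])
      fix s
      show "(\<lambda>\<omega>. real_of_int (d s (Y (a + real (Suc i) * h) \<omega>))) \<in> borel_measurable M"
        by (rule measurable_compose[OF measurable_Y[OF t(2)]]) simp
    qed (use assms in \<open>simp add: countable_finite\<close>)
  qed
  then have "(\<lambda>\<omega>. real_of_int (grid_sum d a h m \<omega>)) -` {real_of_int c} \<inter> space M \<in> sets M"
    by (rule measurable_sets) simp
  then show ?thesis
    by (rule back_subst[of "\<lambda>x. x \<in> sets M"]) (simp only: vimage_def singleton_iff of_int_eq_iff, blast)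
qed

text \<open>Conditionally on \<open>B\<close>, iterating the lifted kernel yields the joint law of
  the endpoint and the grid sum, with \<open>j\<close> the value already on the counter. The Markov
  event is carried along because the next step is taken from it.\<close>

lemma grid_event:
  assumes fin: "finite S" and L: "bounded_operator S L C"
    and B: "mev a s B" and a: "0 \<le> a" and h: "0 < h" and s: "s \<in> S"
  shows "s' \<in> S \<Longrightarrow>
    mev (a + real m * h) s' (B \<inter> {\<omega> \<in> space M. Y (a + real m * h) \<omega> = s' \<and> j + grid_sum d a h m \<omega> = c}) \<and>
    measure M (B \<inter> {\<omega> \<in> space M. Y (a + real m * h) \<omega> = s' \<and> j + grid_sum d a h m \<omega> = c}) =
      measure M B * (lift_op d (markov_semigroup L h) ^^ m) (indicator {(s', c)}) (s, j)"
proof (induction m arbitrary: s' c)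
  case 0
  have "B \<inter> {\<omega> \<in> space M. Y (a + real 0 * h) \<omega> = s' \<and> j + grid_sum d a h 0 \<omega> = c} =
      (if s = s' \<and> j = c then B else {})"
    using mev_sub[OF B] by auto
  then show ?case using B mev_empty by (auto simp: indicator_def)
next
  case (Suc m)
  let ?P = "lift_op d (markov_semigroup L h)"
  let ?u = "a + real m * h" and ?v = "a + real (Suc m) * h"
  let ?E = "\<lambda>r. B \<inter> {\<omega> \<in> space M. Y ?u \<omega> = r \<and> j + grid_sum d a h m \<omega> = c - d r s'}"
  let ?E' = "\<lambda>r. ?E r \<inter> {\<omega> \<in> space M. Y ?v \<omega> = s'}"
  have uv: "0 \<le> ?u" "?u < ?v" "0 \<le> ?v" "?v - ?u = h" using a h by (auto simp: algebra_simps)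
  interpret L: bounded_operator S L C by fact
  interpret Lh: bounded_operator S "markov_semigroup L h" "exp (C * h)"
    using h by (intro L.semigroup_bounded_operator) simp
  interpret P: bounded_operator "S \<times> UNIV" ?P "exp (C * h)"
    by (rule bounded_operator_lift) (rule Lh.bounded_operator_axioms)
  interpret Pm: bounded_operator "S \<times> UNIV" "?P ^^ m" "exp (C * h) ^ m" by (rule P.funpow)
  have eq: "B \<inter> {\<omega> \<in> space M. Y ?v \<omega> = s' \<and> j + grid_sum d a h (Suc m) \<omega> = c} = (\<Union>r\<in>S. ?E' r)"
    using Y_in[OF uv(1)] by auto
  have st: "mev ?v s' (?E' r)"
    "measure M (?E' r) = measure M B * ((?P ^^ m) (indicator {(r, c - d r s')}) (s, j) * transition_prob L h r s')"
    if r: "r \<in> S" for r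
    using mev_step[OF conjunct1[OF Suc.IH[OF r]] uv(1,2) r Suc.prems] Suc.IH[OF r] uv(4) by auto
  have disj: "disjoint_family_on ?E' S" by (auto simp: disjoint_family_on_def)
  \<comment> \<open>To reach \<open>(s', c)\<close> in one step from \<open>r\<close>, the counter
    must stand at \<open>c - d r s'\<close> beforehand.\<close>
  have one: "?P (indicator {(s', c)}) (r, i) = transition_prob L h r s' * indicator {(r, c - d r s')} (r, i)"
    if "r \<in> S" for r i
  proof -
    have "?P (indicator {(s', c)}) (r, i) =
        markov_semigroup L h (\<lambda>v. (if i + d r s' = c then 1 else 0) * indicator {s'} v) r"
      unfolding lift_op_def prod.case
      by (rule Lh.cong[OF bounded_on_finite[OF fin] _ that]) (auto simp: indicator_def)
    also have "\<dots> = (if i + d r s' = c then 1 else 0) * transition_prob L h r s'"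
      unfolding transition_prob_def by (rule Lh.scale[OF bounded_on_indicator that])
    finally show ?thesis by (auto simp: indicator_def)
  qed
  \<comment> \<open>The induction adds a time step at the end, which acts on the test function
    first; hence the innermost factor is peeled off.\<close>
  have "(?P ^^ Suc m) (indicator {(s', c)}) (s, j) = (?P ^^ m) (?P (indicator {(s', c)})) (s, j)"
    by (simp add: funpow_swap1)
  also have "\<dots> = (?P ^^ m) (\<lambda>x. \<Sum>r\<in>S. transition_prob L h r s' * indicator {(r, c - d r s')} x) (s, j)"
  proof (rule Pm.cong)
    show "bounded_on (S \<times> UNIV) (?P (indicator {(s', c)}))"
      by (rule P.bounded_image[OF bounded_on_indicator])
    fix x assume x: "x \<in> S \<times> (UNIV :: int set)"
    obtain r i where ri: "x = (r, i)" by force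
    have "(\<Sum>r'\<in>S. transition_prob L h r' s' * indicator {(r', c - d r' s')} (r, i)) =
        (\<Sum>r'\<in>S. if r' = r then transition_prob L h r s' * indicator {(r, c - d r s')} (r, i) else 0)"
      by (intro sum.cong) (auto simp: indicator_def)
    then show "?P (indicator {(s', c)}) x = (\<Sum>r\<in>S. transition_prob L h r s' * indicator {(r, c - d r s')} x)"
      using one[of r i] x fin ri by simp
  qed (use s in simp)
  also have "\<dots> = (\<Sum>r\<in>S. transition_prob L h r s' * (?P ^^ m) (indicator {(r, c - d r s')}) (s, j))"
    by (rule Pm.sum[OF bounded_on_indicator]) (use s in simp)
  finally have rhs: "(?P ^^ Suc m) (indicator {(s', c)}) (s, j) =
      (\<Sum>r\<in>S. (?P ^^ m) (indicator {(r, c - d r s')}) (s, j) * transition_prob L h r s')"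
    by (simp add: mult.commute)
  have "measure M (\<Union>r\<in>S. ?E' r) = (\<Sum>r\<in>S. measure M (?E' r))"
    using fin st(1) mev_sets disj by (intro finite_measure_finite_Union) auto
  also have "\<dots> = (\<Sum>r\<in>S. measure M B * ((?P ^^ m) (indicator {(r, c - d r s')}) (s, j) * transition_prob L h r s'))"
    by (intro sum.cong refl st(2))
  also have "\<dots> = measure M B * (?P ^^ Suc m) (indicator {(s', c)}) (s, j)"
    by (simp only: rhs sum_distrib_left)
  finally show ?case
    unfolding eq using mev_Union[OF fin st(1) disj uv(3)] by blast
qed

end

text \<open>\<open>J\<close> is a functional of the path, so its measurability and its law both have
  to come from the grid sums, which almost surely end up equal to its increments.\<close>

theorem jump_sum_markov_chain:
  assumes Y: "markov_chain M S L s0 Y" and fin: "finite S" and L: "bounded_operator S L C"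
    and d: "\<And>s. d s s = 0"
  obtains J where "markov_chain M (S \<times> UNIV) (lift_op d L) (s0, 0) (\<lambda>t \<omega>. (Y t \<omega>, J t \<omega>))"
    "AE \<omega> in M. cadlag_path (\<lambda>t. Y t \<omega>) \<and> (\<forall>t\<ge>0. J t \<omega> = jump_sum d (\<lambda>t. Y t \<omega>) 0 t)"
proof -
  interpret jump_chain M S L s0 Y by unfold_locales fact
  interpret L: bounded_operator S L C by fact
  obtain G where G: "G \<in> sets M" "AE \<omega> in M. \<omega> \<in> G" "\<And>\<omega>. \<omega> \<in> G \<Longrightarrow> cadlag_path (\<lambda>t. Y t \<omega>)"
    by (rule good_set) blast
  \<comment> \<open>The default \<open>0\<close> outside \<open>G\<close> makes \<open>J\<close>
    measurable whatever the paths do there.\<close>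
  define J where "J t \<omega> = (if \<omega> \<in> G then jump_sum d (\<lambda>t. Y t \<omega>) 0 t else 0)" for t \<omega>
  have J0: "J 0 \<omega> = 0" for \<omega> unfolding J_def jump_sum_def by simp
  have lim: "\<forall>\<^sub>F m in sequentially. grid_sum d a ((b - a) / real m) m \<omega> = J b \<omega> - J a \<omega>"
    if "\<omega> \<in> G" "0 \<le> a" "a \<le> b" for a b \<omega>
    using grid_jump_sum[OF G(3)[OF that(1)] that(2,3), of d] d
      jump_sum_split[OF G(3)[OF that(1)] order_refl that(2,3), of d] that
    by (auto simp: J_def elim: eventually_mono)
  have J_event: "{\<omega> \<in> space M. J t \<omega> = c} \<in> sets M" if t: "0 \<le> t" for t c
  proof -
    have "{\<omega> \<in> space M. J t \<omega> = c} =
        (G \<inter> {\<omega> \<in> space M. \<forall>\<^sub>F m in sequentially. grid_sum d 0 ((t - 0) / real m) m \<omega> = c}) \<union>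
        {\<omega> \<in> space M - G. 0 = c}" (is "?l = ?r")
    proof -
      have "J t \<omega> = c \<longleftrightarrow> (\<forall>\<^sub>F m in sequentially. grid_sum d 0 ((t - 0) / real m) m \<omega> = c)" if "\<omega> \<in> G" for \<omega>
      proof
        assume "J t \<omega> = c"
        then show "\<forall>\<^sub>F m in sequentially. grid_sum d 0 ((t - 0) / real m) m \<omega> = c"
          using lim[OF that order_refl t] J0 by simp
      next
        assume "\<forall>\<^sub>F m in sequentially. grid_sum d 0 ((t - 0) / real m) m \<omega> = c"
        then have "\<forall>\<^sub>F m in sequentially. J t \<omega> = c"
          using lim[OF that order_refl t] by eventually_elim (simp add: J0)
        then show "J t \<omega> = c" by simp
      qed
      then show ?thesis using sets.sets_into_space[OF G(1)] by (auto simp: J_def)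
    qed
    also have "\<dots> \<in> sets M"
      using G(1) grid_sum_event[OF fin order_refl, of "(t - 0) / real _"] t
      by (intro sets.Un sets.Int sets_Collect_eventually_sequentially) auto
    finally show ?thesis .
  qed
  have YJ_event: "{\<omega> \<in> space M. Y t \<omega> = s \<and> J t \<omega> = c} \<in> sets M" if "0 \<le> t" for t s c
    using sets.Int[OF Y_event[OF that, of "\<lambda>x. x = s"] J_event[OF that, of c]]
    by (rule back_subst[of "\<lambda>x. x \<in> sets M"]) auto
  \<comment> \<open>\<open>B\<close> may contain information about \<open>J\<close>, but the Markov
    property invoked is that of \<open>Y\<close> alone. With \<open>J a = j\<close> on
    \<open>B\<close>, the condition on \<open>J b\<close> becomes one on the increment from
    \<open>a\<close> to \<open>b\<close>.\<close>
  have key: "mev b s' (B \<inter> {\<omega> \<in> space M. Y b \<omega> = s' \<and> J b \<omega> = c})"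
    "measure M (B \<inter> {\<omega> \<in> space M. Y b \<omega> = s' \<and> J b \<omega> = c}) =
      measure M B * transition_prob (lift_op d L) (b - a) (s, j) (s', c)"
    if B: "mev a s B" and Bj: "B \<subseteq> {\<omega>. J a \<omega> = j}" and ab: "0 \<le> a" "a < b" and s: "s \<in> S" "s' \<in> S"
    for a b B s s' j c
  proof -
    let ?B = "B \<inter> {\<omega> \<in> space M. Y b \<omega> = s' \<and> J b \<omega> = c}"
    let ?h = "\<lambda>m. (b - a) / real m"
    define D where "D m = B \<inter> {\<omega> \<in> space M. Y b \<omega> = s' \<and> j + grid_sum d a (?h m) m \<omega> = c}" for m
    \<comment> \<open>The shift to \<open>Suc m\<close> avoids a mesh with denominator zero.\<close>
    have D: "mev b s' (D (Suc m))"
      "measure M (D (Suc m)) =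
        measure M B * (lift_op d (markov_semigroup L (?h (Suc m))) ^^ Suc m) (indicator {(s', c)}) (s, j)" for m
    proof -
      have "a + real (Suc m) * ?h (Suc m) = b" by (simp add: field_simps)
      then show "mev b s' (D (Suc m))" "measure M (D (Suc m)) =
        measure M B * (lift_op d (markov_semigroup L (?h (Suc m))) ^^ Suc m) (indicator {(s', c)}) (s, j)"
        using grid_event[OF fin L B ab(1) _ s, of "?h (Suc m)" "Suc m" j d c] ab unfolding D_def by auto
    qed
    have B': "?B \<in> sets M" using mev_sets[OF B] YJ_event ab by auto
    have AE: "AE \<omega> in M. \<forall>\<^sub>F m in sequentially. \<omega> \<in> D (Suc m) \<longleftrightarrow> \<omega> \<in> ?B"
      using G(2)
    proof eventually_elim
      case (elim \<omega>)
      have "\<forall>\<^sub>F m in sequentially. \<omega> \<in> D m \<longleftrightarrow> \<omega> \<in> ?B"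
        using lim[OF elim ab(1) less_imp_le[OF ab(2)]]
      proof eventually_elim
        case (elim m)
        show ?case using elim Bj unfolding D_def by auto
      qed
      then show ?case
        by (rule eventually_sequentially_Suc[of "\<lambda>m. \<omega> \<in> D m \<longleftrightarrow> \<omega> \<in> ?B", THEN iffD2])
    qed
    show "mev b s' ?B" by (rule mev_limit[OF D(1) B' _ _ AE]) (use ab in auto)
    have "(\<lambda>m. measure M (D (Suc m))) \<longlonglongrightarrow> measure M ?B"
      by (rule measure_limit[OF mev_sets[OF D(1)] B' AE])
    moreover have "(\<lambda>m. measure M (D (Suc m))) \<longlonglongrightarrow> measure M B * transition_prob (lift_op d L) (b - a) (s, j) (s', c)"
      unfolding D(2) transition_prob_def
      by (intro tendsto_mult tendsto_const LIMSEQ_Suc[OF lift_chernoff[OF L d bounded_on_indicator s(1)]]) (use ab in simp)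
    ultimately show "measure M ?B = measure M B * transition_prob (lift_op d L) (b - a) (s, j) (s', c)"
      by (rule LIMSEQ_unique)
  qed
  define B where "B t z n = {\<omega> \<in> space M. \<forall>i\<le>n. (Y (t i) \<omega>, J (t i) \<omega>) = z i}" for t z and n :: nat
  have BSuc: "B t z (Suc n) = B t z n \<inter> {\<omega> \<in> space M. Y (t (Suc n)) \<omega> = fst (z (Suc n)) \<and> J (t (Suc n)) \<omega> = snd (z (Suc n))}" for t z n
    unfolding B_def by (auto simp: le_Suc_eq prod_eq_iff)
  have BJ: "B t z n \<subseteq> {\<omega>. J (t n) \<omega> = snd (z n)}" for t z n
    unfolding B_def by (auto simp: prod_eq_iff)
  have mB: "mev (t n) (fst (z n)) (B t z n)"
    if "0 \<le> t 0" "\<forall>i<n. t i < t (Suc i)" "\<forall>i\<le>n. z i \<in> S \<times> UNIV" for t z n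
    using that
  proof (induction n)
    case 0
    have s: "fst (z 0) \<in> S" using 0 by (auto simp: mem_Times_iff)
    have B0: "B t z 0 = {\<omega> \<in> space M. Y (t 0) \<omega> = fst (z 0) \<and> J (t 0) \<omega> = snd (z 0)}"
      unfolding B_def by (auto simp: prod_eq_iff)
    show ?case
    \<comment> \<open>At time \<open>0\<close> the counter vanishes and no interval precedes. A
      later first time is reached from time \<open>0\<close>, after splitting by the state
      there.\<close>
    proof (cases "t 0 = 0")
      case True
      then have "B t z 0 = (if snd (z 0) = 0 then {\<omega> \<in> space M. Y (t 0) \<omega> = fst (z 0)} else {})"
        unfolding B0 using J0 by auto
      then show ?thesis using mev_start[OF 0(1)] mev_empty by simp
    next
      case False
      then have t: "0 < t 0" using 0 by simp
      have "B t z 0 = (\<Union>r\<in>S. {\<omega> \<in> space M. Y 0 \<omega> = r} \<inter> {\<omega> \<in> space M. Y (t 0) \<omega> = fst (z 0) \<and> J (t 0) \<omega> = snd (z 0)})"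
        unfolding B0 using Y_in[of 0] by auto
      moreover have "mev (t 0) (fst (z 0)) \<dots>"
        by (rule mev_Union[OF fin key(1)[OF mev_start _ _ t _ s]]) (use t J0 in \<open>auto simp: disjoint_family_on_def\<close>)
      ultimately show ?thesis by simp
    qed
  next
    case (Suc n)
    have "0 \<le> t n" by (rule grid_nonneg[of t "Suc n"]) (use Suc.prems in auto)
    then show ?case
      unfolding BSuc by (intro key(1)[OF Suc.IH BJ]) (use Suc.prems in \<open>auto simp: mem_Times_iff\<close>)
  qed
  have markov: "measure M (B t z (Suc n)) = measure M (B t z n) * transition_prob (lift_op d L) (t (Suc n) - t n) (z n) (z (Suc n))"
    if "0 \<le> t 0" "\<forall>i\<le>n. t i < t (Suc i)" "\<forall>i\<le>Suc n. z i \<in> S \<times> UNIV" for t z n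
  proof -
    have pre: "\<forall>i<n. t i < t (Suc i)" "\<forall>i\<le>n. z i \<in> S \<times> UNIV" using that by auto
    have "0 \<le> t n" by (rule grid_nonneg[of t n]) (use that in auto)
    then show ?thesis
      unfolding BSuc
      by (subst key(2)[OF mB[OF that(1) pre] BJ]) (use that in \<open>auto simp: mem_Times_iff\<close>)
  qed
  have "(\<lambda>\<omega>. (Y t \<omega>, J t \<omega>)) \<in> measurable M (count_space (S \<times> UNIV))" if t: "0 \<le> t" for t
  proof (subst measurable_count_space_eq_countable)
    show "countable (S \<times> (UNIV :: int set))" using fin by (simp add: countable_finite)
    have "(\<lambda>\<omega>. (Y t \<omega>, J t \<omega>)) -` {z} \<inter> space M \<in> sets M" for z
      using YJ_event[OF t, of "fst z" "snd z"]
      by (rule back_subst[of "\<lambda>x. x \<in> sets M"]) (auto simp: prod_eq_iff)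
    then show "(\<lambda>\<omega>. (Y t \<omega>, J t \<omega>)) \<in> space M \<rightarrow> S \<times> UNIV \<and>
        (\<forall>a\<in>S \<times> UNIV. (\<lambda>\<omega>. (Y t \<omega>, J t \<omega>)) -` {a} \<inter> space M \<in> sets M)"
      using Y_in[OF t] by auto
  qed
  moreover have "AE \<omega> in M. cadlag_path (\<lambda>t. (Y t \<omega>, J t \<omega>))"
    using G(2)
  proof eventually_elim
    case (elim \<omega>)
    then show ?case using cadlag_jump_sum[OF G(3)[OF elim], of d] by (simp add: J_def)
  qed
  moreover have "AE \<omega> in M. (Y 0 \<omega>, J 0 \<omega>) = (s0, 0)"
    using chain J0 unfolding markov_chain_def by auto
  ultimately have "markov_chain M (S \<times> UNIV) (lift_op d L) (s0, 0) (\<lambda>t \<omega>. (Y t \<omega>, J t \<omega>))"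
    unfolding markov_chain_def using prob_space_axioms markov[unfolded B_def] by blast
  moreover have "AE \<omega> in M. cadlag_path (\<lambda>t. Y t \<omega>) \<and> (\<forall>t\<ge>0. J t \<omega> = jump_sum d (\<lambda>t. Y t \<omega>) 0 t)"
    using G(2) by eventually_elim (simp add: G(3) J_def)
  ultimately show thesis by (rule that)
qed

section \<open>Jumps that the generator forbids\<close>

text \<open>For a forbidden pair \<open>r \<noteq> r'\<close> the terms of order zero and one in the
  transition probability vanish. The functional that is \<open>1\<close> on exactly this pair counts
  the corresponding jumps, and the grid sums detect a nonzero count.\<close>

theorem jumps_along_generator:
  assumes Y: "markov_chain M S L s0 Y" and fin: "finite S" and L: "bounded_operator S L C"
  shows "AE \<omega> in M. cadlag_path (\<lambda>t. Y t \<omega>) \<and>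
    (\<forall>u\<in>jump_times (\<lambda>t. Y t \<omega>). L (indicator {Y u \<omega>}) (left_value (\<lambda>t. Y t \<omega>) u) \<noteq> 0)"
proof -
  interpret jump_chain M S L s0 Y by unfold_locales fact
  interpret L: bounded_operator S L C by fact
  obtain G where G: "G \<in> sets M" "AE \<omega> in M. \<omega> \<in> G" "\<And>\<omega>. \<omega> \<in> G \<Longrightarrow> cadlag_path (\<lambda>t. Y t \<omega>)"
    by (rule good_set) blast
  let ?d = "\<lambda>r r' s s'. if s = r \<and> s' = r' then 1 else 0 :: int"
  have null: "AE \<omega> in M. jump_sum (?d r r') (\<lambda>t. Y t \<omega>) 0 T = 0"
    if r: "r \<in> S" "r' \<in> S" "r \<noteq> r'" "L (indicator {r'}) r = 0" and T: "0 < T" for r r' T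
  proof -
    let ?h = "\<lambda>m. (T - 0) / real m"
    define D where "D m = {\<omega> \<in> space M. grid_sum (?d r r') 0 (?h m) m \<omega> \<noteq> 0}" for m
    define A where "A = {\<omega> \<in> space M. \<forall>\<^sub>F m in sequentially. \<omega> \<in> D m}"
    have D: "D m \<in> sets M" for m
    proof -
      have "D m = space M - {\<omega> \<in> space M. grid_sum (?d r r') 0 (?h m) m \<omega> = 0}"
        unfolding D_def by auto
      then show ?thesis using grid_sum_event[OF fin order_refl, of "?h m" "?d r r'" m 0] T by auto
    qed
    have lim: "\<forall>\<^sub>F m in sequentially. grid_sum (?d r r') 0 (?h m) m \<omega> = jump_sum (?d r r') (\<lambda>t. Y t \<omega>) 0 T"
      if "\<omega> \<in> G" for \<omega>
    proof -
      have d0: "?d r r' s s = 0" for s using r(3) by simp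
      show ?thesis
        by (rule eventually_mono[OF grid_jump_sum[where d = "?d r r'", OF G(3)[OF that] order_refl less_imp_le[OF T] d0]]) blast
    qed
    have A: "A \<in> sets M"
      unfolding A_def by (intro sets_Collect_eventually_sequentially) (use D in \<open>auto simp: D_def\<close>)
    have AG: "(\<forall>\<^sub>F m in sequentially. \<omega> \<in> D m \<longleftrightarrow> \<omega> \<in> A) \<and> (\<omega> \<in> A \<longleftrightarrow> jump_sum (?d r r') (\<lambda>t. Y t \<omega>) 0 T \<noteq> 0)"
      if w: "\<omega> \<in> G" for \<omega>
    proof -
      have sp: "\<omega> \<in> space M" using w sets.sets_into_space[OF G(1)] by auto
      have *: "\<forall>\<^sub>F m in sequentially. \<omega> \<in> D m \<longleftrightarrow> jump_sum (?d r r') (\<lambda>t. Y t \<omega>) 0 T \<noteq> 0"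
        using lim[OF w] by eventually_elim (use sp in \<open>auto simp: D_def\<close>)
      have "\<omega> \<in> A \<longleftrightarrow> jump_sum (?d r r') (\<lambda>t. Y t \<omega>) 0 T \<noteq> 0"
      proof
        assume "\<omega> \<in> A"
        then have "\<forall>\<^sub>F m in sequentially. \<omega> \<in> D m" unfolding A_def by simp
        then have "\<forall>\<^sub>F m in sequentially. jump_sum (?d r r') (\<lambda>t. Y t \<omega>) 0 T \<noteq> 0"
          using * by eventually_elim simp
        then show "jump_sum (?d r r') (\<lambda>t. Y t \<omega>) 0 T \<noteq> 0" by simp
      next
        assume "jump_sum (?d r r') (\<lambda>t. Y t \<omega>) 0 T \<noteq> 0"
        then show "\<omega> \<in> A" unfolding A_def using * sp by simp
      qed
      then show ?thesis using * by simp
    qed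
    have bound: "measure M (D m) \<le> (C * T)\<^sup>2 * exp (C * T) / real m" if m: "0 < m" for m
    proof -
      let ?E = "\<lambda>i. {\<omega> \<in> space M. Y (real i * ?h m) \<omega> = r} \<inter> {\<omega> \<in> space M. Y (real (Suc i) * ?h m) \<omega> = r'}"
      have h: "0 < ?h m" using m T by simp
      have tp: "\<bar>transition_prob L (?h m) r r'\<bar> \<le> (C * ?h m)\<^sup>2 * exp (C * ?h m)"
        using L.semigroup_taylor[of "indicator {r'}" 1 r "?h m"] r h
        unfolding transition_prob_def by (auto simp: indicator_def)
      have E: "?E i \<in> sets M" "measure M (?E i) \<le> (C * ?h m)\<^sup>2 * exp (C * ?h m)" for i
      proof -
        have t: "0 \<le> real i * ?h m" "real i * ?h m < real (Suc i) * ?h m"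
          by (rule mult_nonneg_nonneg, use h in simp, use h in simp)
            (rule mult_strict_right_mono, simp, rule h)
        note st = mev_step[OF mev_start[OF t(1)] t r(1,2)]
        show "?E i \<in> sets M" by (rule mev_sets[OF st(1)])
        have "real (Suc i) * ?h m - real i * ?h m = ?h m" by (simp add: algebra_simps add_divide_distrib)
        then have "measure M (?E i) = measure M {\<omega> \<in> space M. Y (real i * ?h m) \<omega> = r} * transition_prob L (?h m) r r'"
          using st(2) by simp
        also have "\<dots> \<le> 1 * \<bar>transition_prob L (?h m) r r'\<bar>"
          using mult_left_mono[OF abs_ge_self[of "transition_prob L (?h m) r r'"], of "measure M {\<omega> \<in> space M. Y (real i * ?h m) \<omega> = r}"]
            mult_right_mono[OF prob_le_1[of "{\<omega> \<in> space M. Y (real i * ?h m) \<omega> = r}"], of "\<bar>transition_prob L (?h m) r r'\<bar>"]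
          by (meson abs_ge_zero measure_nonneg order_trans)
        finally show "measure M (?E i) \<le> (C * ?h m)\<^sup>2 * exp (C * ?h m)" using tp by simp
      qed
      have "D m \<subseteq> (\<Union>i<m. ?E i)"
      proof
        fix \<omega> assume w: "\<omega> \<in> D m"
        then have "grid_sum (?d r r') 0 (?h m) m \<omega> \<noteq> 0" unfolding D_def by blast
        then obtain i where "i \<in> {..<m}" "?d r r' (Y (0 + real i * ?h m) \<omega>) (Y (0 + real (Suc i) * ?h m) \<omega>) \<noteq> 0"
          by (rule sum.not_neutral_contains_not_neutral)
        then show "\<omega> \<in> (\<Union>i<m. ?E i)" using w unfolding D_def by (auto split: if_splits)
      qed
      then have "measure M (D m) \<le> measure M (\<Union>i<m. ?E i)"
        using E(1) by (intro finite_measure_mono sets.finite_UN) auto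
      also have "\<dots> \<le> (\<Sum>i<m. measure M (?E i))"
        using E(1) by (intro finite_measure_subadditive_finite) auto
      also have "\<dots> \<le> (\<Sum>i<m. (C * ?h m)\<^sup>2 * exp (C * ?h m))" by (intro sum_mono E(2))
      also have "\<dots> = (C * T)\<^sup>2 / real m * exp (C * ?h m)"
        using m by (simp add: power2_eq_square field_simps)
      also have "\<dots> \<le> (C * T)\<^sup>2 / real m * exp (C * T)"
      proof -
        have "T * 1 \<le> T * real m" using m T by (intro mult_left_mono) auto
        then have "C * ?h m \<le> C * T"
          using m L.C_nonneg by (intro mult_left_mono) (simp_all add: divide_le_eq)
        then show ?thesis by (intro mult_left_mono) auto
      qed
      finally show ?thesis by simp
    qed
    have "(\<lambda>m. measure M (D m)) \<longlonglongrightarrow> measure M A"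
      by (rule measure_limit[OF D A]) (use G(2) in \<open>eventually_elim, use AG in blast\<close>)
    moreover have "(\<lambda>m. measure M (D m)) \<longlonglongrightarrow> 0"
    proof (rule Lim_null_comparison)
      show "\<forall>\<^sub>F m in sequentially. norm (measure M (D m)) \<le> (C * T)\<^sup>2 * exp (C * T) / real m"
        using eventually_gt_at_top[of 0] by eventually_elim (use bound in simp)
      show "(\<lambda>m. (C * T)\<^sup>2 * exp (C * T) / real m) \<longlonglongrightarrow> 0"
        by (intro real_tendsto_divide_at_top[OF tendsto_const] filterlim_real_sequentially)
    qed
    ultimately have "measure M A = 0" by (rule LIMSEQ_unique)
    then have "A \<in> null_sets M" using A by (simp add: null_sets_def emeasure_eq_measure)
    from AE_not_in[OF this] G(2) show ?thesis by eventually_elim (use AG in blast)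
  qed
  \<comment> \<open>Finitely many pairs and integer horizons leave a single null set that serves all
    jump times; \<open>Suc T\<close> keeps the horizon positive.\<close>
  have "AE \<omega> in M. \<forall>(r, r')\<in>{(r, r'). r \<in> S \<and> r' \<in> S \<and> r \<noteq> r' \<and> L (indicator {r'}) r = 0}.
      \<forall>T::nat. jump_sum (?d r r') (\<lambda>t. Y t \<omega>) 0 (real (Suc T)) = 0"
  proof (rule AE_ball_countable')
    show "countable {(r, r'). r \<in> S \<and> r' \<in> S \<and> r \<noteq> r' \<and> L (indicator {r'}) r = 0}"
      by (rule countable_subset[of _ "S \<times> S"]) (use fin in \<open>auto simp: countable_finite\<close>)
  qed (auto simp: AE_all_countable intro!: null)
  then show ?thesis using G(2) AE_space
  proof eventually_elim
    case (elim \<omega>)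
    let ?p = "\<lambda>t. Y t \<omega>"
    have p: "cadlag_path ?p" using G(3) elim by blast
    have "L (indicator {Y u \<omega>}) (left_value ?p u) \<noteq> 0" if u: "u \<in> jump_times ?p" for u
    proof
      assume L0: "L (indicator {Y u \<omega>}) (left_value ?p u) = 0"
      have u0: "0 < u" "left_value ?p u \<noteq> Y u \<omega>" using u unfolding jump_times_def by auto
      from left_value_attained[OF p u0(1)] obtain v where v: "0 < v" "v < u" "?p v = left_value ?p u" by metis
      have S: "left_value ?p u \<in> S" "Y u \<omega> \<in> S"
        using Y_in[of v \<omega>] Y_in[of u \<omega>] u0 v elim by auto
      obtain T :: nat where T: "u \<le> real (Suc T)"
        using real_nat_ceiling_ge[of u] by (meson le_SucI of_nat_le_iff order_refl order_trans)
      let ?I = "jump_times ?p \<inter> {0<..real (Suc T)}"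
      have "jump_sum (?d (left_value ?p u) (Y u \<omega>)) ?p 0 (real (Suc T)) = 0"
        using elim S u0 L0 by blast
      \<comment> \<open>A count is a sum of nonnegative terms, so a vanishing total excludes each
        forbidden jump.\<close>
      then have "\<forall>w\<in>?I. ?d (left_value ?p u) (Y u \<omega>) (left_value ?p w) (?p w) = 0"
        unfolding jump_sum_def
        by (subst (asm) sum_nonneg_eq_0_iff) (use finite_jump_times[OF p order_refl] in auto)
      moreover have "u \<in> ?I" using u u0 T by auto
      ultimately have "?d (left_value ?p u) (Y u \<omega>) (left_value ?p u) (?p u) = 0" by blast
      then show False by simp
    qed
    then show ?case using p by blast
  qed
qed

section \<open>Configurations seen from the tagged particle\<close>

lemma rep_in_torus: "0 < N \<Longrightarrow> rep N x \<in> torus N"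
proof -
  assume "0 < N"
  then have "0 \<le> (x - 1) mod N" "(x - 1) mod N < N" by simp_all
  then show ?thesis unfolding rep_def torus_def by simp
qed

lemma rep_id: "x \<in> torus N \<Longrightarrow> rep N x = x"
  unfolding rep_def torus_def by simp

lemma rep_eq_iff: "rep N x = rep N y \<longleftrightarrow> N dvd x - y"
proof -
  have "rep N x = rep N y \<longleftrightarrow> (x - 1) mod N = (y - 1) mod N" unfolding rep_def by simp
  also have "\<dots> \<longleftrightarrow> N dvd (x - 1) - (y - 1)" by (rule mod_eq_dvd_iff)
  finally show ?thesis by simp
qed

lemma rep_dvd: "N dvd rep N x - x"
  unfolding rep_def by (metis add_diff_cancel_left' diff_diff_eq2 dvd_minus_mod dvd_diff_commute add.commute)

lemma rep_eqI: "x \<in> torus N \<Longrightarrow> N dvd y - x \<Longrightarrow> rep N y = x"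
  using rep_eq_iff[of N y x] rep_id[of x N] by simp

lemma rep_rep_add [simp]: "rep N (rep N x + y) = rep N (x + y)"
  using rep_dvd[of N x] by (subst rep_eq_iff) (simp add: algebra_simps)

lemma rep_rep_diff [simp]: "rep N (rep N x - y) = rep N (x - y)"
  using rep_rep_add[of N x "- y"] by simp

lemma rep_diff_rep: "rep N (rep N x - rep N y) = rep N (x - y)"
proof -
  have "N dvd (rep N x - x) - (rep N y - y)" by (intro dvd_diff rep_dvd)
  then show ?thesis by (subst rep_eq_iff) (simp add: algebra_simps)
qed

lemma rep_add_multiple [simp]: "rep N (x + c * N) = rep N x" "rep N (x + N) = rep N x"
  by (simp_all add: rep_eq_iff)

lemma torus_eqI:
  assumes "x \<in> torus K" "y \<in> torus K" "K dvd x - y"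
  shows "x = y"
  using rep_eqI[OF assms(2,3)] rep_id[OF assms(1)] by simp

lemma finite_torus [simp]: "finite (torus N)"
  unfolding torus_def by simp

lemma GamD:
  assumes "\<eta> \<in> Gam N K"
  shows "x \<in> torus N \<Longrightarrow> \<eta> x = 0 \<or> \<eta> x = 1" "(\<Sum>x\<in>torus N. \<eta> x) = K"
  using assms unfolding Gam_def by auto

lemma tagged_statesD:
  assumes "(x, \<eta>) \<in> tagged_states N K"
  shows "\<eta> \<in> Gam N K" "x \<in> torus N" "\<eta> x = 1"
    "y \<in> torus N \<Longrightarrow> \<eta> y + \<eta> (rep N (y + 1)) \<ge> 1"
  using assms unfolding tagged_states_def Erg_def by auto

lemma finite_tagged_states: "finite (tagged_states N K)"
proof (rule finite_subset)
  show "tagged_states N K \<subseteq> torus N \<times> (torus N \<rightarrow>\<^sub>E {0, 1})"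
    unfolding tagged_states_def Erg_def Gam_def by auto
qed (intro finite_cartesian_product finite_PiE; simp)

section \<open>Ranks, positions and the periodic enumeration of particles\<close>

lemma particle_rank_0 [simp]: "particle_rank \<eta> 0 = 0"
  unfolding particle_rank_def by simp

lemma particle_rank_Suc: "0 \<le> x \<Longrightarrow> particle_rank \<eta> (x + 1) = particle_rank \<eta> x + \<eta> (x + 1)"
proof -
  assume "0 \<le> x"
  then have "{1..x + 1} = insert (x + 1) {1..x}" by auto
  then show ?thesis unfolding particle_rank_def by simp
qed

lemma particle_rank_mono:
  assumes "\<eta> \<in> Gam N K" "0 \<le> x" "x \<le> y" "y \<le> N"
  shows "particle_rank \<eta> x \<le> particle_rank \<eta> y"
  unfolding particle_rank_def
proof (rule sum_mono2)
  fix b assume "b \<in> {1..y} - {1..x}"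
  then show "0 \<le> \<eta> b" using GamD(1)[OF assms(1), of b] assms unfolding torus_def by auto
qed (use assms in auto)

lemma particle_rank_full: "\<eta> \<in> Gam N K \<Longrightarrow> particle_rank \<eta> N = K"
  using GamD(2)[of \<eta> N K] unfolding particle_rank_def torus_def by simp

lemma particle_rank_less:
  assumes "\<eta> \<in> Gam N K" "0 \<le> x" "x < y" "y \<le> N" "\<eta> y = 1"
  shows "particle_rank \<eta> x < particle_rank \<eta> y"
  using particle_rank_mono[OF assms(1,2), of "y - 1"] particle_rank_Suc[of "y - 1" \<eta>] assms by simp

lemma particle_rank_in_torus:
  assumes "\<eta> \<in> Gam N K" "x \<in> torus N" "\<eta> x = 1"
  shows "particle_rank \<eta> x \<in> torus K"
  using particle_rank_less[OF assms(1), of 0 x] particle_rank_mono[OF assms(1), of x N]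
    particle_rank_full[OF assms(1)] assms unfolding torus_def by auto

text \<open>The rank increases strictly on arrival at an occupied site, so no earlier site shares
  the rank of \<open>x\<close> and the infimum is a minimum.\<close>

lemma particle_pos_rank:
  assumes "\<eta> \<in> Gam N K" "x \<in> torus N" "\<eta> x = 1"
  shows "particle_pos N \<eta> (particle_rank \<eta> x) = x"
  unfolding particle_pos_def
proof (rule cInf_eq_minimum)
  show "x \<in> {y \<in> {1..N}. (\<Sum>i\<in>{1..y}. \<eta> i) = particle_rank \<eta> x}"
    using assms unfolding torus_def particle_rank_def by simp
  fix y assume "y \<in> {y \<in> {1..N}. (\<Sum>i\<in>{1..y}. \<eta> i) = particle_rank \<eta> x}"
  then have y: "1 \<le> y" "particle_rank \<eta> y = particle_rank \<eta> x" unfolding particle_rank_def by auto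
  show "x \<le> y"
    using particle_rank_less[OF assms(1), of y x] y assms unfolding torus_def by force
qed

text \<open>The number of particles of the periodic extension of \<open>\<eta>\<close> in \<open>{1..m}\<close>, continued to all
  integers \<open>m\<close> so that its increments are the occupation numbers.\<close>

definition cum_rank :: "int \<Rightarrow> int \<Rightarrow> config \<Rightarrow> int \<Rightarrow> int" where
  "cum_rank N K \<eta> m = particle_rank \<eta> (rep N m) + K * ((m - 1) div N)"

lemma cum_rank_Suc:
  assumes \<eta>: "\<eta> \<in> Gam N K" and N: "0 < N"
  shows "cum_rank N K \<eta> (m + 1) = cum_rank N K \<eta> m + \<eta> (rep N (m + 1))"
proof -
  define c r where "c = m div N" and "r = m mod N"
  have m: "m = N * c + r" "0 \<le> r" "r < N" using N unfolding c_def r_def by auto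
  show ?thesis
  proof (cases "r = 0")
    case True
    \<comment> \<open>When \<open>N\<close> divides \<open>m\<close>, its representative is
      \<open>N\<close>, not \<open>0\<close>; the next site opens a new period, where the full rank
      \<open>K\<close> is traded for one more multiple of \<open>K\<close>.\<close>
    have "m - 1 = N * (c - 1) + (N - 1)" using m True by (simp add: algebra_simps)
    then have "(m - 1) div N = c - 1" "(m - 1) mod N = N - 1"
      using int_div_pos_eq[of "m - 1" N "c - 1" "N - 1"] int_mod_pos_eq[of "m - 1" N "c - 1" "N - 1"] N by auto
    then have "cum_rank N K \<eta> m = particle_rank \<eta> (N - 1 + 1) + K * (c - 1)"
      unfolding cum_rank_def rep_def by presburger
    moreover have "cum_rank N K \<eta> (m + 1) = particle_rank \<eta> 1 + K * c" "rep N (m + 1) = 1"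
      using True unfolding cum_rank_def rep_def by (simp_all add: c_def r_def)
    ultimately show ?thesis
      using particle_rank_Suc[of 0 \<eta>] particle_rank_full[OF \<eta>] by (simp add: algebra_simps)
  next
    case False
    have "m - 1 = N * c + (r - 1)" using m by simp
    then have "(m - 1) div N = c" "(m - 1) mod N = r - 1"
      using int_div_pos_eq[of "m - 1" N c "r - 1"] int_mod_pos_eq[of "m - 1" N c "r - 1"] m False by auto
    then have "cum_rank N K \<eta> m = particle_rank \<eta> r + K * c"
      unfolding cum_rank_def rep_def by simp
    moreover have "cum_rank N K \<eta> (m + 1) = particle_rank \<eta> (r + 1) + K * c" "rep N (m + 1) = r + 1"
      unfolding cum_rank_def rep_def by (simp_all add: c_def r_def)
    ultimately show ?thesis using particle_rank_Suc[OF m(2), of \<eta>] by simp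
  qed
qed

lemma cum_rank_add_period: "0 < N \<Longrightarrow> cum_rank N K \<eta> (m + N) = cum_rank N K \<eta> m + K"
proof -
  assume N: "0 < N"
  have "m + N - 1 = (m - 1) + N" by simp
  moreover have "((m - 1) + N) div N = (m - 1) div N + 1" using N by (intro div_add_self2) simp
  ultimately have "(m + N - 1) div N = (m - 1) div N + 1" by metis
  then show ?thesis unfolding cum_rank_def by (simp add: distrib_left)
qed

lemma cum_rank_mono:
  assumes \<eta>: "\<eta> \<in> Gam N K" and N: "0 < N" and "m \<le> m'"
  shows "cum_rank N K \<eta> m \<le> cum_rank N K \<eta> m'"
  using assms(3)
proof (induction m' rule: int_ge_induct)
  case (step i)
  then show ?case using cum_rank_Suc[OF \<eta> N, of i] GamD(1)[OF \<eta> rep_in_torus[OF N], of "i + 1"] by auto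
qed simp

text \<open>Arriving at an occupied site raises \<open>cum_rank\<close> strictly. Occupied sites of
  the periodic extension are thus labelled by their ranks.\<close>

lemma cum_rank_inj:
  assumes \<eta>: "\<eta> \<in> Gam N K" and N: "0 < N"
    and "\<eta> (rep N m) = 1" "\<eta> (rep N m') = 1" "cum_rank N K \<eta> m = cum_rank N K \<eta> m'"
  shows "m = m'"
proof -
  have less: "cum_rank N K \<eta> a < cum_rank N K \<eta> b" if "a < b" "\<eta> (rep N b) = 1" for a b
    using cum_rank_mono[OF \<eta> N, of a "b - 1"] cum_rank_Suc[OF \<eta> N, of "b - 1"] that by simp
  show ?thesis using less[of m m'] less[of m' m] assms by (cases m m' rule: linorder_cases) auto
qed

lemma particle_pos_cum_rank:
  assumes \<eta>: "\<eta> \<in> Gam N K" and N: "0 < N" and m: "\<eta> (rep N m) = 1"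
  shows "particle_pos N \<eta> (rep K (cum_rank N K \<eta> m)) = rep N m"
proof -
  have "rep K (cum_rank N K \<eta> m) = particle_rank \<eta> (rep N m)"
    using particle_rank_in_torus[OF \<eta> rep_in_torus[OF N] m] by (intro rep_eqI) (auto simp: cum_rank_def)
  then show ?thesis using particle_pos_rank[OF \<eta> rep_in_torus[OF N] m] by simp
qed

text \<open>\<open>p\<close> lists the occupied sites of the periodic extension of \<open>\<eta>\<close> in increasing order, the
  tagged particle having index \<open>0\<close>; ergodicity of \<open>\<eta>\<close> says that the gaps are \<open>1\<close> or \<open>2\<close>.\<close>

definition enumerates :: "int \<Rightarrow> int \<Rightarrow> int \<times> config \<Rightarrow> (int \<Rightarrow> int) \<Rightarrow> bool" where
  "enumerates N K s p \<longleftrightarrow>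
     rep N (p 0) = fst s \<and> (\<forall>i. p (i + K) = p i + N) \<and>
     (\<forall>i. p (i + 1) = p i + 1 \<or> p (i + 1) = p i + 2) \<and>
     (\<forall>m. snd s (rep N m) = 1 \<longleftrightarrow> m \<in> range p)"

text \<open>\<open>3 \<le> N\<close> keeps a site and its two neighbours distinct modulo
  \<open>N\<close>. \<open>2 \<le> K\<close> keeps consecutive particle indices distinct modulo
  \<open>K\<close>, so one jump never moves both ends of a gap.\<close>

locale tagged_config =
  fixes N K x :: int and \<eta> :: config
  assumes N: "3 \<le> N" and K: "2 \<le> K" and tagged: "(x, \<eta>) \<in> tagged_states N K"
begin

lemma N_pos: "0 < N" and K_pos: "0 < K"
  using N K by auto

lemmas Gam = tagged_statesD(1)[OF tagged] and x = tagged_statesD(2)[OF tagged] and \<eta>x = tagged_statesD(3)[OF tagged]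

lemma occ_cases: "\<eta> (rep N m) = 0 \<or> \<eta> (rep N m) = 1"
  by (rule GamD(1)[OF Gam rep_in_torus[OF N_pos]])

lemma occ_next: "\<eta> (rep N m) = 1 \<or> \<eta> (rep N (m + 1)) = 1"
  using tagged_statesD(4)[OF tagged rep_in_torus[OF N_pos], of m] occ_cases[of m] occ_cases[of "m + 1"] by auto

text \<open>Ergodicity puts the next and the previous occupied site within distance
  \<open>2\<close>, and passing to them changes \<open>cum_rank\<close> by one. So every offset from
  the rank of the tag is attained, and injectivity makes the inverse of the rank the desired
  \<open>p\<close>.\<close>

lemma ex_enumeration: "\<exists>p. enumerates N K (x, \<eta>) p"
proof -
  let ?c = "cum_rank N K \<eta>"
  note inj = cum_rank_inj[OF Gam N_pos]
  note step = cum_rank_Suc[OF Gam N_pos]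
  define nx where "nx m = (if \<eta> (rep N (m + 1)) = 1 then m + 1 else m + 2)" for m
  have nx: "\<eta> (rep N (nx m)) = 1" "?c (nx m) = ?c m + 1" "nx m = m + 1 \<or> nx m = m + 2" for m
    using occ_next[of "m + 1"] step[of m] step[of "m + 1"] occ_cases[of "m + 1"] unfolding nx_def by (auto simp: add.assoc)
  define pv where "pv m = (if \<eta> (rep N (m - 1)) = 1 then m - 1 else m - 2)" for m
  have pv: "\<eta> (rep N (pv m)) = 1" "\<eta> (rep N m) = 1 \<Longrightarrow> ?c (pv m) = ?c m - 1" for m
    using occ_next[of "m - 2"] step[of "m - 1"] step[of "m - 2"] occ_cases[of "m - 1"] unfolding pv_def by auto
  have "\<exists>m. \<eta> (rep N m) = 1 \<and> ?c m = ?c x + i" for i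
  proof (induction i rule: int_induct[of _ 0])
    case base
    show ?case by (rule exI[of _ x]) (use \<eta>x rep_id[OF x] in auto)
  next
    case (step1 i)
    then show ?case using nx by (metis add.assoc)
  next
    case (step2 i)
    then show ?case using pv by (metis add_diff_eq)
  qed
  then obtain p where p: "\<And>i. \<eta> (rep N (p i)) = 1" "\<And>i. ?c (p i) = ?c x + i" by metis
  have p_eq: "m = p (?c m - ?c x)" if "\<eta> (rep N m) = 1" for m
    by (rule inj[OF that p(1)]) (simp add: p(2))
  have "p 0 = x" using p_eq[of x] \<eta>x rep_id[OF x] by simp
  moreover have "p (i + K) = p i + N" for i
    using p_eq[of "p i + N"] p by (simp add: cum_rank_add_period[OF N_pos])
  moreover have "p (i + 1) = nx (p i)" for i
    using p_eq[OF nx(1)[of "p i"]] nx(2)[of "p i"] p(2) by simp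
  ultimately show ?thesis
    unfolding enumerates_def using nx(3) p(1) p_eq rep_id[OF x] by (intro exI[of _ p]) (auto simp: image_iff, metis)
qed

end

section \<open>The gap configuration in terms of the enumeration\<close>

text \<open>The rank is recomputed from the tagged position, which makes this a function of the
  tagged state alone, usable as a lumping map.\<close>

definition gap_config :: "int \<Rightarrow> int \<Rightarrow> int \<times> config \<Rightarrow> config" where
  "gap_config N K s = snd (Phi N K (particle_rank (snd s) (fst s), snd s))"

locale enumerated_config = tagged_config +
  fixes p :: "int \<Rightarrow> int"
  assumes enum: "enumerates N K (x, \<eta>) p"
begin

lemma p_0: "rep N (p 0) = x" and p_period: "p (i + K) = p i + N"
  and p_gap: "p (i + 1) = p i + 1 \<or> p (i + 1) = p i + 2"
  and p_range: "\<eta> (rep N m) = 1 \<longleftrightarrow> m \<in> range p"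
  using enum unfolding enumerates_def by auto

lemma p_occ: "\<eta> (rep N (p i)) = 1"
  using p_range by blast

lemma p_less: "i < j \<Longrightarrow> p i < p j"
proof (induction j rule: int_gr_induct)
  case base
  then show ?case using p_gap[of i] by auto
next
  case (step j)
  then show ?case using p_gap[of j] by auto
qed

lemma p_eq_iff: "p i = p j \<longleftrightarrow> i = j"
  using p_less[of i j] p_less[of j i] by (cases i j rule: linorder_cases) auto

lemma p_less_iff: "p i < p j \<longleftrightarrow> i < j"
  using p_less[of i j] p_less[of j i] by (cases i j rule: linorder_cases) auto

lemma p_period_mult: "p (i + c * K) = p i + c * N"
proof (induction c rule: int_induct[of _ 0])
  case (step1 c)
  then show ?case using p_period[of "i + c * K"] by (simp add: algebra_simps)
next
  case (step2 c)
  then show ?case using p_period[of "i + (c - 1) * K"] by (simp add: algebra_simps)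
qed simp

lemma p_cong_iff: "rep N (p i) = rep N (p j) \<longleftrightarrow> K dvd i - j"
proof
  assume "rep N (p i) = rep N (p j)"
  then obtain c where "p i = p j + c * N" unfolding rep_eq_iff by (metis dvd_def add.commute diff_add_cancel mult.commute)
  then have "p i = p (j + c * K)" by (simp add: p_period_mult)
  then have "i = j + c * K" by (simp add: p_eq_iff)
  then show "K dvd i - j" by simp
next
  assume "K dvd i - j"
  then obtain c where "i = j + c * K" by (metis dvd_def add.commute diff_add_cancel mult.commute)
  then show "rep N (p i) = rep N (p j)" by (simp add: p_period_mult)
qed

text \<open>If the gap is \<open>2\<close>, the site after \<open>p i\<close> lies strictly between
  consecutive values of the increasing \<open>p\<close>, hence is empty.\<close>

lemma occ_after: "\<eta> (rep N (p i + 1)) = 2 - (p (i + 1) - p i)"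
proof (cases "p (i + 1) = p i + 1")
  case True
  then show ?thesis using p_occ[of "i + 1"] by simp
next
  case False
  then have gap: "p (i + 1) = p i + 2" using p_gap[of i] by blast
  have "p i + 1 \<noteq> p j" for j
  proof
    assume "p i + 1 = p j"
    then have "p i < p j" "p j < p (i + 1)" using gap by auto
    then show False unfolding p_less_iff by simp
  qed
  then have "\<eta> (rep N (p i + 1)) \<noteq> 1" using p_range[of "p i + 1"] by blast
  then show ?thesis using occ_cases[of "p i + 1"] gap by auto
qed

lemma occ_before: "\<eta> (rep N (p i - 1)) = 2 - (p i - p (i - 1))"
proof (cases "p i = p (i - 1) + 1")
  case True
  then show ?thesis using p_occ[of "i - 1"] by simp
next
  case False
  then have "p i = p (i - 1) + 2" using p_gap[of "i - 1"] by simp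
  then show ?thesis using occ_after[of "i - 1"] by (simp add: add.commute)
qed

lemma cum_rank_p: "cum_rank N K \<eta> (p i) = cum_rank N K \<eta> (p 0) + i"
proof -
  have step: "cum_rank N K \<eta> (p (i + 1)) = cum_rank N K \<eta> (p i) + 1" for i
    using p_gap[of i] occ_after[of i] p_occ[of "i + 1"]
      cum_rank_Suc[OF Gam N_pos, of "p i"] cum_rank_Suc[OF Gam N_pos, of "p i + 1"]
    by (auto simp: add.assoc)
  show ?thesis
  proof (induction i rule: int_induct[of _ 0])
    case (step1 i)
    then show ?case using step[of i] by simp
  next
    case (step2 i)
    then show ?case using step[of "i - 1"] by simp
  qed simp
qed

text \<open>\<open>cum_rank\<close> grows by one along \<open>p\<close> and agrees modulo
  \<open>K\<close> with the rank of the tag at index \<open>0\<close>. This translates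
  \<open>Phi\<close> into \<open>p\<close>.\<close>

lemma particle_pos_p: "particle_pos N \<eta> (rep K (particle_rank \<eta> x + i)) = rep N (p i)"
proof -
  have "K dvd particle_rank \<eta> x + i - cum_rank N K \<eta> (p i)"
    unfolding cum_rank_p[of i] by (simp add: cum_rank_def p_0)
  then have "rep K (particle_rank \<eta> x + i) = rep K (cum_rank N K \<eta> (p i))" by (simp add: rep_eq_iff)
  then show ?thesis using particle_pos_cum_rank[OF Gam N_pos p_occ] by simp
qed

lemma gap_config_eq: "gap_config N K (x, \<eta>) = (\<lambda>l\<in>torus K. 2 - (p l - p (l - 1)))"
proof -
  have "rep N (rep N (p l) - rep N (p (l - 1))) = p l - p (l - 1)" for l
    unfolding rep_diff_rep by (rule rep_id) (use p_gap[of "l - 1"] N in \<open>auto simp: torus_def\<close>)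
  then show ?thesis
    unfolding gap_config_def Phi_def
    using particle_pos_p by (auto simp: fun_eq_iff restrict_def add_diff_eq[symmetric])
qed

text \<open>Gaps are \<open>K\<close>-periodic in the index, so the formula extends to all integers
  and wrap-around disappears from later arguments.\<close>

lemma gap_config_rep: "gap_config N K (x, \<eta>) (rep K i) = 2 - (p i - p (i - 1))"
proof -
  obtain c where c: "rep K i = i + c * K"
    using rep_dvd[of K i] by (metis dvd_def add.commute diff_add_cancel mult.commute)
  have "rep K i - 1 = (i - 1) + c * K" using c by simp
  then have "p (rep K i) = p i + c * N" "p (rep K i - 1) = p (i - 1) + c * N"
    using c p_period_mult by metis+
  then show ?thesis using rep_in_torus[OF K_pos, of i] unfolding gap_config_eq by simp
qed

lemma gap_config_01: "l \<in> torus K \<Longrightarrow> gap_config N K (x, \<eta>) l = 0 \<or> gap_config N K (x, \<eta>) l = 1"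
  unfolding gap_config_eq using p_gap[of "l - 1"] by auto

text \<open>The \<open>K\<close> gaps of one period telescope to \<open>N\<close>, and each entry is
  \<open>2\<close> minus a gap.\<close>

lemma gap_config_Gam: "gap_config N K (x, \<eta>) \<in> Gam K (2 * K - N)"
proof -
  have tel: "(\<Sum>l\<in>{1..n}. 2 - (p l - p (l - 1))) = 2 * n - (p n - p 0)" if "0 \<le> n" for n :: int
    using that
  proof (induction n rule: int_ge_induct)
    case (step n)
    then have "{1..n + 1} = insert (n + 1) {1..n}" by auto
    then show ?case using step by simp
  qed simp
  have "(\<Sum>l\<in>torus K. gap_config N K (x, \<eta>) l) = (\<Sum>l\<in>{1..K}. 2 - (p l - p (l - 1)))"
    unfolding gap_config_eq torus_def by simp
  also have "\<dots> = 2 * K - N" using tel[of K] p_period[of 0] K_pos by simp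
  finally show ?thesis
    unfolding Gam_def using gap_config_01 by (auto simp: gap_config_eq PiE_def extensional_def)
qed

end

section \<open>Effect of a jump on positions and gaps\<close>

text \<open>Covers tagged and untagged jumps alike, so that the two sums of the generator merge into
  one over all sites.\<close>

definition jump_state :: "int \<Rightarrow> int \<times> config \<Rightarrow> int \<Rightarrow> int \<Rightarrow> int \<times> config" where
  "jump_state N s y z =
     (if y = fst s then rep N (fst s + z) else fst s, exchange y (rep N (y + z)) (snd s))"

lemma fep_gen_eq:
  assumes "x \<in> torus N"
  shows "fep_gen N f (x, \<eta>) =
    (\<Sum>y\<in>torus N. \<Sum>z\<in>{1, -1}. fep_rate N \<eta> y z * (f (jump_state N (x, \<eta>) y z) - f (x, \<eta>)))"
  unfolding fep_gen_def prod.case sum.remove[OF finite_torus assms] jump_state_def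
  by (auto intro!: sum.cong)

text \<open>The signed displacement read off from a pair of states; \<open>3 \<le> N\<close>
  separates the steps to the right and to the left. The value \<open>-1\<close> is also the default
  for all remaining pairs.\<close>

definition tag_step :: "int \<Rightarrow> int \<times> config \<Rightarrow> int \<times> config \<Rightarrow> int" where
  "tag_step N s s' = (if fst s' = fst s then 0 else if fst s' = rep N (fst s + 1) then 1 else -1)"

context tagged_config
begin

lemma shift_neq: "rep N m \<noteq> rep N (m + 1)" "rep N m \<noteq> rep N (m - 1)" "rep N (m + 1) \<noteq> rep N (m - 1)"
  using N zdvd_not_zless[of 1 N] zdvd_not_zless[of 2 N] by (auto simp: rep_eq_iff)

lemma rate_cases:
  "fep_rate N \<eta> (rep N m) z = 0 \<or>
   fep_rate N \<eta> (rep N m) z = 1 \<and> \<eta> (rep N m) = 1 \<and> \<eta> (rep N (m - z)) = 1 \<and> \<eta> (rep N (m + z)) = 0"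
  unfolding fep_rate_def using occ_cases[of m] occ_cases[of "m - z"] occ_cases[of "m + z"] by auto

text \<open>Only \<open>y\<close> loses a particle. Of its neighbours, \<open>y + z\<close> has just
  been filled and \<open>y - z\<close> was occupied because the rate is nonzero, so no two adjacent
  empty sites arise.\<close>

lemma jump_state_tagged:
  assumes y: "y \<in> torus N" and z: "z = 1 \<or> z = -1" and rate: "fep_rate N \<eta> y z \<noteq> 0"
  shows "jump_state N (x, \<eta>) y z \<in> tagged_states N K"
proof -
  let ?v = "rep N (y + z)"
  let ?\<eta>' = "exchange y ?v \<eta>"
  have \<eta>: "\<eta> y = 1" "\<eta> (rep N (y - z)) = 1" "\<eta> ?v = 0"
    using rate_cases[of y z] rate rep_id[OF y] by auto
  have v: "?v \<in> torus N" "?v \<noteq> y" using \<eta> rep_in_torus[OF N_pos] by auto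
  have vals: "?\<eta>' y = 0" "?\<eta>' ?v = 1" "\<And>u. u \<noteq> y \<Longrightarrow> u \<noteq> ?v \<Longrightarrow> ?\<eta>' u = \<eta> u"
    using \<eta> v unfolding exchange_def by auto
  have ge: "u \<noteq> y \<Longrightarrow> \<eta> u \<le> ?\<eta>' u" for u using vals \<eta> by (cases "u = ?v") auto
  have nb: "?\<eta>' (rep N (y + 1)) \<ge> 1" "?\<eta>' (rep N (y - 1)) \<ge> 1"
    using \<eta> vals(2) z ge[of "rep N (y - z)"] shift_neq[of y] rep_id[OF y] by auto
  have "(\<Sum>u\<in>torus N. ?\<eta>' u) = ?\<eta>' y + (?\<eta>' ?v + (\<Sum>u\<in>torus N - {y} - {?v}. ?\<eta>' u))"
    using y v by (simp add: sum.remove[of _ y] sum.remove[of _ ?v])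
  also have "(\<Sum>u\<in>torus N - {y} - {?v}. ?\<eta>' u) = (\<Sum>u\<in>torus N - {y} - {?v}. \<eta> u)"
    by (intro sum.cong refl vals(3)) auto
  also have "?\<eta>' y + (?\<eta>' ?v + \<dots>) = \<eta> y + (\<eta> ?v + \<dots>)" using vals \<eta> by simp
  also have "\<dots> = (\<Sum>u\<in>torus N. \<eta> u)"
    using y v by (simp add: sum.remove[of _ y] sum.remove[of _ ?v])
  finally have "(\<Sum>u\<in>torus N. ?\<eta>' u) = K" using GamD(2)[OF Gam] by simp
  moreover have "?\<eta>' \<in> torus N \<rightarrow>\<^sub>E {0, 1}"
  proof (rule PiE_I)
    fix u assume "u \<in> torus N"
    then show "?\<eta>' u \<in> {0, 1}" using vals GamD(1)[OF Gam, of u] by (cases "u = y"; cases "u = ?v") auto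
  next
    fix u assume u: "u \<notin> torus N"
    then have "u \<noteq> y" "u \<noteq> ?v" using y v by auto
    then show "?\<eta>' u = undefined" using vals(3)[of u] Gam u unfolding Gam_def by (auto dest: PiE_arb)
  qed
  moreover have "?\<eta>' u + ?\<eta>' (rep N (u + 1)) \<ge> 1" if u: "u \<in> torus N" for u
  proof -
    have nonneg: "0 \<le> ?\<eta>' w" if "w \<in> torus N" for w
      using \<open>?\<eta>' \<in> torus N \<rightarrow>\<^sub>E {0, 1}\<close> that by (auto simp: PiE_def Pi_def)
    show ?thesis
    proof (cases "u = y \<or> rep N (u + 1) = y")
      case True
      moreover have "u = rep N (y - 1)" if "rep N (u + 1) = y"
        using rep_rep_diff[of N "u + 1" 1] that rep_id[OF u] by simp
      ultimately show ?thesis using nb nonneg[OF u] nonneg[OF rep_in_torus[OF N_pos], of "u + 1"] by auto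
    next
      case False
      then show ?thesis
        using ge[of u] ge[of "rep N (u + 1)"] tagged_statesD(4)[OF tagged u] by auto
    qed
  qed
  moreover have "(if y = x then ?v else x) \<in> torus N \<and> ?\<eta>' (if y = x then ?v else x) = 1"
    using v x vals \<eta>x ge[of x] \<open>?\<eta>' \<in> torus N \<rightarrow>\<^sub>E {0, 1}\<close> by (auto simp: PiE_def Pi_def)
  ultimately show ?thesis
    unfolding tagged_states_def jump_state_def Erg_def Gam_def by (auto split: if_splits)
qed

lemma tag_step_jump:
  assumes "y \<in> torus N" "z = 1 \<or> z = -1"
  shows "tag_step N (x, \<eta>) (jump_state N (x, \<eta>) y z) = (if y = x then z else 0)"
  using assms shift_neq[of x] rep_id[OF x] unfolding tag_step_def jump_state_def by auto

end

lemma tag_step_refl [simp]: "tag_step N s s = 0"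
  unfolding tag_step_def by simp

text \<open>\<open>a\<close> is controlled only for a nonzero rate, because a jump of rate zero may
  lead outside the state space, where the test function has no bound.\<close>

lemma bounded_gen_term:
  fixes r a b B :: real
  assumes "r = 0 \<or> r = 1" "r \<noteq> 0 \<Longrightarrow> \<bar>a\<bar> \<le> B" "\<bar>b\<bar> \<le> B"
  shows "\<bar>r * (a - b)\<bar> \<le> 2 * B"
  using assms by auto

context enumerated_config
begin

lemma dvd_add_consecutive: "K dvd i \<Longrightarrow> \<not> K dvd i + 1"
  using K by (metis add_diff_cancel_left' dvd_diff zdvd1_eq abs_of_nonneg not_less zero_le_numeral order_trans one_less_numeral_iff semiring_norm(76) linorder_not_le)

text \<open>A nonzero rate forces gap \<open>2\<close> in the direction of the jump and gap
  \<open>1\<close> on the other side. Shifting the residue class of \<open>l\<close> by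
  \<open>z\<close> interchanges these lengths, so all gaps remain \<open>1\<close> or
  \<open>2\<close>.\<close>

lemma enumerates_jump:
  assumes z: "z = 1 \<or> z = -1" and rate: "fep_rate N \<eta> (rep N (p l)) z \<noteq> 0"
  shows "enumerates N K (jump_state N (x, \<eta>) (rep N (p l)) z) (\<lambda>i. p i + (if K dvd i - l then z else 0))"
    (is "enumerates N K ?s ?p")
proof -
  let ?y = "rep N (p l)" and ?v = "rep N (p l + z)"
  have \<eta>: "\<eta> (rep N (p l - z)) = 1" "\<eta> ?v = 0"
    using rate_cases[of "p l" z] rate by auto
  have vy: "?v \<noteq> ?y" using \<eta> p_occ[of l] by auto
  have gaps: "z = 1 \<Longrightarrow> p (l + 1) = p l + 2" "z = 1 \<Longrightarrow> p l = p (l - 1) + 1"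
    "z = -1 \<Longrightarrow> p (l + 1) = p l + 1" "z = -1 \<Longrightarrow> p l = p (l - 1) + 2"
    using occ_after[of l] occ_before[of l] \<eta> by auto
  \<comment> \<open>When the tag jumps, \<open>?p 0\<close> may leave \<open>{1..N}\<close>; only
    its residue is prescribed by \<open>enumerates\<close>.\<close>
  have "rep N (?p 0) = fst ?s"
  proof -
    have "K dvd 0 - l \<longleftrightarrow> ?y = x" using p_cong_iff[of 0 l] p_0 by auto
    then show ?thesis using p_0 rep_rep_add[of N "p 0" z] unfolding jump_state_def by auto
  qed
  moreover have "?p (i + K) = ?p i + N" for i
  proof -
    have "K dvd i + K - l \<longleftrightarrow> K dvd i - l" by (metis add_diff_eq add.commute diff_add_eq dvd_add_triv_left_iff)
    then show ?thesis using p_period[of i] by simp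
  qed
  moreover have "?p (i + 1) = ?p i + 1 \<or> ?p (i + 1) = ?p i + 2" for i
  proof -
    consider "K dvd i - l" | "K dvd i + 1 - l" | "\<not> K dvd i - l" "\<not> K dvd i + 1 - l" by blast
    then show ?thesis
    proof cases
      case 1
      then obtain b where b: "i = l + b * K" by (metis dvd_def add.commute diff_add_cancel mult.commute)
      have "p i = p l + b * N" "p (i + 1) = p (l + 1) + b * N"
        using p_period_mult[of l b] p_period_mult[of "l + 1" b] b by (simp_all add: algebra_simps)
      moreover have "\<not> K dvd i + 1 - l" using dvd_add_consecutive[OF 1] by (simp add: algebra_simps)
      ultimately show ?thesis using 1 gaps z by auto
    next
      case 2
      then obtain b where b: "i + 1 = l + b * K" by (metis dvd_def add.commute diff_add_cancel mult.commute)
      then have i: "i = (l - 1) + b * K" by simp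
      have "p (i + 1) = p l + b * N" unfolding b by (rule p_period_mult)
      moreover have "p i = p (l - 1) + b * N" unfolding i by (rule p_period_mult)
      moreover have "\<not> K dvd i - l" using dvd_add_consecutive[of "i - l"] 2 by (auto simp: algebra_simps)
      ultimately show ?thesis using 2 gaps z by auto
    next
      case 3
      then show ?thesis using p_gap[of i] by simp
    qed
  qed
  moreover have "snd ?s (rep N m) = 1 \<longleftrightarrow> m \<in> range ?p" for m
  proof
    assume occ: "snd ?s (rep N m) = 1"
    show "m \<in> range ?p"
    proof (cases "rep N m = ?v")
      case True
      then obtain b where "m = p l + z + b * N" unfolding rep_eq_iff by (metis dvd_def add.commute diff_add_cancel mult.commute)
      then have "m = ?p (l + b * K)" by (simp add: p_period_mult)
      then show ?thesis by blast
    next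
      case False
      then have ny: "rep N m \<noteq> ?y" and "\<eta> (rep N m) = 1"
        using occ \<eta> vy unfolding jump_state_def exchange_def by (auto split: if_splits)
      then obtain i where i: "m = p i" using p_range by blast
      then have "m = ?p i" using ny p_cong_iff[of i l] by simp
      then show ?thesis by blast
    qed
  next
    assume "m \<in> range ?p"
    then obtain i where i: "m = ?p i" by blast
    show "snd ?s (rep N m) = 1"
    proof (cases "K dvd i - l")
      case True
      then have "rep N m = ?v" using i p_cong_iff[of i l] rep_rep_add[of N "p i" z] rep_rep_add[of N "p l" z] by simp
      then show ?thesis using p_occ[of l] vy unfolding jump_state_def exchange_def by simp
    next
      case False
      then have "rep N m \<noteq> ?y" "rep N m \<noteq> ?v" using i p_cong_iff[of i l] p_occ[of i] \<eta> by auto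
      then show ?thesis using p_occ[of i] i False unfolding jump_state_def exchange_def by simp
    qed
  qed
  ultimately show ?thesis unfolding enumerates_def by blast
qed

text \<open>The entry at \<open>l\<close> drops by \<open>z\<close> and the next one rises by
  \<open>z\<close>. For a permitted jump the two entries differ by exactly \<open>z\<close>, so this
  change swaps them.\<close>

lemma gap_config_jump:
  assumes z: "z = 1 \<or> z = -1" and rate: "fep_rate N \<eta> (rep N (p l)) z \<noteq> 0" and l: "l \<in> torus K"
  shows "gap_config N K (jump_state N (x, \<eta>) (rep N (p l)) z) = exchange l (rep K (l + 1)) (gap_config N K (x, \<eta>))"
proof -
  let ?s = "jump_state N (x, \<eta>) (rep N (p l)) z"
  let ?p = "\<lambda>i. p i + (if K dvd i - l then z else 0)"
  interpret jumped: enumerated_config N K "fst ?s" "snd ?s" ?p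
    by unfold_locales (use N K jump_state_tagged[OF rep_in_torus[OF N_pos] z rate] enumerates_jump[OF z rate] in auto)
  have \<eta>: "\<eta> (rep N (p l - z)) = 1" "\<eta> (rep N (p l + z)) = 0"
    using rate_cases[of "p l" z] rate by auto
  have vals: "gap_config N K (x, \<eta>) l = 2 - (p l - p (l - 1))" "gap_config N K (x, \<eta>) (rep K (l + 1)) = 2 - (p (l + 1) - p l)"
    using gap_config_rep[of l] gap_config_rep[of "l + 1"] rep_id[OF l] by simp_all
  have zz: "2 - (p l - p (l - 1)) - (2 - (p (l + 1) - p l)) = z"
    using occ_after[of l] occ_before[of l] \<eta> z by auto
  have "gap_config N K ?s i = exchange l (rep K (l + 1)) (gap_config N K (x, \<eta>)) i" for i
  proof (cases "i \<in> torus K")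
    case True
    have "gap_config N K ?s i = 2 - (?p i - ?p (i - 1))" using jumped.gap_config_eq True by simp
    also have "\<dots> = gap_config N K (x, \<eta>) i - (if K dvd i - l then z else 0) + (if K dvd i - 1 - l then z else 0)"
      using gap_config_rep[of i] rep_id[OF True] by simp
    also have "K dvd i - l \<longleftrightarrow> i = l" using torus_eqI[OF True l] by auto
    also have "K dvd i - 1 - l \<longleftrightarrow> i = rep K (l + 1)"
      using rep_eq_iff[of K i "l + 1"] rep_id[OF True] by (simp add: algebra_simps)
    finally have e: "gap_config N K ?s i = gap_config N K (x, \<eta>) i - (if i = l then z else 0) + (if i = rep K (l + 1) then z else 0)" .
    have "rep K (l + 1) \<noteq> l" using rep_eq_iff[of K "l + 1" l] rep_id[OF l] K by (auto dest: zdvd_imp_le)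
    then show ?thesis using e vals zz unfolding exchange_def by auto
  next
    case False
    then have "i \<noteq> l" "i \<noteq> rep K (l + 1)" using l rep_in_torus[OF K_pos] by auto
    then show ?thesis using False jumped.gap_config_eq gap_config_eq by (simp add: exchange_def)
  qed
  then show ?thesis by blast
qed

text \<open>The entry at \<open>l\<close> is the occupation of the site before the particle, the
  next entry that of the site after it. Facilitation and exclusion for the particle thus become
  plain exclusion for the gaps.\<close>

lemma rate_env:
  assumes l: "l \<in> torus K"
  shows "fep_rate N \<eta> (rep N (p l)) 1 = real_of_int (gap_config N K (x, \<eta>) l * (1 - gap_config N K (x, \<eta>) (rep K (l + 1))))"
    and "fep_rate N \<eta> (rep N (p l)) (-1) = real_of_int ((1 - gap_config N K (x, \<eta>) l) * gap_config N K (x, \<eta>) (rep K (l + 1)))"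
proof -
  have "gap_config N K (x, \<eta>) l = \<eta> (rep N (p l - 1))" "gap_config N K (x, \<eta>) (rep K (l + 1)) = \<eta> (rep N (p l + 1))"
    using gap_config_rep[of l] gap_config_rep[of "l + 1"] rep_id[OF l] occ_before[of l] occ_after[of l] by simp_all
  then show "fep_rate N \<eta> (rep N (p l)) 1 = real_of_int (gap_config N K (x, \<eta>) l * (1 - gap_config N K (x, \<eta>) (rep K (l + 1))))"
    "fep_rate N \<eta> (rep N (p l)) (-1) = real_of_int ((1 - gap_config N K (x, \<eta>) l) * gap_config N K (x, \<eta>) (rep K (l + 1)))"
    unfolding fep_rate_def using p_occ[of l] by simp_all
qed

lemma rep_p_eq_x_iff: "l \<in> torus K \<Longrightarrow> rep N (p l) = x \<longleftrightarrow> l = K"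
proof -
  assume l: "l \<in> torus K"
  have "rep N (p l) = x \<longleftrightarrow> K dvd l - 0" using p_cong_iff[of l 0] p_0 by simp
  also have "\<dots> \<longleftrightarrow> K dvd l - K" using dvd_add_left_iff[of K K "l - K"] by simp
  also have "\<dots> \<longleftrightarrow> l = K" using torus_eqI[OF l, of K] K unfolding torus_def by auto
  finally show ?thesis .
qed

lemma bij_particles: "bij_betw (\<lambda>l. rep N (p l)) (torus K) {y \<in> torus N. \<eta> y = 1}"
  unfolding bij_betw_def
proof
  show "inj_on (\<lambda>l. rep N (p l)) (torus K)"
    by (rule inj_onI) (use p_cong_iff torus_eqI in blast)
  show "(\<lambda>l. rep N (p l)) ` torus K = {y \<in> torus N. \<eta> y = 1}"
  proof (intro equalityI subsetI)
    fix y assume "y \<in> (\<lambda>l. rep N (p l)) ` torus K"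
    then show "y \<in> {y \<in> torus N. \<eta> y = 1}" using p_occ rep_in_torus[OF N_pos] by auto
  next
    fix y assume "y \<in> {y \<in> torus N. \<eta> y = 1}"
    then have y: "\<eta> (rep N y) = 1" "rep N y = y" using rep_id by auto
    then obtain i where i: "y = p i" using p_range by blast
    have "rep N (p (rep K i)) = y" using p_cong_iff[of "rep K i" i] rep_dvd[of K i] i y by simp
    then show "y \<in> (\<lambda>l. rep N (p l)) ` torus K" using rep_in_torus[OF K_pos, of i] by force
  qed
qed

text \<open>Keeping the displacement of the tag as second argument of \<open>G\<close> yields both
  generator identities at once: ignoring it gives the exclusion process, adding it to a counter
  gives the process with its current.\<close>

lemma fep_gen_env:
  fixes G :: "config \<Rightarrow> int \<Rightarrow> real"
  shows "fep_gen N (\<lambda>s'. G (gap_config N K s') (tag_step N (x, \<eta>) s')) (x, \<eta>) =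
    (let \<sigma> = gap_config N K (x, \<eta>) in
      \<Sum>l\<in>torus K.
        real_of_int (\<sigma> l * (1 - \<sigma> (rep K (l + 1)))) *
          (G (exchange l (rep K (l + 1)) \<sigma>) (if l = K then 1 else 0) - G \<sigma> 0) +
        real_of_int ((1 - \<sigma> l) * \<sigma> (rep K (l + 1))) *
          (G (exchange l (rep K (l + 1)) \<sigma>) (if l = K then -1 else 0) - G \<sigma> 0))"
proof -
  let ?\<sigma> = "gap_config N K (x, \<eta>)"
  let ?g = "\<lambda>s'. G (gap_config N K s') (tag_step N (x, \<eta>) s')"
  let ?t = "\<lambda>y z. fep_rate N \<eta> y z * (?g (jump_state N (x, \<eta>) y z) - ?g (x, \<eta>))"
  have "fep_gen N ?g (x, \<eta>) = (\<Sum>y\<in>torus N. ?t y 1 + ?t y (-1))"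
    unfolding fep_gen_eq[OF x] by simp
  also have "\<dots> = (\<Sum>y\<in>{y \<in> torus N. \<eta> y = 1}. ?t y 1 + ?t y (-1))"
  proof (rule sum.mono_neutral_right)
    show "\<forall>y\<in>torus N - {y \<in> torus N. \<eta> y = 1}. ?t y 1 + ?t y (-1) = 0"
    proof
      fix y assume "y \<in> torus N - {y \<in> torus N. \<eta> y = 1}"
      then have "\<eta> y = 0" using GamD(1)[OF Gam] by auto
      then show "?t y 1 + ?t y (-1) = 0" by (simp add: fep_rate_def)
    qed
  qed auto
  also have "\<dots> = (\<Sum>l\<in>torus K. ?t (rep N (p l)) 1 + ?t (rep N (p l)) (-1))"
    by (rule sum.reindex_bij_betw[OF bij_particles, symmetric])
  also have "\<dots> = (\<Sum>l\<in>torus K.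
        real_of_int (?\<sigma> l * (1 - ?\<sigma> (rep K (l + 1)))) *
          (G (exchange l (rep K (l + 1)) ?\<sigma>) (if l = K then 1 else 0) - G ?\<sigma> 0) +
        real_of_int ((1 - ?\<sigma> l) * ?\<sigma> (rep K (l + 1))) *
          (G (exchange l (rep K (l + 1)) ?\<sigma>) (if l = K then -1 else 0) - G ?\<sigma> 0))"
  proof (rule sum.cong[OF refl])
    fix l assume l: "l \<in> torus K"
    \<comment> \<open>The effect of a jump on gaps is known only for a nonzero rate; otherwise both
      sides vanish.\<close>
    have t: "?t (rep N (p l)) z = fep_rate N \<eta> (rep N (p l)) z *
        (G (exchange l (rep K (l + 1)) ?\<sigma>) (if l = K then z else 0) - G ?\<sigma> 0)" if "z = 1 \<or> z = -1" for z
      using gap_config_jump[OF that _ l] tag_step_jump[OF rep_in_torus[OF N_pos] that, of "p l"] rep_p_eq_x_iff[OF l]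
      by (cases "fep_rate N \<eta> (rep N (p l)) z = 0") auto
    show "?t (rep N (p l)) 1 + ?t (rep N (p l)) (-1) =
        real_of_int (?\<sigma> l * (1 - ?\<sigma> (rep K (l + 1)))) *
          (G (exchange l (rep K (l + 1)) ?\<sigma>) (if l = K then 1 else 0) - G ?\<sigma> 0) +
        real_of_int ((1 - ?\<sigma> l) * ?\<sigma> (rep K (l + 1))) *
          (G (exchange l (rep K (l + 1)) ?\<sigma>) (if l = K then -1 else 0) - G ?\<sigma> 0)"
      unfolding rate_env[OF l, symmetric] t[OF disjI1[OF refl]] t[OF disjI2[OF refl]] by (rule refl)
  qed
  finally show ?thesis by (simp add: Let_def)
qed

lemma fep_gen_ssep: "fep_gen N (\<lambda>s'. f (gap_config N K s')) (x, \<eta>) = ssep_gen K f (gap_config N K (x, \<eta>))"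
  using fep_gen_env[of "\<lambda>\<sigma> _. f \<sigma>"] unfolding ssep_gen_def Let_def
  by (simp add: algebra_simps)

lemma fep_gen_ssep_current:
  "fep_gen N (\<lambda>s'. f (gap_config N K s', j + tag_step N (x, \<eta>) s')) (x, \<eta>) = ssep_current_gen K f (gap_config N K (x, \<eta>), j)"
proof -
  have K1: "rep K (K + 1) = 1" "K \<in> torus K" using K unfolding rep_def torus_def by auto
  show ?thesis
    unfolding fep_gen_env[of "\<lambda>\<sigma> i. f (\<sigma>, j + i)"] Let_def ssep_current_gen_def prod.case
      sum.remove[OF finite_torus K1(2)] K1(1)
    by (auto simp: algebra_simps intro!: sum.cong)
qed

text \<open>The indicator of \<open>s'\<close> vanishes at the current state, so a nonzero value of
  the generator exhibits a jump of positive rate onto \<open>s'\<close>.\<close>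

lemma allowed_jump:
  assumes "fep_gen N (indicator {s'}) (x, \<eta>) \<noteq> 0" "s' \<noteq> (x, \<eta>)"
  obtains l z where "l \<in> torus K" "z = 1 \<or> z = -1"
    "gap_config N K s' = exchange l (rep K (l + 1)) (gap_config N K (x, \<eta>))"
    "fst s' = (if l = K then rep N (x + z) else x)"
    "gap_config N K (x, \<eta>) l = (if z = 1 then 1 else 0)" "gap_config N K (x, \<eta>) (rep K (l + 1)) = (if z = 1 then 0 else 1)"
proof -
  obtain y where y: "y \<in> torus N"
    "(\<Sum>z\<in>{1, -1}. fep_rate N \<eta> y z * (indicator {s'} (jump_state N (x, \<eta>) y z) - indicator {s'} (x, \<eta>))) \<noteq> 0"
    using assms(1) unfolding fep_gen_eq[OF x] by (rule sum.not_neutral_contains_not_neutral)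
  obtain z where z: "z \<in> {1, -1}"
    "fep_rate N \<eta> y z * (indicator {s'} (jump_state N (x, \<eta>) y z) - indicator {s'} (x, \<eta>)) \<noteq> 0"
    using y(2) by (rule sum.not_neutral_contains_not_neutral)
  then have rate: "fep_rate N \<eta> y z \<noteq> 0" and s': "s' = jump_state N (x, \<eta>) y z" and z1: "z = 1 \<or> z = -1"
    using assms(2) by (auto simp: indicator_def split: if_splits)
  have "y \<in> {y \<in> torus N. \<eta> y = 1}" using rate_cases[of y z] rate rep_id[OF y(1)] y(1) by auto
  then obtain l where l: "l \<in> torus K" "y = rep N (p l)"
    using bij_particles unfolding bij_betw_def by blast
  show thesis
  proof (rule that[OF l(1) z1])
    show "gap_config N K s' = exchange l (rep K (l + 1)) (gap_config N K (x, \<eta>))"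
      unfolding s' l(2) by (rule gap_config_jump[OF z1 _ l(1)]) (use rate l(2) in simp)
    show "fst s' = (if l = K then rep N (x + z) else x)"
      unfolding s' jump_state_def using rep_p_eq_x_iff[OF l(1)] l(2) by simp
    show "gap_config N K (x, \<eta>) l = (if z = 1 then 1 else 0)" "gap_config N K (x, \<eta>) (rep K (l + 1)) = (if z = 1 then 0 else 1)"
      using rate_env[OF l(1)] rate l z1 gap_config_01[OF l(1)] gap_config_01[OF rep_in_torus[OF K_pos], of "l + 1"] by auto
  qed
qed

end

text \<open>\<open>N\<close> sites with two directions each, every term being at most
  \<open>2 * B\<close> since rates are \<open>0\<close> or \<open>1\<close>.\<close>

lemma bounded_operator_fep_gen:
  assumes N: "3 \<le> N" and K: "2 \<le> K"
  shows "bounded_operator (tagged_states N K) (fep_gen N) (4 * real_of_int N)"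
proof
  show "0 \<le> 4 * real_of_int N" using N by simp
next
  fix f g :: "int \<times> config \<Rightarrow> real" and s assume "s \<in> tagged_states N K"
  then obtain x \<eta> where s: "s = (x, \<eta>)" "x \<in> torus N" using tagged_statesD(2) by (cases s) blast
  show "fep_gen N (\<lambda>x. f x + g x) s = fep_gen N f s + fep_gen N g s"
    unfolding s(1) fep_gen_eq[OF s(2)] sum.distrib[symmetric]
    by (intro sum.cong refl) (simp add: algebra_simps)
next
  fix f :: "int \<times> config \<Rightarrow> real" and s c assume "s \<in> tagged_states N K"
  then obtain x \<eta> where s: "s = (x, \<eta>)" "x \<in> torus N" using tagged_statesD(2) by (cases s) blast
  show "fep_gen N (\<lambda>x. c * f x) s = c * fep_gen N f s"
    unfolding s(1) fep_gen_eq[OF s(2)] sum_distrib_left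
    by (intro sum.cong refl) (simp add: algebra_simps)
next
  fix f :: "int \<times> config \<Rightarrow> real" and B s
  assume f: "\<And>s. s \<in> tagged_states N K \<Longrightarrow> \<bar>f s\<bar> \<le> B" and "s \<in> tagged_states N K"
  then obtain x \<eta> where s: "s = (x, \<eta>)" "(x, \<eta>) \<in> tagged_states N K" by (cases s) blast
  interpret tagged_config N K x \<eta> by unfold_locales fact+
  let ?t = "\<lambda>y z. fep_rate N \<eta> y z * (f (jump_state N (x, \<eta>) y z) - f (x, \<eta>))"
  have t: "\<bar>?t y z\<bar> \<le> 2 * B" if y: "y \<in> torus N" and z: "z = 1 \<or> z = -1" for y z
    by (rule bounded_gen_term)
      (use rate_cases[of y z] rep_id[OF y] jump_state_tagged[OF y z] f s(2) in auto)
  have "\<bar>fep_gen N f s\<bar> = \<bar>\<Sum>y\<in>torus N. ?t y 1 + ?t y (-1)\<bar>"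
    unfolding s(1) fep_gen_eq[OF x] by simp
  also have "\<dots> \<le> (\<Sum>y\<in>torus N. 4 * B)"
  proof (rule order_trans[OF sum_abs sum_mono])
    fix y assume y: "y \<in> torus N"
    show "\<bar>?t y 1 + ?t y (-1)\<bar> \<le> 4 * B"
      using t[OF y, of 1] t[OF y, of "-1"] by (simp only: abs_le_iff) linarith
  qed
  also have "\<dots> = 4 * real_of_int N * B" using N by (simp add: torus_def)
  finally show "\<bar>fep_gen N f s\<bar> \<le> 4 * real_of_int N * B" .
qed

lemma (in tagged_config) ex_enumerated: "\<exists>p. enumerated_config N K x \<eta> p"
  using ex_enumeration tagged_config_axioms
  unfolding enumerated_config_def enumerated_config_axioms_def by blast

section \<open>The current through the edge between \<open>K\<close> and \<open>1\<close>\<close>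

definition edge_crossing :: "int \<Rightarrow> int \<Rightarrow> config \<Rightarrow> config \<Rightarrow> bool" where
  "edge_crossing a b \<sigma> \<sigma>' \<longleftrightarrow> \<sigma> a = 1 \<and> \<sigma> b = 0 \<and> \<sigma>' = exchange a b \<sigma>"

text \<open>For \<open>3 \<le> K\<close> only the edge between \<open>K\<close> and \<open>1\<close>
  contains both of these sites. An exchange through another edge alters at most one of them, whereas
  a crossing alters both.\<close>

lemma (in tagged_config) allowed_jump_current:
  assumes K3: "3 \<le> K" and jump: "fep_gen N (indicator {s'}) (x, \<eta>) \<noteq> 0" "s' \<noteq> (x, \<eta>)"
  shows "[fst s' - x = of_bool (edge_crossing K 1 (gap_config N K (x, \<eta>)) (gap_config N K s')) -
    of_bool (edge_crossing 1 K (gap_config N K (x, \<eta>)) (gap_config N K s'))] (mod N)"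
proof -
  obtain p where "enumerated_config N K x \<eta> p" using ex_enumerated by blast
  then interpret enumerated_config N K x \<eta> p .
  let ?\<sigma> = "gap_config N K (x, \<eta>)"
  obtain l z where l: "l \<in> torus K" and z: "z = 1 \<or> z = -1"
    and \<sigma>': "gap_config N K s' = exchange l (rep K (l + 1)) ?\<sigma>"
    and x': "fst s' = (if l = K then rep N (x + z) else x)"
    and \<sigma>: "?\<sigma> l = (if z = 1 then 1 else 0)" "?\<sigma> (rep K (l + 1)) = (if z = 1 then 0 else 1)"
    by (rule allowed_jump[OF jump])
  show ?thesis
  proof (cases "l = K")
    case True
    have "rep K (K + 1) = 1" using K unfolding rep_def by simp
    moreover have "exchange 1 K ?\<sigma> = exchange K 1 ?\<sigma>" unfolding exchange_def using K3 by (auto simp: fun_upd_twist)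
    ultimately have "of_bool (edge_crossing K 1 ?\<sigma> (gap_config N K s')) - of_bool (edge_crossing 1 K ?\<sigma> (gap_config N K s')) = z"
      using True z \<sigma> \<sigma>' unfolding edge_crossing_def by auto
    moreover have "[fst s' - x = z] (mod N)"
      using rep_dvd[of N "x + z"] True x' by (simp add: cong_iff_dvd_diff algebra_simps)
    ultimately show ?thesis by simp
  next
    case False
    then have "1 \<le> l" "l < K" using l unfolding torus_def by auto
    then have l1: "rep K (l + 1) = l + 1" by (intro rep_id) (auto simp: torus_def)
    have "\<not> edge_crossing K 1 ?\<sigma> (gap_config N K s')"
    proof
      assume "edge_crossing K 1 ?\<sigma> (gap_config N K s')"
      then have "gap_config N K s' K \<noteq> ?\<sigma> K" "gap_config N K s' 1 \<noteq> ?\<sigma> 1"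
        unfolding edge_crossing_def using K3 by (auto simp: exchange_def)
      then have "K = l \<or> K = l + 1" "1 = l \<or> 1 = l + 1"
        unfolding \<sigma>' l1 exchange_def by (auto split: if_splits)
      then show False using K3 \<open>1 \<le> l\<close> \<open>l < K\<close> by auto
    qed
    moreover have "\<not> edge_crossing 1 K ?\<sigma> (gap_config N K s')"
    proof
      assume "edge_crossing 1 K ?\<sigma> (gap_config N K s')"
      then have "gap_config N K s' K \<noteq> ?\<sigma> K" "gap_config N K s' 1 \<noteq> ?\<sigma> 1"
        unfolding edge_crossing_def using K3 by (auto simp: exchange_def)
      then have "K = l \<or> K = l + 1" "1 = l \<or> 1 = l + 1"
        unfolding \<sigma>' l1 exchange_def by (auto split: if_splits)
      then show False using K3 \<open>1 \<le> l\<close> \<open>l < K\<close> by auto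
    qed
    ultimately show ?thesis using x' False by simp
  qed
qed

text \<open>A crossing changes the image configuration, so it can happen only at a jump time of
  \<open>p\<close>; jumps of \<open>p\<close> that leave the image unchanged contribute
  zero.\<close>

lemma path_current_eq_jump_sum:
  assumes p: "cadlag_path p" and K: "2 \<le> K"
  shows "path_current K (\<lambda>u. f (p u)) t =
    jump_sum (\<lambda>s s'. of_bool (edge_crossing K 1 (f s) (f s')) - of_bool (edge_crossing 1 K (f s) (f s'))) p 0 t"
proof -
  let ?I = "jump_times p \<inter> {0<..t}"
  have fin: "finite ?I" by (rule finite_jump_times[OF p order_refl])
  have c: "crossings (\<lambda>u. f (p u)) t a b = {u \<in> ?I. edge_crossing a b (f (left_value p u)) (f (p u))}"
    if "a \<noteq> b" for a b
  proof -
    have "u \<in> jump_times p" if "0 < u" "edge_crossing a b (f (left_value p u)) (f (p u))" for u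
    proof (rule ccontr)
      assume "u \<notin> jump_times p"
      then have "left_value p u = p u" using \<open>0 < u\<close> unfolding jump_times_def by simp
      then have "edge_crossing a b (f (p u)) (f (p u))" using that by simp
      then have "exchange a b (f (p u)) a = f (p u) a" "f (p u) a = 1" "f (p u) b = 0"
        unfolding edge_crossing_def by auto
      then show False using \<open>a \<noteq> b\<close> by (simp add: exchange_def)
    qed
    then show ?thesis
      unfolding crossings_def edge_crossing_def using left_value_comp[OF p, where f = f] by auto
  qed
  have "int (card {u \<in> ?I. P u}) = (\<Sum>u\<in>?I. of_bool (P u))" for P
    using fin by (simp add: of_bool_def sum.If_cases Int_def)
  then show ?thesis
    unfolding path_current_def jump_sum_def using K by (simp add: c sum_subtractf)
qed

lemma jump_sum_cong_mod:
  "(\<And>u. u \<in> jump_times p \<Longrightarrow> [d (left_value p u) (p u) = d' (left_value p u) (p u)] (mod m)) \<Longrightarrow>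
    [jump_sum d p a b = jump_sum d' p a b] (mod m)"
  unfolding jump_sum_def by (intro cong_sum) auto

text \<open>Reconciles the prescribed initial rank \<open>k\<close> with the rank recomputed from
  the site: both index the same particle, hence agree modulo \<open>K\<close>.\<close>

lemma (in tagged_config) gap_config_particle_pos:
  assumes k: "k \<in> torus K" and x_eq: "x = particle_pos N \<eta> k"
  shows "snd (Phi N K (k, \<eta>)) = gap_config N K (x, \<eta>)"
proof -
  obtain p where "enumerated_config N K x \<eta> p" using ex_enumerated by blast
  then interpret enumerated_config N K x \<eta> p .
  have "rep N (p (k - particle_rank \<eta> x)) = rep N (p 0)"
    using particle_pos_p[of "k - particle_rank \<eta> x"] rep_id[OF k] x_eq p_0 by simp
  then have "K dvd k - particle_rank \<eta> x" by (simp add: p_cong_iff)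
  then have "k = particle_rank \<eta> x"
    by (rule torus_eqI[OF k particle_rank_in_torus[OF Gam x \<eta>x]])
  then show ?thesis by (simp add: gap_config_def)
qed

section \<open>The gap process and the displacement of the tagged particle\<close>

theorem proposition4p2:
  fixes N K k :: int and \<eta> :: config
    and M :: "'w measure"
    and X :: "real \<Rightarrow> 'w \<Rightarrow> int" and H :: "real \<Rightarrow> 'w \<Rightarrow> config"
    and rk :: "real \<Rightarrow> 'w \<Rightarrow> int" and \<sigma> :: "real \<Rightarrow> 'w \<Rightarrow> config"
  assumes NK: "real_of_int N / 2 < real_of_int K" "K < N"
    and init: "k \<in> torus K" "\<eta> \<in> Erg N K"
    and fep: "markov_chain M (tagged_states N K) (fep_gen N) (particle_pos N \<eta> k, \<eta>)
                (\<lambda>t \<omega>. (X t \<omega>, H t \<omega>))"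
    and rk: "\<And>t \<omega>. rk t \<omega> = particle_rank (H t \<omega>) (X t \<omega>)"
    and \<sigma>: "\<And>t \<omega>. \<sigma> t \<omega> = snd (Phi N K (rk t \<omega>, H t \<omega>))"
  shows
    "(\<forall>t\<ge>0. \<forall>\<omega>\<in>space M. fst (Phi N K (rk t \<omega>, H t \<omega>)) = X t \<omega>) \<and>
     markov_chain M (Gam K (2 * K - N)) (ssep_gen K) (snd (Phi N K (k, \<eta>))) \<sigma> \<and>
     (K \<ge> 3 \<longrightarrow>
        (AE \<omega> in M. \<forall>t\<ge>0. [X t \<omega> - X 0 \<omega> = path_current K (\<lambda>s. \<sigma> s \<omega>) t] (mod N))) \<and>
     (K = 2 \<longrightarrow>
        (\<exists>J :: real \<Rightarrow> 'w \<Rightarrow> int.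
           markov_chain M (Gam K (2 * K - N) \<times> UNIV) (ssep_current_gen K)
             (snd (Phi N K (k, \<eta>)), 0) (\<lambda>t \<omega>. (\<sigma> t \<omega>, J t \<omega>)) \<and>
           (AE \<omega> in M. \<forall>t\<ge>0. [X t \<omega> - X 0 \<omega> = J t \<omega>] (mod N))))"
proof -
  let ?S = "tagged_states N K" and ?Y = "\<lambda>t \<omega>. (X t \<omega>, H t \<omega>)"
  let ?x0 = "particle_pos N \<eta> k"
  have N2K: "N < 2 * K" using NK(1) by linarith
  then have N: "3 \<le> N" and K: "2 \<le> K" using NK(2) by auto
  interpret jump_chain M ?S "fep_gen N" "(?x0, \<eta>)" ?Y by unfold_locales fact
  note bdd = bounded_operator_fep_gen[OF N K]
  have \<sigma>_env: "\<sigma> t \<omega> = gap_config N K (X t \<omega>, H t \<omega>)" for t \<omega>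
    unfolding \<sigma> rk gap_config_def by simp
  have config: "tagged_config N K x \<eta>" if "(x, \<eta>) \<in> ?S" for x \<eta>
    by unfold_locales (use N K that in auto)
  have ex_enum: "\<exists>p. enumerated_config N K x \<eta> p" if "(x, \<eta>) \<in> ?S" for x \<eta>
    by (rule tagged_config.ex_enumerated[OF config[OF that]])
  have gap_config_Gam: "gap_config N K s \<in> Gam K (2 * K - N)" if "s \<in> ?S" for s
    using ex_enum[of "fst s" "snd s"] enumerated_config.gap_config_Gam[of N K "fst s" "snd s"] that by auto
  have start: "snd (Phi N K (k, \<eta>)) = gap_config N K (?x0, \<eta>)"
  proof -
    have "AE \<omega> in M. ?Y 0 \<omega> = (?x0, \<eta>)" using fep unfolding markov_chain_def by blast
    \<comment> \<open>The membership does not involve \<open>\<omega>\<close>, so in a probability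
      space its almost sure validity is plain truth.\<close>
    then have "AE \<omega> in M. (?x0, \<eta>) \<in> ?S" using AE_space
    proof eventually_elim
      case (elim \<omega>)
      then show ?case using Y_in[of 0 \<omega>] by simp
    qed
    then have "(?x0, \<eta>) \<in> ?S" by simp
    from tagged_config.gap_config_particle_pos[OF config[OF this] init(1) refl] show ?thesis .
  qed

  have pos: "fst (Phi N K (rk t \<omega>, H t \<omega>)) = X t \<omega>" if "0 \<le> t" "\<omega> \<in> space M" for t \<omega>
    unfolding Phi_def rk prod.case fst_conv
    by (rule particle_pos_rank) (use tagged_statesD[OF Y_in[OF that]] in auto)

  have ssep: "markov_chain M (Gam K (2 * K - N)) (ssep_gen K) (snd (Phi N K (k, \<eta>))) \<sigma>"
  proof -
    have "markov_chain M (Gam K (2 * K - N)) (ssep_gen K) (gap_config N K (?x0, \<eta>)) (\<lambda>t \<omega>. gap_config N K (?Y t \<omega>))"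
    proof (rule lumped_markov_chain[OF fep bdd gap_config_Gam])
      fix f s assume "s \<in> ?S"
      then show "fep_gen N (\<lambda>s. f (gap_config N K s)) s = ssep_gen K f (gap_config N K s)"
        using ex_enum[of "fst s" "snd s"] enumerated_config.fep_gen_ssep[of N K "fst s" "snd s"] by auto
    qed (auto intro: finite_subset[OF _ finite_tagged_states])
    moreover have "(\<lambda>t \<omega>. gap_config N K (?Y t \<omega>)) = \<sigma>" using \<sigma>_env by (simp add: fun_eq_iff)
    ultimately show ?thesis using start by simp
  qed

  have tele: "X t \<omega> - X 0 \<omega> = jump_sum (\<lambda>s s'. fst s' - fst s) (\<lambda>t. ?Y t \<omega>) 0 t"
    if "cadlag_path (\<lambda>t. ?Y t \<omega>)" "0 \<le> t" for t \<omega>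
    using jump_sum_telescope[OF that(1) order_refl that(2), of fst] by simp
  have jump_in: "left_value (\<lambda>t. ?Y t \<omega>) u \<in> ?S" "?Y u \<omega> \<in> ?S" "?Y u \<omega> \<noteq> left_value (\<lambda>t. ?Y t \<omega>) u"
    if p: "cadlag_path (\<lambda>t. ?Y t \<omega>)" and w: "\<omega> \<in> space M" and jump: "u \<in> jump_times (\<lambda>t. ?Y t \<omega>)" for u \<omega>
  proof -
    have u: "0 < u" using jump unfolding jump_times_def by simp
    obtain v where "0 < v" "?Y v \<omega> = left_value (\<lambda>t. ?Y t \<omega>) u" by (rule left_value_attained[OF p u])
    then show "left_value (\<lambda>t. ?Y t \<omega>) u \<in> ?S" using Y_in[of v \<omega>] w by simp
    show "?Y u \<omega> \<in> ?S" using Y_in[of u \<omega>] u w by simp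
    show "?Y u \<omega> \<noteq> left_value (\<lambda>t. ?Y t \<omega>) u" using jump unfolding jump_times_def by auto
  qed

  have current: "AE \<omega> in M. \<forall>t\<ge>0. [X t \<omega> - X 0 \<omega> = path_current K (\<lambda>s. \<sigma> s \<omega>) t] (mod N)" if K3: "3 \<le> K"
    using jumps_along_generator[OF fep finite_tagged_states bdd] AE_space
  proof eventually_elim
    case (elim \<omega>)
    let ?p = "\<lambda>t. ?Y t \<omega>"
    have p: "cadlag_path ?p" using elim by blast
    show ?case
    proof (intro allI impI)
      fix t :: real assume t: "0 \<le> t"
      show "[X t \<omega> - X 0 \<omega> = path_current K (\<lambda>s. \<sigma> s \<omega>) t] (mod N)"
        unfolding tele[OF p t] \<sigma>_env path_current_eq_jump_sum[OF p K, of "gap_config N K"]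
      proof (rule jump_sum_cong_mod)
        fix u assume u: "u \<in> jump_times ?p"
        obtain x \<eta> where s: "left_value ?p u = (x, \<eta>)" by force
        have "(x, \<eta>) \<in> ?S" using jump_in(1)[OF p _ u] elim s by simp
        then interpret tagged_config N K x \<eta> by (rule config)
        have "fep_gen N (indicator {?p u}) (x, \<eta>) \<noteq> 0" using elim u s by auto
        then show "[fst (?p u) - fst (left_value ?p u) =
            of_bool (edge_crossing K 1 (gap_config N K (left_value ?p u)) (gap_config N K (?p u))) -
            of_bool (edge_crossing 1 K (gap_config N K (left_value ?p u)) (gap_config N K (?p u)))] (mod N)"
          using allowed_jump_current[OF K3, of "?p u"] jump_in(3)[OF p _ u] elim s by simp
      qed
    qed
  qed

  have lifted: "\<exists>J. markov_chain M (Gam K (2 * K - N) \<times> UNIV) (ssep_current_gen K)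
      (snd (Phi N K (k, \<eta>)), 0) (\<lambda>t \<omega>. (\<sigma> t \<omega>, J t \<omega>)) \<and>
      (AE \<omega> in M. \<forall>t\<ge>0. [X t \<omega> - X 0 \<omega> = J t \<omega>] (mod N))" if K2: "K = 2"
  proof -
    have N3: "N = 3" using K2 NK(2) N2K by simp
    obtain J where J: "markov_chain M (?S \<times> UNIV) (lift_op (tag_step N) (fep_gen N)) ((?x0, \<eta>), 0) (\<lambda>t \<omega>. (?Y t \<omega>, J t \<omega>))"
      "AE \<omega> in M. cadlag_path (\<lambda>t. ?Y t \<omega>) \<and> (\<forall>t\<ge>0. J t \<omega> = jump_sum (tag_step N) (\<lambda>t. ?Y t \<omega>) 0 t)"
      by (rule jump_sum_markov_chain[OF fep finite_tagged_states bdd tag_step_refl])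
    let ?\<pi> = "\<lambda>x. (gap_config N K (fst x), snd x :: int)"
    have "markov_chain M (Gam K (2 * K - N) \<times> UNIV) (ssep_current_gen K) (?\<pi> ((?x0, \<eta>), 0)) (\<lambda>t \<omega>. ?\<pi> (?Y t \<omega>, J t \<omega>))"
    proof (rule lumped_markov_chain[OF J(1) bounded_operator_lift[OF bdd]])
      fix s assume "s \<in> ?S \<times> (UNIV :: int set)"
      then show "?\<pi> s \<in> Gam K (2 * K - N) \<times> UNIV" using gap_config_Gam by auto
    next
      fix x :: "config \<times> int"
      \<comment> \<open>The counter is part of the image, so fibres are finite although the lifted
        state space is not.\<close>
      have "{s \<in> ?S \<times> UNIV. ?\<pi> s = x} \<subseteq> ?S \<times> {snd x}" by auto
      then show "finite {s \<in> ?S \<times> UNIV. ?\<pi> s = x}"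
        by (rule finite_subset) (simp add: finite_tagged_states)
    next
      fix f s assume "s \<in> ?S \<times> (UNIV :: int set)"
      then obtain x \<eta> j where s: "s = ((x, \<eta>), j)" "(x, \<eta>) \<in> ?S" by auto
      then show "lift_op (tag_step N) (fep_gen N) (\<lambda>s. f (?\<pi> s)) s = ssep_current_gen K f (?\<pi> s)"
        using ex_enum[OF s(2)] enumerated_config.fep_gen_ssep_current[of N K x \<eta> _ f j]
        by (auto simp: lift_op_def)
    qed
    then have "markov_chain M (Gam K (2 * K - N) \<times> UNIV) (ssep_current_gen K)
        (snd (Phi N K (k, \<eta>)), 0) (\<lambda>t \<omega>. (\<sigma> t \<omega>, J t \<omega>))"
      by (simp add: start \<sigma>_env)
    moreover have "AE \<omega> in M. \<forall>t\<ge>0. [X t \<omega> - X 0 \<omega> = J t \<omega>] (mod N)"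
      using J(2) AE_space
    proof eventually_elim
      case (elim \<omega>)
      let ?p = "\<lambda>t. ?Y t \<omega>"
      have p: "cadlag_path ?p" using elim by blast
      show ?case
      proof (intro allI impI)
        fix t :: real assume t: "0 \<le> t"
        have "[jump_sum (\<lambda>s s'. fst s' - fst s) ?p 0 t = jump_sum (tag_step N) ?p 0 t] (mod N)"
        proof (rule jump_sum_cong_mod)
          fix u assume u: "u \<in> jump_times ?p"
          have in3: "fst s \<in> {1, 2, 3}" if "s \<in> ?S" for s
          proof -
            have "fst s \<in> torus 3" using tagged_statesD(2)[of "fst s" "snd s" N K] that N3 by simp
            then have "fst s = 1 \<or> fst s = 2 \<or> fst s = 3" unfolding torus_def by auto
            then show ?thesis by auto
          qed
          \<comment> \<open>With three positions every difference is \<open>0\<close>,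
            \<open>1\<close> or \<open>-1\<close> modulo \<open>3\<close>, so the congruence holds
            for arbitrary pairs of states, permitted jumps or not.\<close>
          have "[fst s' - fst s = tag_step N s s'] (mod N)" if "s \<in> ?S" "s' \<in> ?S" for s s'
            using in3[OF that(1)] in3[OF that(2)] N3 by (auto simp: tag_step_def rep_def cong_def)
          then show "[fst (?p u) - fst (left_value ?p u) = tag_step N (left_value ?p u) (?p u)] (mod N)"
            using jump_in[OF p _ u] elim by blast
        qed
        then show "[X t \<omega> - X 0 \<omega> = J t \<omega>] (mod N)" using elim t tele[OF p t] by simp
      qed
    qed
    ultimately show ?thesis by blast
  qed
  show ?thesis using pos ssep current lifted by blast
qed

end
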